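(* Let $\mathcal{X} = \mathbb{R}^d$, $\mathcal{Y} = \mathbb{R}$ and let $\mathcal{G}$ be a compact group with an orthogonal representation $\phi$ on $\mathcal{X}$. Let $X \sim \mathcal{N}(0, \sigma_X^2 I)$ and $Y = h_\theta(X) + \xi$ where $h_\theta(x) = \theta^\top x$ is $\mathcal{G}$-invariant with $\theta\in\mathbb{R}^d$ and where $\xi$ has mean $0$, variance $\sigma_\xi^2 < \infty$ and is independent of $X$. Let $w$ be the least squares estimate of $\theta$ from i.i.d.~training examples $((X_i, Y_i): i=1, \dots, n)$ distributed independently of and identically to $(X, Y)$ and let $A$ be the orthogonal complement of the subspace of $\mathcal{G}$-invariant linear predictors. \begin{itemize} \item If $n > d + 1$ then the generalisation gap satisfies \[ \mathbb{E}\left[R[h_w] - R[h_{\bar{w}}]\right] = \sigma_\xi^2\frac{\dim A}{n - d - 1}. \] \item At the interpolation threshold $n \in [d-1, d+1]$, if $h_w$ is not $\mathcal{G}$-invariant then the generalisation gap diverges to $\infty$. \item If $n < d- 1$ the generalisation gap is \[ \mathbb{E}\left[R[h_w] - R[h_{\bar{w}}]\right] = \dim A \left( \sigma_X^2 \|\theta\|_2^2\frac{n(d-n)}{d(d-1)(d+2)} + \sigma_\xi^2\frac{n}{d(d - n - 1)} \right) . \] \end{itemize} The expectations are over the training sample. Each of the three statements in the list above continues to hold with $\ge$ in place of $=$ (respectively, the divergence still holds) when $h_{\bar{w}}$ is replaced by any predictor $h'$ such that $R[h'] \le R[h_{\bar{w}}]$.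
   Context: $h_w(x)=w^\top x$ denotes the linear predictor with parameter $w\in\mathbb{R}^d$. The risk of a predictor $f$ is $R[f]=\mathbb{E}[(f(X)-Y)^2]$ (conditional on any randomness in $f$). $\lambda$ is the normalised Haar measure on $\mathcal{G}$, and $\bar{w} = \Phi(w)$ where $\Phi(w) = \int_\mathcal{G} \phi(g) w \, d\lambda(g)$, so that $h_{\bar w}$ is the orbit-averaged (invariant) version of $h_w$: $h_{\bar w}(x)=\int_\mathcal{G} h_w(\phi(g)x)\,d\lambda(g)$. The least squares estimate is the minimum-norm solution $w=(\mathbf{X}^\top\mathbf{X})^+\mathbf{X}^\top\mathbf{Y}$ with $\mathbf{X}\in\mathbb{R}^{n\times d}$, $\mathbf{Y}\in\mathbb{R}^n$ the row-stacked training inputs/outputs. The orthogonal complement is taken with respect to the inner product $\langle a,b\rangle = a^\top \mathbb{E}[XX^\top] b$ on parameters (here proportional to the Euclidean one); $\dim A = d - \dim\{w: \Phi(w)=w\}$.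
   Formalization: At the interpolation threshold, divergence is stated for noise variance σ_ξ² > 0 and h_w not almost surely invariant, since with σ_ξ = 0 and n = d−1 the gap is finite; throughout, σ_X > 0 is assumed so that X is non-degenerate. *)

theory Defs
  imports "HOL-Probability.Probability"
begin

definition gauss_iso :: "real \<Rightarrow> (real^'d) measure" where
  "gauss_iso \<sigma> = density lborel (\<lambda>x. ennreal (\<Prod>i\<in>UNIV. normal_density 0 \<sigma> (x $ i)))"

definition joint_law :: "real \<Rightarrow> real measure \<Rightarrow> ((real^'d) \<times> real) measure" where
  "joint_law \<sigma>X \<mu>\<xi> = gauss_iso \<sigma>X \<Otimes>\<^sub>M \<mu>\<xi>"

definition risk :: "real \<Rightarrow> real measure \<Rightarrow> real^'d \<Rightarrow> (real^'d \<Rightarrow> real) \<Rightarrow> real" where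
  "risk \<sigma>X \<mu>\<xi> \<theta> f = (\<integral>z. (f (fst z) - (\<theta> \<bullet> fst z + snd z))\<^sup>2 \<partial>joint_law \<sigma>X \<mu>\<xi>)"

text \<open>Loss of a predictor on the full training sample z_i = (X_i, xi_i), i < n, Y_i = theta.X_i + xi_i.\<close>
definition sample_loss :: "real^'d \<Rightarrow> nat \<Rightarrow> (nat \<Rightarrow> (real^'d) \<times> real) \<Rightarrow> real^'d \<Rightarrow> real" where
  "sample_loss \<theta> n S w = (\<Sum>i<n. (w \<bullet> fst (S i) - (\<theta> \<bullet> fst (S i) + snd (S i)))\<^sup>2)"

text \<open>Minimum-norm least squares estimate (= (X^T X)^+ X^T Y).\<close>
definition lsq :: "real^'d \<Rightarrow> nat \<Rightarrow> (nat \<Rightarrow> (real^'d) \<times> real) \<Rightarrow> real^'d" where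
  "lsq \<theta> n S = (THE w. (\<forall>v. sample_loss \<theta> n S w \<le> sample_loss \<theta> n S v) \<and>
       (\<forall>v. (\<forall>u. sample_loss \<theta> n S v \<le> sample_loss \<theta> n S u) \<longrightarrow> norm w \<le> norm v))"

definition sample_law :: "real \<Rightarrow> real measure \<Rightarrow> nat \<Rightarrow> (nat \<Rightarrow> (real^'d) \<times> real) measure" where
  "sample_law \<sigma>X \<mu>\<xi> n = PiM {..<n} (\<lambda>_. joint_law \<sigma>X \<mu>\<xi>)"

definition orbit_avg :: "'g measure \<Rightarrow> ('g \<Rightarrow> real^'d^'d) \<Rightarrow> real^'d \<Rightarrow> real^'d" where
  "orbit_avg H \<phi> w = (\<integral>g. \<phi> g *v w \<partial>H)"

definition inv_params :: "('g \<Rightarrow> real^'d^'d) \<Rightarrow> (real^'d) set" where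
  "inv_params \<phi> = {w. \<forall>g x. w \<bullet> (\<phi> g *v x) = w \<bullet> x}"

text \<open>Normalised Haar measure on a compact group (group written additively via group_add).\<close>
definition haar_prob :: "('g::{topological_group_add, t2_space}) measure \<Rightarrow> bool" where
  "haar_prob H \<longleftrightarrow> prob_space H \<and> sets H = sets borel \<and>
     (\<forall>g S. S \<in> sets borel \<longrightarrow> emeasure H ((\<lambda>h. g + h) ` S) = emeasure H S)"

end

theory Submission
  imports Defs "HOL-Real_Asymp.Real_Asymp"
begin

text \<open>The orbit average \<open>\<Phi>\<close> is the orthogonal projection onto the invariant parameters, so the gap equals
  \<open>\<sigma>X\<^sup>2 |w - \<Phi> w|\<^sup>2 = \<sigma>X\<^sup>2 \<Sum>\<^sub>a (a \<bullet> w)\<^sup>2\<close> with \<open>a\<close> ranging over an orthonormal basis of \<open>A\<close>. Averaging over the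
  noise, \<open>(a \<bullet> w)\<^sup>2\<close> becomes \<open>(a \<bullet> P \<theta>)\<^sup>2 + \<sigma>\<xi>\<^sup>2 a \<bullet> G\<^sup>+ a\<close>, where \<open>P\<close> is the projection onto the row space of the
  design matrix and \<open>G\<^sup>+\<close> the pseudo-inverse of its Gram matrix.

  The expectation of \<open>(a \<bullet> P \<theta>)\<^sup>2\<close> follows from the rotation invariance of the law of \<open>P\<close> and from
  \<open>tr P = tr P\<^sup>2 = n\<close> alone. The entries of \<open>G\<^sup>+\<close> are inverse squared distances \<open>1 / r\<close> of a Gaussian vector from
  an independent subspace: from the span of the other columns if \<open>n \<ge> d\<close>, and of the other rows (after
  averaging over \<open>a\<close>) if \<open>n \<le> d\<close>. Their Laplace transform is \<open>(1 + 2 t \<sigma>X\<^sup>2)\<^bsup>-k/2\<^esup>\<close> with \<open>k\<close> the codimension, and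
  \<open>1 / r = \<integral> exp (- t r) dt\<close> gives \<open>1 / (\<sigma>X\<^sup>2 (k - 2))\<close> for \<open>k \<ge> 3\<close> and divergence for \<open>k \<le> 2\<close>.\<close>

section \<open>Isotropic Gaussian vectors\<close>

text \<open>Expectations are integrals in [0, \<infinity>]: Fubini then asks only for measurability,
  and one computation yields both the finite values and the divergence. The codimension is k = n -
  (d - 1) for columns and k = d - (n - 1) for rows. So k \<le> 2 means that n and d differ by at
  most one, which is the interpolation threshold, and k - 2 is the denominator of the noise term.

  Being invariant, \<theta> is orthogonal to A. Hence the bias a \<bullet> P \<theta> disappears as
  soon as P is the identity, and otherwise only an off-diagonal second moment of P is required.

  The sample size n is a number and not a type, so a design is a function giving its rows, and R^n
  never appears as a vector space. Independence is expressed by overwriting one component (a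
  coordinate, a row, a whole column) with a fresh draw, which leaves the integral unchanged;
  conditioning on the rest is then just an inner integral.\<close>

definition normal_law :: "real \<Rightarrow> real measure" where
  "normal_law \<sigma> = density lborel (\<lambda>x. ennreal (normal_density 0 \<sigma> x))"

lemma sets_normal_law [simp, measurable_cong]: "sets (normal_law \<sigma>) = sets borel"
  by (simp add: normal_law_def)

lemma space_normal_law [simp]: "space (normal_law \<sigma>) = UNIV"
  by (simp add: normal_law_def)

lemma prob_space_normal_law: "\<sigma> > 0 \<Longrightarrow> prob_space (normal_law \<sigma>)"
  unfolding normal_law_def by (rule prob_space_normal_density)

lemma sets_gauss_iso [simp, measurable_cong]: "sets (gauss_iso \<sigma>) = sets borel"
  by (simp add: gauss_iso_def)

lemma space_gauss_iso [simp]: "space (gauss_iso \<sigma>) = UNIV"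
  by (simp add: gauss_iso_def)

lemma borel_measurable_vec_lambda [measurable (raw)]:
  fixes f :: "'a \<Rightarrow> 'd::finite \<Rightarrow> real"
  assumes "\<And>i. (\<lambda>x. f x i) \<in> borel_measurable M"
  shows "(\<lambda>x. \<chi> i. f x i) \<in> borel_measurable M"
  by (subst borel_measurable_euclidean_space)
    (auto simp: Basis_vec_def inner_axis assms)

lemma borel_measurable_vec_nth [measurable (raw)]:
  fixes f :: "'a \<Rightarrow> real^'d"
  assumes "f \<in> borel_measurable M"
  shows "(\<lambda>x. f x $ i) \<in> borel_measurable M"
proof -
  have "(\<lambda>x. f x $ i) = (\<lambda>x. f x \<bullet> axis i 1)" by (simp add: inner_axis)
  with assms show ?thesis by simp
qed

lemma prod_Basis_vec: "(\<Prod>b\<in>(Basis :: (real^'d) set). f b) = (\<Prod>i\<in>UNIV. f (axis i 1))"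
proof -
  have "(Basis :: (real^'d) set) = range (\<lambda>i. axis i 1)"
    by (auto simp: Basis_vec_def)
  moreover have "inj (\<lambda>i. axis i (1::real) :: real^'d)"
    by (auto simp: inj_on_def axis_eq_axis)
  ultimately show ?thesis
    by (metis (no_types, lifting) prod.reindex_cong)
qed

text \<open>Agreement on boxes determines Lebesgue measure. The product form makes Fubini available
  coordinate by coordinate, which is how the independence of Gaussian coordinates enters.\<close>

lemma lborel_vec_eq:
  "(lborel :: (real^'d) measure) = distr (PiM UNIV (\<lambda>_. lborel)) borel (\<lambda>f. \<chi> i. f i)"
proof (rule lborel_eqI)
  interpret product_sigma_finite "\<lambda>_::'d. lborel :: real measure" ..
  fix l u :: "real^'d" assume le: "\<And>b. b \<in> Basis \<Longrightarrow> l \<bullet> b \<le> u \<bullet> b"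
  have le': "l $ i \<le> u $ i" for i
    using le[of "axis i 1"] by (simp add: axis_in_Basis_iff inner_axis)
  have eq: "(\<lambda>f. \<chi> i. f i) -` box l u \<inter> space (PiM UNIV (\<lambda>_. lborel))
      = (\<Pi>\<^sub>E i\<in>UNIV. {l $ i <..< u $ i})"
    by (auto simp: mem_box_cart space_PiM PiE_iff)
  have "emeasure (distr (PiM UNIV (\<lambda>_::'d. lborel)) borel (\<lambda>f. \<chi> i. f i)) (box l u)
      = (\<Prod>i\<in>UNIV. emeasure lborel {l $ i <..< u $ i})"
    by (subst emeasure_distr) (auto simp: eq emeasure_PiM)
  also have "\<dots> = ennreal (\<Prod>b\<in>Basis. (u - l) \<bullet> b)"
    by (simp add: le' prod_Basis_vec inner_axis prod_ennreal)
  finally show "emeasure (distr (PiM UNIV (\<lambda>_::'d. lborel)) borel (\<lambda>f. \<chi> i. f i)) (box l u)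
      = ennreal (\<Prod>b\<in>Basis. (u - l) \<bullet> b)" .
qed simp

lemma nn_integral_gauss_iso_eq_PiM:
  fixes f :: "real^'d \<Rightarrow> ennreal"
  assumes [measurable]: "f \<in> borel_measurable borel"
  shows "(\<integral>\<^sup>+x. f x \<partial>gauss_iso \<sigma>)
    = (\<integral>\<^sup>+g. (\<Prod>i\<in>UNIV. ennreal (normal_density 0 \<sigma> (g i))) * f (\<chi> i. g i) \<partial>PiM UNIV (\<lambda>_. lborel))"
  unfolding gauss_iso_def
  by (subst nn_integral_density, simp, simp, subst lborel_vec_eq, subst nn_integral_distr)
     (auto simp: prod_ennreal)

lemma nn_integral_normal_density [simp]:
  "\<sigma> > 0 \<Longrightarrow> (\<integral>\<^sup>+x. ennreal (normal_density 0 \<sigma> x) \<partial>lborel) = 1"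
  by (subst nn_integral_eq_integral) auto

lemma prob_space_gauss_iso:
  assumes "\<sigma> > 0"
  shows "prob_space (gauss_iso \<sigma> :: (real^'d) measure)"
proof
  interpret product_sigma_finite "\<lambda>_::'d. lborel :: real measure" ..
  have "emeasure (gauss_iso \<sigma> :: (real^'d) measure) UNIV = (\<integral>\<^sup>+(x::real^'d). 1 \<partial>gauss_iso \<sigma>)"
    by simp
  also have "\<dots> = (\<Prod>i\<in>(UNIV::'d set). \<integral>\<^sup>+x. ennreal (normal_density 0 \<sigma> x) \<partial>lborel)"
    by (subst nn_integral_gauss_iso_eq_PiM, simp, subst product_nn_integral_prod [symmetric]) auto
  finally show "emeasure (gauss_iso \<sigma> :: (real^'d) measure) (space (gauss_iso \<sigma>)) = 1"
    using assms by simp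
qed

text \<open>Independence of coordinate \<open>k\<close> from the others, in the form of overwriting
  it by a fresh draw. The vector keeps its type, so it never has to be split into separate factors
  afterwards.\<close>

lemma nn_integral_gauss_iso_resample:
  fixes f :: "real^'d \<Rightarrow> ennreal"
  assumes \<sigma>: "\<sigma> > 0" and [measurable]: "f \<in> borel_measurable borel"
  shows "(\<integral>\<^sup>+x. f x \<partial>gauss_iso \<sigma>)
    = (\<integral>\<^sup>+x. \<integral>\<^sup>+c. f (x + (c - x $ k) *\<^sub>R axis k 1) \<partial>normal_law \<sigma> \<partial>gauss_iso \<sigma>)"
proof -
  interpret product_sigma_finite "\<lambda>_::'d. lborel :: real measure" ..
  define F where "F g = f (\<chi> i. g i)" for g
  define p where "p x = ennreal (normal_density 0 \<sigma> x)" for x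
  have [measurable]: "p \<in> borel_measurable borel" by (simp add: p_def [abs_def])
  have [measurable]: "F \<in> borel_measurable (PiM UNIV (\<lambda>_. borel))"
    unfolding F_def [abs_def] by measurable
  have U: "UNIV = insert k (UNIV - {k})" by auto
  have meas_upd [measurable]:
    "(\<lambda>x. (fst x)(k := snd x)) \<in> PiM (UNIV - {k}) (\<lambda>_. lborel) \<Otimes>\<^sub>M lborel \<rightarrow>\<^sub>M PiM UNIV (\<lambda>_. borel)"
  proof (rule measurable_PiM_single')
    fix i show "(\<lambda>x. ((fst x)(k := snd x)) i) \<in> borel_measurable (PiM (UNIV - {k}) (\<lambda>_. lborel) \<Otimes>\<^sub>M lborel)"
      by (cases "i = k") auto
  qed auto
  have expand: "(\<integral>\<^sup>+g. (\<Prod>i\<in>UNIV. p (g i)) * G g \<partial>PiM UNIV (\<lambda>_. lborel))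
      = (\<integral>\<^sup>+x. (\<Prod>i\<in>UNIV-{k}. p (x i)) * (\<integral>\<^sup>+c. p c * G (x(k := c)) \<partial>lborel) \<partial>PiM (UNIV - {k}) (\<lambda>_. lborel))"
    if [measurable]: "G \<in> borel_measurable (PiM UNIV (\<lambda>_. borel))" for G
  proof -
    have sc: "sets (PiM UNIV (\<lambda>_::'d. borel::real measure)) = sets (PiM UNIV (\<lambda>_. lborel))"
      by (intro sets_PiM_cong) auto
    have [measurable]: "G \<in> borel_measurable (PiM UNIV (\<lambda>_. lborel))"
      using that by (simp add: measurable_cong_sets [OF sc refl])
    have "(\<integral>\<^sup>+g. (\<Prod>i\<in>UNIV. p (g i)) * G g \<partial>PiM UNIV (\<lambda>_. lborel))
      = (\<integral>\<^sup>+x. \<integral>\<^sup>+c. (\<Prod>i\<in>UNIV. p ((x(k := c)) i)) * G (x(k := c)) \<partial>lborel \<partial>PiM (UNIV - {k}) (\<lambda>_. lborel))"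
      by (subst U, subst product_nn_integral_insert) (auto simp: U [symmetric])
    also have "\<dots> = (\<integral>\<^sup>+x. \<integral>\<^sup>+c. (\<Prod>i\<in>UNIV-{k}. p (x i)) * (p c * G (x(k := c))) \<partial>lborel \<partial>PiM (UNIV - {k}) (\<lambda>_. lborel))"
    proof (intro nn_integral_cong)
      fix x c
      have "(\<Prod>i\<in>UNIV. p ((x(k := c)) i)) = p c * (\<Prod>i\<in>UNIV-{k}. p ((x(k := c)) i))"
        by (subst prod.remove [of UNIV k]) auto
      also have "(\<Prod>i\<in>UNIV-{k}. p ((x(k := c)) i)) = (\<Prod>i\<in>UNIV-{k}. p (x i))"
        by (intro prod.cong) auto
      finally show "(\<Prod>i\<in>UNIV. p ((x(k := c)) i)) * G (x(k := c))
          = (\<Prod>i\<in>UNIV-{k}. p (x i)) * (p c * G (x(k := c)))" by (simp add: mult_ac)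
    qed
    also have "\<dots> = (\<integral>\<^sup>+x. (\<Prod>i\<in>UNIV-{k}. p (x i)) * (\<integral>\<^sup>+c. p c * G (x(k := c)) \<partial>lborel) \<partial>PiM (UNIV - {k}) (\<lambda>_. lborel))"
    proof (intro nn_integral_cong nn_integral_cmult)
      fix x :: "'d \<Rightarrow> real" assume "x \<in> space (PiM (UNIV - {k}) (\<lambda>_. lborel))"
      then have "(\<lambda>c. x(k := c)) \<in> lborel \<rightarrow>\<^sub>M PiM UNIV (\<lambda>_. borel)"
        using measurable_compose [OF measurable_Pair1' meas_upd] by simp
      then have [measurable]: "(\<lambda>c. G (x(k := c))) \<in> borel_measurable lborel"
        by (rule measurable_compose) fact
      show "(\<lambda>c. p c * G (x(k := c))) \<in> borel_measurable lborel" by measurable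
    qed
    finally show ?thesis .
  qed
  \<comment> \<open>Averaging over coordinate \<open>k\<close> twice is the same as averaging once,
    because \<open>G\<close> does not depend on that coordinate. So \<open>expand\<close> turns the
    integrals of \<open>F\<close> and of \<open>G\<close> into the same expression.\<close>
  define G where "G g = (\<integral>\<^sup>+c. p c * F (g(k := c)) \<partial>lborel)" for g
  have [measurable]: "(\<lambda>x. (fst x)(k := snd x)) \<in> PiM UNIV (\<lambda>_. borel) \<Otimes>\<^sub>M lborel \<rightarrow>\<^sub>M PiM UNIV (\<lambda>_. borel)"
    by (rule measurable_PiM_single') (auto simp: space_PiM space_pair_measure)
  have [measurable]: "G \<in> borel_measurable (PiM UNIV (\<lambda>_. borel))"
    unfolding G_def [abs_def] by (intro lborel.borel_measurable_nn_integral) measurable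
  have G: "(\<integral>\<^sup>+c. p c * G (x(k := c)) \<partial>lborel) = G x" for x
  proof -
    have "(\<integral>\<^sup>+c. p c * G (x(k := c)) \<partial>lborel) = (\<integral>\<^sup>+c. p c * G x \<partial>lborel)"
      by (simp add: G_def)
    also have "\<dots> = G x" using \<sigma> by (subst nn_integral_multc) (auto simp: p_def [abs_def])
    finally show ?thesis .
  qed
  have "(\<integral>\<^sup>+x. f x \<partial>gauss_iso \<sigma>) = (\<integral>\<^sup>+g. (\<Prod>i\<in>UNIV. p (g i)) * F g \<partial>PiM UNIV (\<lambda>_. lborel))"
    by (subst nn_integral_gauss_iso_eq_PiM) (auto simp: p_def F_def)
  also have "\<dots> = (\<integral>\<^sup>+g. (\<Prod>i\<in>UNIV. p (g i)) * G g \<partial>PiM UNIV (\<lambda>_. lborel))"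
    by (subst (1 2) expand) (auto simp: G, simp add: G_def)
  also have "\<dots> = (\<integral>\<^sup>+x. \<integral>\<^sup>+c. f (x + (c - x $ k) *\<^sub>R axis k 1) \<partial>normal_law \<sigma> \<partial>gauss_iso \<sigma>)"
  proof (subst nn_integral_gauss_iso_eq_PiM)
    interpret N: prob_space "normal_law \<sigma>" using \<sigma> by (rule prob_space_normal_law)
    show "(\<lambda>x. \<integral>\<^sup>+c. f (x + (c - x $ k) *\<^sub>R axis k 1) \<partial>normal_law \<sigma>) \<in> borel_measurable borel"
      by (intro N.borel_measurable_nn_integral) measurable
    have "(\<integral>\<^sup>+c. f ((\<chi> i. g i) + (c - (\<chi> i. g i) $ k) *\<^sub>R axis k 1) \<partial>normal_law \<sigma>) = G g" for g
    proof -
      have "(\<chi> i. g i) + (c - (\<chi> i. g i) $ k) *\<^sub>R axis k 1 = (\<chi> i. (g(k := c)) i)" for c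
        by (simp add: vec_eq_iff axis_def)
      then show ?thesis
        unfolding normal_law_def G_def F_def by (subst nn_integral_density) (auto simp: p_def fun_upd_def)
    qed
    then show "(\<integral>\<^sup>+ g. (\<Prod>i\<in>UNIV. p (g i)) * G g \<partial>Pi\<^sub>M UNIV (\<lambda>_. lborel)) =
      (\<integral>\<^sup>+ g. (\<Prod>i\<in>UNIV. ennreal (normal_density 0 \<sigma> (g i))) *
        (\<integral>\<^sup>+c. f ((\<chi> i. g i) + (c - (\<chi> i. g i) $ k) *\<^sub>R axis k 1) \<partial>normal_law \<sigma>) \<partial>Pi\<^sub>M UNIV (\<lambda>_. lborel))"
      by (simp add: p_def)
  qed
  finally show ?thesis .
qed

text \<open>Uniqueness of Lebesgue measure up to scaling, specialised: weighting with the indicator \<open>g\<close> of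
  the unit ball, which an orthogonal map preserves, Fubini and translation invariance give
  \<open>\<lambda>(B) \<integral>g = \<lambda>(f\<^sup>-\<^sup>1 B) \<integral>g\<close>.\<close>
lemma lborel_distr_orthogonal:
  fixes f :: "'a::euclidean_space \<Rightarrow> 'a"
  assumes f: "orthogonal_transformation f"
  shows "distr lborel borel f = lborel"
proof (rule measure_eqI)
  have lin: "linear f" using f by (rule orthogonal_transformation_linear)
  obtain h where h: "orthogonal_transformation h" "\<And>x. f (h x) = x" "\<And>x. h (f x) = x"
    using f by (metis bij_betw_inv_into_left bij_betw_inv_into_right iso_tuple_UNIV_I
        orthogonal_transformation_bij orthogonal_transformation_inv)
  have [measurable]: "f \<in> borel_measurable borel" "h \<in> borel_measurable borel"
    using h(1) f by (auto intro!: borel_measurable_continuous_onI linear_continuous_on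
        simp: linear_conv_bounded_linear [symmetric] orthogonal_transformation_linear)
  fix B assume "B \<in> sets (distr lborel borel f)"
  then have [measurable]: "B \<in> sets borel" by simp
  define b :: "'a \<Rightarrow> ennreal" where "b = indicator B"
  define g :: "'a \<Rightarrow> ennreal" where "g = indicator (ball 0 1)"
  have [measurable]: "b \<in> borel_measurable borel" "g \<in> borel_measurable borel"
    by (auto simp: b_def g_def intro!: borel_measurable_indicator)
  have g: "g (h x) = g x" "g (-x) = g x" for x
    using h(1) by (auto simp: g_def orthogonal_transformation_norm indicator_def)
  have tr: "(\<integral>\<^sup>+x. F (x + t) \<partial>lborel) = (\<integral>\<^sup>+x. F x \<partial>lborel)"
    if [measurable]: "F \<in> borel_measurable borel" for F and t :: 'a
    using lborel_distr_plus [of t] nn_integral_distr [of "(+) t" lborel borel F]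
    by (simp add: add.commute)
  have reflect: "(\<integral>\<^sup>+x. F (- x) \<partial>lborel) = (\<integral>\<^sup>+x. F x \<partial>lborel)"
    if [measurable]: "F \<in> borel_measurable borel" for F :: "'a \<Rightarrow> ennreal"
  proof -
    have "(lborel :: 'a measure) = distr lborel borel uminus"
      using lborel_affine [of "-1" "0::'a"] by (simp add: density_1)
    from nn_integral_distr [of uminus "lborel :: 'a measure" borel F] this show ?thesis by simp
  qed
  have "emeasure lborel B * (\<integral>\<^sup>+y. g y \<partial>lborel) = (\<integral>\<^sup>+y. g y * (\<integral>\<^sup>+x. b x \<partial>lborel) \<partial>lborel)"
    by (subst nn_integral_multc) (auto simp: b_def mult.commute)
  also have "\<dots> = (\<integral>\<^sup>+y. g y * (\<integral>\<^sup>+x. b (x + f y) \<partial>lborel) \<partial>lborel)"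
    by (subst tr) auto
  also have "\<dots> = (\<integral>\<^sup>+y. \<integral>\<^sup>+x. g y * b (x + f y) \<partial>lborel \<partial>lborel)"
    by (intro nn_integral_cong nn_integral_cmult [symmetric]) measurable
  also have "\<dots> = (\<integral>\<^sup>+x. \<integral>\<^sup>+y. g y * b (x + f y) \<partial>lborel \<partial>lborel)"
    by (rule lborel_pair.Fubini') measurable
  also have "\<dots> = (\<integral>\<^sup>+x. \<integral>\<^sup>+y. g ((y + h x) - h x) * b (f (y + h x)) \<partial>lborel \<partial>lborel)"
    by (simp add: linear_add [OF lin] h add.commute)
  also have "\<dots> = (\<integral>\<^sup>+x. \<integral>\<^sup>+y. g (y - h x) * b (f y) \<partial>lborel \<partial>lborel)"
    by (intro nn_integral_cong tr) measurable
  also have "\<dots> = (\<integral>\<^sup>+y. \<integral>\<^sup>+x. g (y - h x) * b (f y) \<partial>lborel \<partial>lborel)"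
    by (rule lborel_pair.Fubini') measurable
  also have "\<dots> = (\<integral>\<^sup>+y. (\<integral>\<^sup>+x. g (y - h x) \<partial>lborel) * b (f y) \<partial>lborel)"
    by (intro nn_integral_cong nn_integral_multc) measurable
  also have "\<dots> = (\<integral>\<^sup>+y. (\<integral>\<^sup>+x. g x \<partial>lborel) * b (f y) \<partial>lborel)"
  proof (rule nn_integral_cong)
    fix y
    have "(\<integral>\<^sup>+x. g (y - h x) \<partial>lborel) = (\<integral>\<^sup>+x. g (-x + f y) \<partial>lborel)"
    proof (intro nn_integral_cong)
      fix x
      have "y - h x = h (-x + f y)"
        using h by (simp add: linear_diff [OF orthogonal_transformation_linear])
      then show "g (y - h x) = g (-x + f y)" by (simp only: g)
    qed
    also have "\<dots> = (\<integral>\<^sup>+x. g x \<partial>lborel)"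
      using reflect [of "\<lambda>x. g (x + f y)"] tr [of g "f y"] by simp
    finally show "(\<integral>\<^sup>+x. g (y - h x) \<partial>lborel) * b (f y) = (\<integral>\<^sup>+x. g x \<partial>lborel) * b (f y)"
      by simp
  qed
  also have "\<dots> = emeasure (distr lborel borel f) B * (\<integral>\<^sup>+x. g x \<partial>lborel)"
  proof -
    have "(\<integral>\<^sup>+y. b (f y) \<partial>lborel) = emeasure (distr lborel borel f) B"
      using nn_integral_distr [of f lborel borel b] by (simp add: b_def)
    then show ?thesis
      by (subst nn_integral_cmult) (auto simp: mult.commute)
  qed
  finally have eq: "emeasure lborel B * emeasure lborel (ball (0::'a) 1)
      = emeasure (distr lborel borel f) B * emeasure lborel (ball (0::'a) 1)"
    by (simp add: g_def)
  have "emeasure lborel (ball (0::'a) 1) \<noteq> \<infinity>"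
    using emeasure_lborel_ball_finite by (metis less_irrefl)
  moreover have "emeasure lborel (ball (0::'a) 1) \<noteq> 0"
    using emeasure_lborel_ball_finite [of "0::'a" 1] content_ball_pos [of 1 "0::'a"]
    by (auto simp: measure_def)
  ultimately show "emeasure (distr lborel borel f) B = emeasure lborel B"
    using eq by (metis ennreal_mult_cancel_left infinity_ennreal_def mult.commute)
qed simp

lemma prod_normal_density_eq_radial:
  fixes x :: "real^'d"
  shows "(\<Prod>i\<in>UNIV. normal_density 0 \<sigma> (x $ i))
    = (1 / sqrt (2 * pi * \<sigma>\<^sup>2)) ^ CARD('d) * exp (- (norm x)\<^sup>2 / (2 * \<sigma>\<^sup>2))"
proof -
  have "(\<Prod>i\<in>UNIV. normal_density 0 \<sigma> (x $ i))
      = (1 / sqrt (2 * pi * \<sigma>\<^sup>2)) ^ CARD('d) * exp (\<Sum>i\<in>UNIV. - (x $ i)\<^sup>2 / (2 * \<sigma>\<^sup>2))"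
    unfolding normal_density_def by (simp add: prod.distrib exp_sum prod_dividef power_divide)
  also have "(\<Sum>i\<in>UNIV. - (x $ i)\<^sup>2 / (2 * \<sigma>\<^sup>2)) = - (norm x)\<^sup>2 / (2 * \<sigma>\<^sup>2)"
    by (simp add: sum_divide_distrib [symmetric] sum_negf power2_norm_eq_inner inner_vec_def) (simp add: power2_eq_square)
  finally show ?thesis .
qed

lemma borel_measurable_orthogonal_transformation:
  fixes f :: "'a::euclidean_space \<Rightarrow> 'a"
  assumes "orthogonal_transformation f"
  shows "f \<in> borel_measurable borel"
  using assms by (auto intro!: borel_measurable_continuous_onI linear_continuous_on
        simp: linear_conv_bounded_linear [symmetric] orthogonal_transformation_linear)

text \<open>The Gaussian density is a function of the norm and Lebesgue measure is preserved, so a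
  rotation changes neither factor.\<close>

lemma nn_integral_gauss_iso_orthogonal:
  fixes f :: "real^'d \<Rightarrow> real^'d"
  assumes f: "orthogonal_transformation f" and [measurable]: "F \<in> borel_measurable borel"
  shows "(\<integral>\<^sup>+x. F (f x) \<partial>gauss_iso \<sigma>) = (\<integral>\<^sup>+x. F x \<partial>gauss_iso \<sigma>)"
proof -
  define p where "p x = ennreal (\<Prod>i\<in>UNIV. normal_density 0 \<sigma> (x $ i))" for x :: "real^'d"
  have [measurable]: "p \<in> borel_measurable borel" by (simp add: p_def [abs_def])
  have [measurable]: "f \<in> borel_measurable borel"
    using f by (rule borel_measurable_orthogonal_transformation)
  have p: "p (f x) = p x" for x
    using f by (simp add: p_def prod_normal_density_eq_radial orthogonal_transformation_norm)
  have "(\<integral>\<^sup>+x. F (f x) \<partial>gauss_iso \<sigma>) = (\<integral>\<^sup>+x. p (f x) * F (f x) \<partial>lborel)"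
    unfolding gauss_iso_def p by (subst nn_integral_density) (auto simp: p_def)
  also have "\<dots> = (\<integral>\<^sup>+x. p x * F x \<partial>distr lborel borel f)"
    by (subst nn_integral_distr) auto
  also have "\<dots> = (\<integral>\<^sup>+x. F x \<partial>gauss_iso \<sigma>)"
    unfolding gauss_iso_def lborel_distr_orthogonal [OF f]
    by (subst nn_integral_density) (auto simp: p_def)
  finally show ?thesis .
qed

lemma distr_gauss_iso_orthogonal:
  fixes f :: "real^'d \<Rightarrow> real^'d"
  assumes f: "orthogonal_transformation f"
  shows "distr (gauss_iso \<sigma>) (gauss_iso \<sigma>) f = gauss_iso \<sigma>"
proof (rule measure_eqI)
  have [measurable]: "f \<in> borel_measurable borel"
    using f by (rule borel_measurable_orthogonal_transformation)
  fix B assume "B \<in> sets (distr (gauss_iso \<sigma>) (gauss_iso \<sigma>) f)"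
  then have [measurable]: "B \<in> sets borel" by simp
  have "emeasure (distr (gauss_iso \<sigma>) (gauss_iso \<sigma>) f) B = (\<integral>\<^sup>+x. indicator B x \<partial>distr (gauss_iso \<sigma>) (gauss_iso \<sigma>) f)"
    by (subst nn_integral_indicator) auto
  also have "\<dots> = (\<integral>\<^sup>+x. indicator B (f x) \<partial>gauss_iso \<sigma>)"
    by (subst nn_integral_distr) auto
  also have "\<dots> = (\<integral>\<^sup>+x. indicator B x \<partial>gauss_iso \<sigma>)"
    by (rule nn_integral_gauss_iso_orthogonal [OF f]) measurable
  also have "\<dots> = emeasure (gauss_iso \<sigma>) B"
    by (subst nn_integral_indicator) auto
  finally show "emeasure (distr (gauss_iso \<sigma>) (gauss_iso \<sigma>) f) B = emeasure (gauss_iso \<sigma>) B" .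
qed simp

text \<open>Conjugating with a rotation that takes a coordinate axis to \<open>b\<close> turns
  overwriting a coordinate into overwriting the component along \<open>b\<close>.\<close>

lemma nn_integral_gauss_iso_resample_along:
  fixes F :: "real^'d \<Rightarrow> ennreal"
  assumes \<sigma>: "\<sigma> > 0" and b: "norm b = 1" and [measurable]: "F \<in> borel_measurable borel"
  shows "(\<integral>\<^sup>+x. F x \<partial>gauss_iso \<sigma>)
    = (\<integral>\<^sup>+x. \<integral>\<^sup>+c. F (x + (c - b \<bullet> x) *\<^sub>R b) \<partial>normal_law \<sigma> \<partial>gauss_iso \<sigma>)"
proof -
  interpret N: prob_space "normal_law \<sigma>" using \<sigma> by (rule prob_space_normal_law)
  fix k :: 'd
  obtain f :: "real^'d \<Rightarrow> real^'d" where f: "orthogonal_transformation f" "f (axis k 1) = b"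
    using orthogonal_transformation_exists_1 [of "axis k (1::real)" b] b norm_axis_1 by metis
  have lin: "linear f" using f(1) by (rule orthogonal_transformation_linear)
  have [measurable]: "f \<in> borel_measurable borel"
    using f(1) by (rule borel_measurable_orthogonal_transformation)
  define G where "G x = (\<integral>\<^sup>+c. F (x + (c - b \<bullet> x) *\<^sub>R b) \<partial>normal_law \<sigma>)" for x
  have [measurable]: "G \<in> borel_measurable borel"
    unfolding G_def by (intro N.borel_measurable_nn_integral) measurable
  have G: "(\<integral>\<^sup>+c. F (f (y + (c - y $ k) *\<^sub>R axis k 1)) \<partial>normal_law \<sigma>) = G (f y)" for y
  proof -
    have "y $ k = axis k 1 \<bullet> y" by (simp add: inner_axis')
    also have "\<dots> = b \<bullet> f y" using f unfolding orthogonal_transformation_def by metis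
    finally show ?thesis
      by (simp add: G_def linear_add [OF lin] linear_scale [OF lin] f(2))
  qed
  have "(\<integral>\<^sup>+x. F x \<partial>gauss_iso \<sigma>) = (\<integral>\<^sup>+x. F (f x) \<partial>gauss_iso \<sigma>)"
    by (rule nn_integral_gauss_iso_orthogonal [OF f(1), symmetric]) measurable
  also have "\<dots> = (\<integral>\<^sup>+x. G (f x) \<partial>gauss_iso \<sigma>)"
    by (subst nn_integral_gauss_iso_resample [OF \<sigma>, where k = k]) (auto simp: G)
  also have "\<dots> = (\<integral>\<^sup>+x. G x \<partial>gauss_iso \<sigma>)"
    by (rule nn_integral_gauss_iso_orthogonal [OF f(1)]) measurable
  finally show ?thesis by (simp add: G_def)
qed

text \<open>Proper subspaces are Lebesgue null, and null sets stay null under a density. Every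
  general-position statement about the design rests on this.\<close>

lemma AE_gauss_iso_notin_lowdim:
  fixes S :: "(real^'d) set"
  assumes "dim S < CARD('d)"
  shows "AE x in gauss_iso \<sigma>. x \<notin> span S"
proof -
  have "negligible (span S)"
    using assms by (intro negligible_lowdim) (simp add: dim_span)
  then have "AE x in lebesgue. x \<notin> span S"
    by (auto simp: negligible_iff_null_sets intro: AE_not_in)
  moreover have "span S \<in> sets borel"
    by (intro borel_closed closed_subspace subspace_span)
  ultimately have "AE x in lborel. x \<notin> span S"
    by (simp add: AE_completion_iff)
  then show ?thesis
    unfolding gauss_iso_def by (subst AE_density) auto
qed

lemma nn_integral_normal_law_exp_square:
  assumes \<sigma>: "\<sigma> > 0" and t: "t \<ge> 0"
  shows "(\<integral>\<^sup>+c. ennreal (exp (- t * (c + m)\<^sup>2)) \<partial>normal_law \<sigma>)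
    = ennreal (exp (- t / (1 + 2 * t * \<sigma>\<^sup>2) * m\<^sup>2) / sqrt (1 + 2 * t * \<sigma>\<^sup>2))"
proof -
  define s where "s = 1 + 2 * t * \<sigma>\<^sup>2"
  have s: "s > 0" using t by (simp add: s_def add_pos_nonneg)
  \<comment> \<open>Completing the square shows the tilted density to be \<open>K\<close> times the
    normal density with mean \<open>\<mu>\<close> and standard deviation \<open>\<tau>\<close>.
    \<open>K\<close> collects the leftover exponent and the ratio
    \<open>\<tau> / \<sigma> = 1 / sqrt s\<close>, and is the value of the integral.\<close>
  define \<tau> where "\<tau> = \<sigma> / sqrt s"
  define \<mu> where "\<mu> = - (2 * t * \<sigma>\<^sup>2 * m / s)"
  define K where "K = exp (- t / s * m\<^sup>2) / sqrt s"
  have \<tau>: "\<tau> > 0" using s \<sigma> by (simp add: \<tau>_def)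
  have \<tau>2: "\<tau>\<^sup>2 = \<sigma>\<^sup>2 / s" using s by (simp add: \<tau>_def power_divide)
  have expo: "- c\<^sup>2 / (2 * \<sigma>\<^sup>2) + - t * (c + m)\<^sup>2 = - t / s * m\<^sup>2 + - (c - \<mu>)\<^sup>2 / (2 * \<tau>\<^sup>2)" for c
  proof -
    have "- (c - \<mu>)\<^sup>2 / (2 * \<tau>\<^sup>2) = - (s * c + 2 * t * \<sigma>\<^sup>2 * m)\<^sup>2 / (2 * s * \<sigma>\<^sup>2)"
      unfolding \<tau>2 \<mu>_def using s \<sigma> by (simp add: field_simps power2_eq_square)
    moreover have "- c\<^sup>2 / (2 * \<sigma>\<^sup>2) + - t * (c + m)\<^sup>2 + t / s * m\<^sup>2
        = - (s * c + 2 * t * \<sigma>\<^sup>2 * m)\<^sup>2 / (2 * s * \<sigma>\<^sup>2)"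
    proof -
      have "(- c\<^sup>2 / (2 * \<sigma>\<^sup>2) + - t * (c + m)\<^sup>2 + t / s * m\<^sup>2) * (2 * s * \<sigma>\<^sup>2)
        = - c\<^sup>2 * s - t * (c + m)\<^sup>2 * (2 * s * \<sigma>\<^sup>2) + 2 * t * m\<^sup>2 * \<sigma>\<^sup>2"
        using s \<sigma> by (simp add: field_simps)
      also have "\<dots> = - (s * c + 2 * t * \<sigma>\<^sup>2 * m)\<^sup>2"
        unfolding s_def by (simp add: algebra_simps power2_eq_square)
      finally show ?thesis using s \<sigma> by (simp add: field_simps)
    qed
    ultimately show ?thesis by linarith
  qed
  have "exp (- t * (c + m)\<^sup>2) * normal_density 0 \<sigma> c = K * normal_density \<mu> \<tau> c" for c
  proof -
    have "sqrt (2 * pi * \<tau>\<^sup>2) = sqrt (2 * pi * \<sigma>\<^sup>2) / sqrt s"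
      by (simp add: \<tau>2 real_sqrt_divide)
    then have "K * normal_density \<mu> \<tau> c
        = 1 / sqrt (2 * pi * \<sigma>\<^sup>2) * exp (- t / s * m\<^sup>2 + - (c - \<mu>)\<^sup>2 / (2 * \<tau>\<^sup>2))"
      unfolding normal_density_def K_def exp_add using s by simp
    also have "\<dots> = exp (- t * (c + m)\<^sup>2) * normal_density 0 \<sigma> c"
      unfolding normal_density_def expo [symmetric] exp_add by simp
    finally show ?thesis by simp
  qed
  then have "(\<integral>\<^sup>+c. ennreal (exp (- t * (c + m)\<^sup>2)) \<partial>normal_law \<sigma>)
      = (\<integral>\<^sup>+c. ennreal K * ennreal (normal_density \<mu> \<tau> c) \<partial>lborel)"
    unfolding normal_law_def
    by (subst nn_integral_density) (auto simp: ennreal_mult [symmetric] K_def s less_imp_le mult.commute)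
  also have "\<dots> = ennreal K"
    using \<tau> by (subst nn_integral_cmult, simp, subst nn_integral_eq_integral) auto
  finally show ?thesis by (simp add: K_def s_def)
qed

section \<open>Independent families of pairs and their images\<close>

text \<open>The sides \<open>C i\<close> of the test boxes are arbitrary measurable sets of pairs,
  so the indicator is written as a product over \<open>i\<close>. With the first components fixed
  its integral factors over the second ones, and the result factors again over the first
  ones.\<close>

lemma distr_PiM_pair:
  assumes I: "finite I" and A: "prob_space A" and B: "prob_space B"
  shows "distr (PiM I (\<lambda>_. A) \<Otimes>\<^sub>M PiM I (\<lambda>_. B)) (PiM I (\<lambda>_. A \<Otimes>\<^sub>M B)) (\<lambda>(x, y). \<lambda>i\<in>I. (x i, y i))
    = PiM I (\<lambda>_. A \<Otimes>\<^sub>M B)"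
proof -
  interpret A: prob_space A by fact
  interpret B: prob_space B by fact
  interpret AB: pair_prob_space A B ..
  interpret PA: product_sigma_finite "\<lambda>_. A" by unfold_locales
  interpret PB: product_sigma_finite "\<lambda>_. B" by unfold_locales
  interpret PAB: product_sigma_finite "\<lambda>_. A \<Otimes>\<^sub>M B" by unfold_locales
  interpret QB: prob_space "PiM I (\<lambda>_. B)" by (rule prob_space_PiM) unfold_locales
  have m [measurable]: "(\<lambda>(x, y). \<lambda>i\<in>I. (x i, y i))
      \<in> PiM I (\<lambda>_. A) \<Otimes>\<^sub>M PiM I (\<lambda>_. B) \<rightarrow>\<^sub>M PiM I (\<lambda>_. A \<Otimes>\<^sub>M B)"
    unfolding split_beta by (intro measurable_restrict) measurable
  show ?thesis
  proof (rule PAB.PiM_eqI)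
    fix C assume C [measurable]: "\<And>i. i \<in> I \<Longrightarrow> C i \<in> sets (A \<Otimes>\<^sub>M B)"
    have [measurable]: "Pi\<^sub>E I C \<in> sets (PiM I (\<lambda>_. A \<Otimes>\<^sub>M B))"
      using I by (intro sets_PiM_I_finite) auto
    have "emeasure (distr (PiM I (\<lambda>_. A) \<Otimes>\<^sub>M PiM I (\<lambda>_. B)) (PiM I (\<lambda>_. A \<Otimes>\<^sub>M B)) (\<lambda>(x, y). \<lambda>i\<in>I. (x i, y i))) (Pi\<^sub>E I C)
      = (\<integral>\<^sup>+z. indicator (Pi\<^sub>E I C) ((\<lambda>(x, y). \<lambda>i\<in>I. (x i, y i)) z) \<partial>(PiM I (\<lambda>_. A) \<Otimes>\<^sub>M PiM I (\<lambda>_. B)))"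
      by (subst nn_integral_distr [OF m, symmetric]) auto
    also have "\<dots> = (\<integral>\<^sup>+z. (\<Prod>i\<in>I. indicator (C i) (fst z i, snd z i)) \<partial>(PiM I (\<lambda>_. A) \<Otimes>\<^sub>M PiM I (\<lambda>_. B)))"
    proof (intro nn_integral_cong)
      fix z
      show "indicator (Pi\<^sub>E I C) ((\<lambda>(x, y). \<lambda>i\<in>I. (x i, y i)) z)
          = (\<Prod>i\<in>I. indicator (C i) (fst z i, snd z i) :: ennreal)"
      proof (cases "\<forall>i\<in>I. (fst z i, snd z i) \<in> C i")
        case True
        then show ?thesis by (auto simp: split_beta indicator_def)
      next
        case False
        then obtain i where "i \<in> I" "(fst z i, snd z i) \<notin> C i" by auto
        then have "(\<Prod>i\<in>I. indicator (C i) (fst z i, snd z i) :: ennreal) = 0"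
          using I by (intro prod_zero) (auto intro!: bexI [of _ i])
        with False show ?thesis by (auto simp: split_beta indicator_def)
      qed
    qed
    also have "\<dots> = (\<integral>\<^sup>+x. \<integral>\<^sup>+y. (\<Prod>i\<in>I. indicator (C i) (x i, y i)) \<partial>PiM I (\<lambda>_. B) \<partial>PiM I (\<lambda>_. A))"
      by (subst QB.nn_integral_fst [symmetric]) auto
    also have "\<dots> = (\<integral>\<^sup>+x. (\<Prod>i\<in>I. \<integral>\<^sup>+y. indicator (C i) (x i, y) \<partial>B) \<partial>PiM I (\<lambda>_. A))"
      using I by (intro nn_integral_cong PB.product_nn_integral_prod)
        (auto simp: space_PiM PiE_iff intro!: measurable_compose [OF measurable_Pair1'])
    also have "\<dots> = (\<Prod>i\<in>I. \<integral>\<^sup>+x. \<integral>\<^sup>+y. indicator (C i) (x, y) \<partial>B \<partial>A)"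
      using I by (intro PA.product_nn_integral_prod B.borel_measurable_nn_integral) auto
    also have "\<dots> = (\<Prod>i\<in>I. emeasure (A \<Otimes>\<^sub>M B) (C i))"
      by (intro prod.cong refl) (subst B.nn_integral_fst, auto)
    finally show "emeasure (distr (PiM I (\<lambda>_. A) \<Otimes>\<^sub>M PiM I (\<lambda>_. B)) (PiM I (\<lambda>_. A \<Otimes>\<^sub>M B))
        (\<lambda>(x, y). \<lambda>i\<in>I. (x i, y i))) (Pi\<^sub>E I C) = (\<Prod>i\<in>I. emeasure (A \<Otimes>\<^sub>M B) (C i))" .
  qed (use I in auto)
qed

text \<open>Fubini for families of pairs: the design is frozen in the outer integral while the
  noise, or the fresh coefficients of a column, are averaged in the inner one.\<close>

lemma nn_integral_PiM_pair:
  assumes I: "finite I" and A: "prob_space A" and B: "prob_space B"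
    and f [measurable]: "f \<in> borel_measurable (PiM I (\<lambda>_. A \<Otimes>\<^sub>M B))"
  shows "(\<integral>\<^sup>+S. f S \<partial>PiM I (\<lambda>_. A \<Otimes>\<^sub>M B))
    = (\<integral>\<^sup>+x. \<integral>\<^sup>+y. f (\<lambda>i\<in>I. (x i, y i)) \<partial>PiM I (\<lambda>_. B) \<partial>PiM I (\<lambda>_. A))"
proof -
  interpret B: prob_space "PiM I (\<lambda>_. B)" using B by (intro prob_space_PiM)
  have m [measurable]: "(\<lambda>(x, y). \<lambda>i\<in>I. (x i, y i))
      \<in> PiM I (\<lambda>_. A) \<Otimes>\<^sub>M PiM I (\<lambda>_. B) \<rightarrow>\<^sub>M PiM I (\<lambda>_. A \<Otimes>\<^sub>M B)"
    unfolding split_beta by (intro measurable_restrict) measurable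
  have "(\<integral>\<^sup>+S. f S \<partial>PiM I (\<lambda>_. A \<Otimes>\<^sub>M B))
      = (\<integral>\<^sup>+z. f ((\<lambda>(x, y). \<lambda>i\<in>I. (x i, y i)) z) \<partial>(PiM I (\<lambda>_. A) \<Otimes>\<^sub>M PiM I (\<lambda>_. B)))"
    by (subst distr_PiM_pair [OF I A B, symmetric], subst nn_integral_distr) auto
  also have "\<dots> = (\<integral>\<^sup>+x. \<integral>\<^sup>+y. f (\<lambda>i\<in>I. (x i, y i)) \<partial>PiM I (\<lambda>_. B) \<partial>PiM I (\<lambda>_. A))"
    by (subst B.nn_integral_fst [symmetric]) auto
  finally show ?thesis .
qed

text \<open>Lifts a map that produces the law of one row to the whole design. It is applied to
  rotations and to overwriting the component along a vector.\<close>

lemma nn_integral_PiM_distr: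
  assumes I: "finite I" and M: "prob_space M" and M': "prob_space M'"
    and g [measurable]: "g \<in> M \<rightarrow>\<^sub>M M'" and eq: "distr M M' g = M'"
    and f [measurable]: "f \<in> borel_measurable (PiM I (\<lambda>_. M'))"
  shows "(\<integral>\<^sup>+S. f S \<partial>PiM I (\<lambda>_. M')) = (\<integral>\<^sup>+S. f (\<lambda>i\<in>I. g (S i)) \<partial>PiM I (\<lambda>_. M))"
proof -
  have "PiM I (\<lambda>_. M') = distr (PiM I (\<lambda>_. M)) (PiM I (\<lambda>_. M')) (compose I g)"
    by (subst distr_PiM_finite_prob_space') (auto simp: assms)
  then have "(\<integral>\<^sup>+S. f S \<partial>PiM I (\<lambda>_. M'))
      = (\<integral>\<^sup>+S. f S \<partial>distr (PiM I (\<lambda>_. M)) (PiM I (\<lambda>_. M')) (compose I g))" by simp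
  also have "\<dots> = (\<integral>\<^sup>+S. f (compose I g S) \<partial>PiM I (\<lambda>_. M))"
    by (intro nn_integral_distr f, unfold compose_def, intro measurable_restrict) auto
  finally show ?thesis by (simp add: compose_def)
qed

section \<open>The minimum-norm least squares estimate\<close>

text \<open>The operator of \<open>X^T X\<close>, built from the rows so that \<open>n\<close> can
  remain a variable.\<close>

definition gram :: "nat \<Rightarrow> (nat \<Rightarrow> 'a::euclidean_space) \<Rightarrow> 'a \<Rightarrow> 'a" where
  "gram n X v = (\<Sum>i<n. (X i \<bullet> v) *\<^sub>R X i)"

text \<open>The \<open>i\<close>-th column of the pseudo-inverse of the matrix with rows \<open>X 0, \<dots>, X (n - 1)\<close>.\<close>
definition pinv_col :: "nat \<Rightarrow> (nat \<Rightarrow> 'a::euclidean_space) \<Rightarrow> nat \<Rightarrow> 'a" where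
  "pinv_col n X i = (THE u. u \<in> span (X ` {..<n}) \<and> gram n X u = X i)"

text \<open>In matrix notation \<open>X^+ X v\<close>: the least squares fit to noiseless responses,
  which is the orthogonal projection onto the row space.\<close>

definition row_proj :: "nat \<Rightarrow> (nat \<Rightarrow> 'a::euclidean_space) \<Rightarrow> 'a \<Rightarrow> 'a" where
  "row_proj n X v = (\<Sum>i<n. (v \<bullet> X i) *\<^sub>R pinv_col n X i)"

lemma linear_gram: "linear (gram n X)"
  unfolding gram_def
  by (intro linearI) (auto simp: inner_add_right scaleR_add_left sum.distrib scaleR_sum_right)

lemma inner_gram: "u \<bullet> gram n X v = (\<Sum>i<n. (X i \<bullet> u) * (X i \<bullet> v))"
  by (simp add: gram_def inner_sum_right inner_commute mult.commute)

lemma inner_gram_sym: "u \<bullet> gram n X v = gram n X u \<bullet> v"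
  by (subst inner_commute [of "gram n X u"]) (simp add: inner_gram mult.commute)

lemma inner_gram_self: "v \<bullet> gram n X v = (\<Sum>i<n. (X i \<bullet> v)\<^sup>2)"
  by (simp add: inner_gram power2_eq_square)

lemma gram_in_span: "gram n X v \<in> span (X ` {..<n})"
  unfolding gram_def by (intro span_sum span_scale span_base) auto

lemma gram_eq_0D:
  assumes "gram n X v = 0" "i < n"
  shows "X i \<bullet> v = 0"
proof -
  have "(\<Sum>i<n. (X i \<bullet> v)\<^sup>2) = 0" using inner_gram_self [of v n X] assms by simp
  then have "\<forall>i\<in>{..<n}. (X i \<bullet> v)\<^sup>2 = 0" by (subst (asm) sum_nonneg_eq_0_iff) auto
  then show ?thesis using assms by auto
qed

lemma orthogonal_span_rows:
  assumes "\<And>i. i < n \<Longrightarrow> X i \<bullet> v = 0" "u \<in> span (X ` {..<n})"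
  shows "u \<bullet> v = 0"
  using orthogonal_to_span [of u "X ` {..<n}" v] assms
  by (force simp: orthogonal_def inner_commute)

text \<open>A vector annihilated by \<open>gram\<close> is orthogonal to every row; if it also lies
  in their span, it is zero.\<close>

lemma gram_inj_on_span: "inj_on (gram n X) (span (X ` {..<n}))"
proof (rule inj_onI)
  fix u v assume uv: "u \<in> span (X ` {..<n})" "v \<in> span (X ` {..<n})" "gram n X u = gram n X v"
  then have "gram n X (u - v) = 0" by (simp add: linear_diff [OF linear_gram])
  then have "(u - v) \<bullet> (u - v) = 0"
    by (rule orthogonal_span_rows [of n X, OF gram_eq_0D [of n X]]) (auto intro: span_diff uv)
  then show "u = v" by simp
qed

text \<open>In finite dimension injectivity forces surjectivity. The normal equations are therefore
  uniquely solvable inside the row space, which makes the description in \<open>pinv_col\<close>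
  well defined.\<close>

lemma gram_image_span: "gram n X ` span (X ` {..<n}) = span (X ` {..<n})"
proof (rule subspace_dim_equal)
  show "subspace (gram n X ` span (X ` {..<n}))"
    by (intro linear_subspace_image linear_gram subspace_span)
  have "dim (gram n X ` span (X ` {..<n})) = dim (span (X ` {..<n}))"
    by (intro dim_image_eq linear_gram) (simp add: gram_inj_on_span span_span)
  then show "dim (span (X ` {..<n})) \<le> dim (gram n X ` span (X ` {..<n}))" by simp
qed (auto simp: gram_in_span)

lemma pinv_col_ex1:
  assumes "i < n"
  shows "\<exists>!u. u \<in> span (X ` {..<n}) \<and> gram n X u = X i"
proof -
  have "X i \<in> gram n X ` span (X ` {..<n})"
    unfolding gram_image_span using assms by (intro span_base) auto
  then obtain u where "u \<in> span (X ` {..<n})" "gram n X u = X i" by auto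
  then show ?thesis using inj_onD [OF gram_inj_on_span [of n X]] by metis
qed

lemma pinv_col_in_span: "i < n \<Longrightarrow> pinv_col n X i \<in> span (X ` {..<n})"
  and gram_pinv_col: "i < n \<Longrightarrow> gram n X (pinv_col n X i) = X i"
  using theI' [OF pinv_col_ex1 [of i n X]] unfolding pinv_col_def by auto

lemma pinv_col_eqI:
  assumes "i < n" "u \<in> span (X ` {..<n})" "gram n X u = X i"
  shows "pinv_col n X i = u"
  using theI' [OF pinv_col_ex1 [of i n X]] pinv_col_ex1 [of i n X] assms unfolding pinv_col_def by blast

lemma gram_cong: "(\<And>i. i < n \<Longrightarrow> X i = Y i) \<Longrightarrow> gram n X = gram n Y"
  by (auto simp: gram_def fun_eq_iff intro!: sum.cong)

lemma pinv_col_cong: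
  assumes "\<And>i. i < n \<Longrightarrow> X i = Y i" "i < n"
  shows "pinv_col n X i = pinv_col n Y i"
proof -
  have "X ` {..<n} = Y ` {..<n}" using assms by (intro image_cong) auto
  then show ?thesis
    unfolding pinv_col_def using gram_cong [of n X Y] assms by simp
qed

lemma row_proj_cong:
  assumes "\<And>i. i < n \<Longrightarrow> X i = Y i"
  shows "row_proj n X = row_proj n Y"
  unfolding row_proj_def using assms by (intro ext sum.cong) (auto simp: pinv_col_cong [of n X Y])

lemma row_proj_in_span: "row_proj n X v \<in> span (X ` {..<n})"
  unfolding row_proj_def by (intro span_sum span_scale pinv_col_in_span) auto

text \<open>The normal equations for noiseless responses; consequently \<open>row_proj n X v\<close>
  differs from \<open>v\<close> by a vector orthogonal to all rows.\<close>

lemma gram_row_proj: "gram n X (row_proj n X v) = gram n X v"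
  unfolding row_proj_def
  by (simp add: linear_sum [OF linear_gram] linear_scale [OF linear_gram] gram_pinv_col)
     (simp add: gram_def inner_commute)

lemma inner_row_proj_diff: "i < n \<Longrightarrow> X i \<bullet> (row_proj n X v - v) = 0"
  by (rule gram_eq_0D) (auto simp: linear_diff [OF linear_gram] gram_row_proj)

lemma inner_row_proj_eq:
  assumes "u \<in> span (X ` {..<n})"
  shows "u \<bullet> row_proj n X v = u \<bullet> v"
  using orthogonal_span_rows [of n X "row_proj n X v - v" u] inner_row_proj_diff [of _ n X v] assms
  by (simp add: inner_diff_right)

lemma row_proj_eqI:
  assumes "u \<in> span (X ` {..<n})" "\<And>i. i < n \<Longrightarrow> X i \<bullet> u = X i \<bullet> v"
  shows "row_proj n X v = u"
proof -
  have "(row_proj n X v - u) \<bullet> (row_proj n X v - u) = 0"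
  proof (rule orthogonal_span_rows [of n X])
    fix i assume "i < n"
    then have "X i \<bullet> row_proj n X v = X i \<bullet> v"
      by (intro inner_row_proj_eq span_base) auto
    with assms \<open>i < n\<close> show "X i \<bullet> (row_proj n X v - u) = 0" by (simp add: inner_diff_right)
  qed (intro span_diff assms row_proj_in_span)
  then show ?thesis by simp
qed

lemma row_proj_eq_self_iff: "row_proj n X v = v \<longleftrightarrow> v \<in> span (X ` {..<n})"
  using row_proj_eqI [of v X n v] row_proj_in_span [of n X v] by auto

lemma inner_row_proj_sym: "u \<bullet> row_proj n X v = row_proj n X u \<bullet> v"
  using inner_row_proj_eq [OF row_proj_in_span, of n X u v] inner_row_proj_eq [OF row_proj_in_span, of n X v u]
  by (simp add: inner_commute)

lemma norm_row_proj_sq: "(norm (row_proj n X v))\<^sup>2 = v \<bullet> row_proj n X v"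
  using inner_row_proj_eq [OF row_proj_in_span, of n X v v]
  by (simp add: power2_norm_eq_inner inner_commute)

lemma linear_row_proj: "linear (row_proj n X)"
  unfolding row_proj_def
  by (intro linearI) (auto simp: inner_add_left scaleR_add_left sum.distrib scaleR_sum_right)

lemma gram_orthogonal:
  assumes "orthogonal_transformation f"
  shows "gram n (\<lambda>i. f (X i)) (f v) = f (gram n X v)"
proof -
  have "f (X i) \<bullet> f v = X i \<bullet> v" for i
    using assms by (auto simp: orthogonal_transformation_def)
  then show ?thesis
    using orthogonal_transformation_linear [OF assms]
    by (simp add: gram_def linear_sum linear_scale)
qed

lemma pinv_col_orthogonal:
  assumes f: "orthogonal_transformation f" and "i < n"
  shows "pinv_col n (\<lambda>i. f (X i)) i = f (pinv_col n X i)"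
proof (rule pinv_col_eqI)
  have "f (pinv_col n X i) \<in> f ` span (X ` {..<n})"
    using pinv_col_in_span [OF assms(2)] by blast
  also have "f ` span (X ` {..<n}) = span ((\<lambda>i. f (X i)) ` {..<n})"
    using span_linear_image [OF orthogonal_transformation_linear [OF f], of "X ` {..<n}"]
    by (simp add: image_image)
  finally show "f (pinv_col n X i) \<in> span ((\<lambda>i. f (X i)) ` {..<n})" .
qed (use assms in \<open>auto simp: gram_orthogonal gram_pinv_col\<close>)

lemma row_proj_orthogonal:
  assumes f: "orthogonal_transformation f"
  shows "row_proj n (\<lambda>i. f (X i)) (f v) = f (row_proj n X v)"
proof -
  have "f u \<bullet> f v = u \<bullet> v" for u v
    using assms by (auto simp: orthogonal_transformation_def)
  then show ?thesis
    using orthogonal_transformation_linear [OF f]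
    by (simp add: row_proj_def linear_sum linear_scale pinv_col_orthogonal [OF f])
qed

text \<open>The normal equations make the residual at \<open>w\<close> orthogonal to all vectors of
  fitted values, so the cross term vanishes. The identity serves twice: it identifies the least
  squares solutions here, and it completes the square in a Gaussian integral later.\<close>

lemma sum_square_residual_decomp:
  fixes X :: "nat \<Rightarrow> 'a::euclidean_space" and n :: nat and y :: "nat \<Rightarrow> real"
  defines "w \<equiv> \<Sum>i<n. y i *\<^sub>R pinv_col n X i"
  shows "(\<Sum>i<n. (X i \<bullet> v - y i)\<^sup>2) = (\<Sum>i<n. (X i \<bullet> w - y i)\<^sup>2) + (\<Sum>i<n. (X i \<bullet> (v - w))\<^sup>2)"
proof -
  have gram_w: "gram n X (w) = (\<Sum>i<n. y i *\<^sub>R X i)"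
    unfolding w_def by (simp add: linear_sum [OF linear_gram] linear_scale [OF linear_gram] gram_pinv_col)
  have "(\<Sum>i<n. (X i \<bullet> w - y i) * (X i \<bullet> (v - w))) = (\<Sum>i<n. (X i \<bullet> w) * (X i \<bullet> (v - w))) - (\<Sum>i<n. y i *\<^sub>R X i) \<bullet> (v - w)"
    by (simp add: left_diff_distrib sum_subtractf inner_sum_left)
  also have "\<dots> = 0"
    by (simp add: gram_w [symmetric] inner_gram_sym [symmetric]) (simp add: inner_gram)
  finally have 0: "(\<Sum>i<n. (X i \<bullet> w - y i) * (X i \<bullet> (v - w))) = 0" .
  have "(\<Sum>i<n. (X i \<bullet> v - y i)\<^sup>2) = (\<Sum>i<n. (X i \<bullet> w - y i)\<^sup>2 + (X i \<bullet> (v - w))\<^sup>2 + 2 * ((X i \<bullet> w - y i) * (X i \<bullet> (v - w))))"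
    by (intro sum.cong refl) (simp add: inner_diff_right power2_eq_square algebra_simps)
  also have "\<dots> = (\<Sum>i<n. (X i \<bullet> w - y i)\<^sup>2) + (\<Sum>i<n. (X i \<bullet> (v - w))\<^sup>2)"
    using 0 by (simp add: sum.distrib sum_distrib_left [symmetric])
  finally show ?thesis .
qed

text \<open>The minimisers of the loss form \<open>w\<close> plus the kernel of the design. As
  \<open>w\<close> lies in the row space, it is orthogonal to that kernel, and Pythagoras singles it
  out as the unique minimiser of smallest norm.\<close>

lemma lsq_eq_sum_pinv_col:
  "lsq \<theta> n S = (\<Sum>i<n. (\<theta> \<bullet> fst (S i) + snd (S i)) *\<^sub>R pinv_col n (\<lambda>i. fst (S i)) i)"
proof -
  define X where "X i = fst (S i)" for i
  define y where "y i = \<theta> \<bullet> fst (S i) + snd (S i)" for i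
  define w where "w = (\<Sum>i<n. y i *\<^sub>R pinv_col n X i)"
  have w_span: "w \<in> span (X ` {..<n})"
    unfolding w_def by (intro span_sum span_scale pinv_col_in_span) auto
  have loss: "sample_loss \<theta> n S v = sample_loss \<theta> n S w + (\<Sum>i<n. (X i \<bullet> (v - w))\<^sup>2)" for v
  proof -
    have "sample_loss \<theta> n S u = (\<Sum>i<n. (X i \<bullet> u - y i)\<^sup>2)" for u
      by (simp add: sample_loss_def X_def y_def inner_commute)
    then show ?thesis unfolding w_def by (simp only:) (rule sum_square_residual_decomp)
  qed
  have min_iff: "(\<forall>u. sample_loss \<theta> n S v \<le> sample_loss \<theta> n S u) \<longleftrightarrow> (\<forall>i<n. X i \<bullet> (v - w) = 0)" for v
  proof
    assume "\<forall>u. sample_loss \<theta> n S v \<le> sample_loss \<theta> n S u"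
    then have "sample_loss \<theta> n S v \<le> sample_loss \<theta> n S w" by blast
    then have "(\<Sum>i<n. (X i \<bullet> (v - w))\<^sup>2) \<le> 0"
      using loss [of v] by linarith
    then have "(\<Sum>i<n. (X i \<bullet> (v - w))\<^sup>2) = 0"
      by (simp add: antisym sum_nonneg)
    then have "\<forall>i\<in>{..<n}. (X i \<bullet> (v - w))\<^sup>2 = 0" by (subst (asm) sum_nonneg_eq_0_iff) auto
    then show "\<forall>i<n. X i \<bullet> (v - w) = 0" by auto
  next
    assume "\<forall>i<n. X i \<bullet> (v - w) = 0"
    then have "sample_loss \<theta> n S v = sample_loss \<theta> n S w" using loss [of v] by simp
    moreover have "sample_loss \<theta> n S w \<le> sample_loss \<theta> n S u" for u
      by (subst loss [of u]) (simp add: sum_nonneg)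
    ultimately show "\<forall>u. sample_loss \<theta> n S v \<le> sample_loss \<theta> n S u" by simp
  qed
  have pyth: "(norm v)\<^sup>2 = (norm w)\<^sup>2 + (norm (v - w))\<^sup>2" if "\<forall>i<n. X i \<bullet> (v - w) = 0" for v
  proof -
    have "w \<bullet> (v - w) = 0"
      by (rule orthogonal_span_rows [of n X, OF _ w_span]) (use that in auto)
    then show ?thesis
      by (simp add: power2_norm_eq_inner inner_diff_left inner_diff_right inner_commute)
  qed
  have "lsq \<theta> n S = w"
    unfolding lsq_def min_iff
  proof (rule the_equality)
    show "(\<forall>i<n. X i \<bullet> (w - w) = 0) \<and> (\<forall>v. (\<forall>i<n. X i \<bullet> (v - w) = 0) \<longrightarrow> norm w \<le> norm v)"
    proof (intro conjI allI impI)
      fix v assume "\<forall>i<n. X i \<bullet> (v - w) = 0"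
      then have "(norm w)\<^sup>2 \<le> (norm v)\<^sup>2" using pyth [of v] by simp
      then show "norm w \<le> norm v" by (rule power2_le_imp_le) simp
    qed simp
    fix v assume v: "(\<forall>i<n. X i \<bullet> (v - w) = 0) \<and> (\<forall>u. (\<forall>i<n. X i \<bullet> (u - w) = 0) \<longrightarrow> norm v \<le> norm u)"
    then have "norm v \<le> norm w" by (metis diff_self inner_zero_right)
    then have "(norm v)\<^sup>2 \<le> (norm w)\<^sup>2" by (simp add: power_mono)
    moreover have "(norm v)\<^sup>2 = (norm w)\<^sup>2 + (norm (v - w))\<^sup>2" using v by (intro pyth) blast
    ultimately have "(norm (v - w))\<^sup>2 \<le> 0" by linarith
    then show "v = w" by simp
  qed
  then show ?thesis by (simp add: w_def X_def [abs_def] y_def)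
qed

text \<open>The inner integral no longer depends on coordinate \<open>i\<close>, so integrating it
  over that coordinate, of total mass one, restores the full product.\<close>

lemma nn_integral_PiM_resample:
  assumes M: "prob_space M" and I: "finite I" and i: "i \<in> I"
    and f [measurable]: "f \<in> borel_measurable (PiM I (\<lambda>_. M))"
  shows "(\<integral>\<^sup>+X. f X \<partial>PiM I (\<lambda>_. M)) = (\<integral>\<^sup>+X. \<integral>\<^sup>+x. f (X(i := x)) \<partial>M \<partial>PiM I (\<lambda>_. M))"
proof -
  interpret M: prob_space M by fact
  interpret product_sigma_finite "\<lambda>_. M" by unfold_locales
  define J where "J = I - {i}"
  have IJ: "I = insert i J" "finite J" "i \<notin> J" using I i by (auto simp: J_def)
  have upd [measurable]: "(\<lambda>x. (fst x)(i := snd x)) \<in> PiM I (\<lambda>_. M) \<Otimes>\<^sub>M M \<rightarrow>\<^sub>M PiM I (\<lambda>_. M)"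
    by (rule measurable_PiM_single') (use i in \<open>auto simp: space_PiM space_pair_measure PiE_iff extensional_def\<close>)
  define G where "G X = (\<integral>\<^sup>+x. f (X(i := x)) \<partial>M)" for X
  have [measurable]: "G \<in> borel_measurable (PiM I (\<lambda>_. M))"
    unfolding G_def by (intro M.borel_measurable_nn_integral) measurable
  have "(\<integral>\<^sup>+X. f X \<partial>PiM I (\<lambda>_. M)) = (\<integral>\<^sup>+X. G X \<partial>PiM J (\<lambda>_. M))"
    using IJ f by (simp add: product_nn_integral_insert G_def)
  also have "\<dots> = (\<integral>\<^sup>+X. \<integral>\<^sup>+x. G (X(i := x)) \<partial>M \<partial>PiM J (\<lambda>_. M))"
    by (simp add: G_def M.emeasure_space_1)
  also have "\<dots> = (\<integral>\<^sup>+X. G X \<partial>PiM I (\<lambda>_. M))"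
    using IJ \<open>G \<in> borel_measurable (PiM I (\<lambda>_. M))\<close> by (simp add: product_nn_integral_insert)
  finally show ?thesis by (simp add: G_def)
qed

lemma borel_measurable_det:
  fixes A :: "'a \<Rightarrow> real^'d^'d"
  assumes "\<And>p q. (\<lambda>x. A x $ p $ q) \<in> borel_measurable M"
  shows "(\<lambda>x. det (A x)) \<in> borel_measurable M"
  unfolding det_def using assms by (intro borel_measurable_sum borel_measurable_times borel_measurable_prod) auto

text \<open>The pseudo-inverse is the limit of the ridge-regularised inverses, and those are given by
  Cramer's rule.\<close>
lemma borel_measurable_pinv_col [measurable (raw)]:
  fixes Y :: "'a \<Rightarrow> nat \<Rightarrow> real^'d"
  assumes Y: "\<And>j. j < n \<Longrightarrow> (\<lambda>x. Y x j) \<in> borel_measurable M" and i: "i < n"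
  shows "(\<lambda>x. pinv_col n (Y x) i) \<in> borel_measurable M"
proof -
  define \<epsilon> where "\<epsilon> k = 1 / real (Suc k)" for k
  have \<epsilon>: "\<epsilon> k > 0" for k by (simp add: \<epsilon>_def)
  define A :: "nat \<Rightarrow> (nat \<Rightarrow> real^'d) \<Rightarrow> real^'d^'d" where
    "A k X = (\<chi> r c. (\<Sum>j<n. X j $ r * X j $ c) + (if r = c then \<epsilon> k else 0))" for k X
  have A: "A k X *v v = gram n X v + \<epsilon> k *\<^sub>R v" for k X v
  proof (subst vec_eq_iff, intro allI)
    fix r
    have "(A k X *v v) $ r = (\<Sum>c\<in>UNIV. (\<Sum>j<n. X j $ r * X j $ c) * v $ c) + (\<Sum>c\<in>UNIV. (if r = c then \<epsilon> k else 0) * v $ c)"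
      by (simp add: matrix_vector_mult_def A_def distrib_right sum.distrib)
    also have "(\<Sum>c\<in>UNIV. (if r = c then \<epsilon> k else 0) * v $ c) = \<epsilon> k * v $ r"
      by (subst sum.cong [OF refl, where h = "\<lambda>c. if r = c then \<epsilon> k * v $ c else 0"]) auto
    also have "(\<Sum>c\<in>UNIV. (\<Sum>j<n. X j $ r * X j $ c) * v $ c) = (\<Sum>j<n. (\<Sum>c\<in>UNIV. X j $ c * v $ c) * X j $ r)"
      unfolding sum_distrib_right by (subst sum.swap) (simp add: mult_ac)
    finally show "(A k X *v v) $ r = (gram n X v + \<epsilon> k *\<^sub>R v) $ r"
      by (simp add: gram_def inner_vec_def)
  qed
  have det: "det (A k X) \<noteq> 0" for k X
  proof -
    have "v = 0" if "A k X *v v = 0" for v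
    proof -
      have "0 = v \<bullet> gram n X v + \<epsilon> k * (v \<bullet> v)"
        using arg_cong [OF that, of "\<lambda>z. v \<bullet> z"] by (simp add: A inner_add_right)
      moreover have "v \<bullet> gram n X v \<ge> 0" unfolding inner_gram_self by (intro sum_nonneg) auto
      ultimately have "\<epsilon> k * (v \<bullet> v) \<le> 0" by linarith
      then have "v \<bullet> v \<le> 0" using \<epsilon> [of k] by (simp add: mult_le_0_iff)
      then show ?thesis by (metis inner_ge_zero inner_eq_zero_iff antisym)
    qed
    then show ?thesis
      by (metis invertible_det_nz invertible_left_inverse matrix_left_invertible_ker)
  qed
  define r where "r k X = (\<chi> c. det (\<chi> p q. if q = c then X i $ p else A k X $ p $ q) / det (A k X))" for k X
  have Ar: "gram n X (r k X) + \<epsilon> k *\<^sub>R r k X = X i" for k X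
    using cramer [OF det [of k X], of "r k X" "X i"] unfolding A r_def by simp
  have r_meas: "(\<lambda>x. r k (Y x)) \<in> borel_measurable M" for k
  proof -
    have [measurable]: "(\<lambda>x. Y x j $ p) \<in> borel_measurable M" if "j < n" for j p
      using Y [OF that] by measurable
    have [measurable]: "(\<lambda>x. A k (Y x) $ p $ q) \<in> borel_measurable M" for p q
      unfolding A_def vec_lambda_beta
      by (intro borel_measurable_add borel_measurable_sum borel_measurable_times) auto
    show ?thesis
      unfolding r_def
      by (intro borel_measurable_vec_lambda borel_measurable_divide borel_measurable_det) (use i in auto)
  qed
  have lim: "(\<lambda>k. r k X) \<longlonglongrightarrow> pinv_col n X i" for X
  proof -
    define w where "w = pinv_col n X i"
    obtain u where u: "gram n X u = w"
      using gram_image_span [of n X] pinv_col_in_span [OF i, of X] unfolding w_def by (metis imageE)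
    have "norm (r k X - w) \<le> 2 * \<epsilon> k * norm u" for k
    proof -
      \<comment> \<open>The shift by \<open>\<epsilon> k *\<^sub>R u\<close> cancels the first-order
        error: \<open>z\<close> solves the regularised equation with a right-hand side of second
        order. Testing against \<open>z\<close> then bounds its norm without any lower bound on the
        nonzero eigenvalues of \<open>gram\<close>.\<close>
      define z where "z = r k X - w + \<epsilon> k *\<^sub>R u"
      have eq: "gram n X z + \<epsilon> k *\<^sub>R z = (\<epsilon> k)\<^sup>2 *\<^sub>R u"
        using Ar [of X k] gram_pinv_col [OF i, of X] u
        unfolding z_def w_def [symmetric]
        by (simp add: linear_add [OF linear_gram] linear_diff [OF linear_gram] linear_scale [OF linear_gram]
            scaleR_add_right scaleR_diff_right power2_eq_square algebra_simps)
      have "\<epsilon> k * (norm z * norm z) \<le> z \<bullet> gram n X z + \<epsilon> k * (z \<bullet> z)"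
        unfolding inner_gram_self by (simp add: sum_nonneg power2_norm_eq_inner [symmetric] power2_eq_square)
      also have "\<dots> = (\<epsilon> k)\<^sup>2 * (z \<bullet> u)"
        using arg_cong [OF eq, of "\<lambda>v. z \<bullet> v"] by (simp add: inner_add_right)
      also have "\<dots> \<le> (\<epsilon> k)\<^sup>2 * (norm z * norm u)"
        by (intro mult_left_mono norm_cauchy_schwarz) auto
      finally have "\<epsilon> k * (norm z * norm z) \<le> \<epsilon> k * (norm z * (\<epsilon> k * norm u))"
        by (simp add: power2_eq_square mult_ac)
      then have "norm z * norm z \<le> norm z * (\<epsilon> k * norm u)"
        using \<epsilon> [of k] by simp
      then have "norm z \<le> \<epsilon> k * norm u"
        using \<epsilon> [of k] by (cases "z = 0") auto
      moreover have "norm (r k X - w) \<le> norm z + norm (\<epsilon> k *\<^sub>R u)"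
        using norm_triangle_ineq4 [of z "\<epsilon> k *\<^sub>R u"] by (simp add: z_def)
      ultimately show ?thesis using \<epsilon> [of k] by simp
    qed
    moreover have "(\<lambda>k. 2 * \<epsilon> k * norm u) \<longlonglongrightarrow> 2 * 0 * norm u"
      unfolding \<epsilon>_def using LIMSEQ_inverse_real_of_nat
      by (intro tendsto_intros) (simp add: inverse_eq_divide)
    ultimately have "(\<lambda>k. r k X - w) \<longlonglongrightarrow> 0"
      by (intro Lim_null_comparison [of "\<lambda>k. r k X - w" "\<lambda>k. 2 * \<epsilon> k * norm u"]) auto
    then show ?thesis unfolding w_def by (simp add: LIM_zero_iff)
  qed
  show ?thesis
    by (rule borel_measurable_LIMSEQ_metric [OF r_meas]) (rule lim)
qed

lemma borel_measurable_row_proj [measurable (raw)]: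
  fixes Y :: "'a \<Rightarrow> nat \<Rightarrow> real^'d"
  assumes [measurable]: "\<And>j. j < n \<Longrightarrow> (\<lambda>x. Y x j) \<in> borel_measurable M" "v \<in> borel_measurable M"
  shows "(\<lambda>x. row_proj n (Y x) (v x)) \<in> borel_measurable M"
  unfolding row_proj_def
  by (intro borel_measurable_sum borel_measurable_scaleR borel_measurable_inner borel_measurable_pinv_col)
    (auto simp: assms)

section \<open>Rank of the design matrix\<close>

lemma dim_rows_eq:
  fixes X :: "nat \<Rightarrow> 'a::euclidean_space"
  assumes "\<And>i. i < n \<Longrightarrow> X i \<notin> span (X ` {..<i})"
  shows "dim (X ` {..<n}) = n"
  using assms
proof (induction n)
  case (Suc n)
  then have "dim (X ` {..<n}) = n" "X n \<notin> span (X ` {..<n})" by auto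
  then show ?case by (simp add: lessThan_Suc dim_insert)
qed simp

lemma dim_rows_le:
  fixes X :: "nat \<Rightarrow> 'a::euclidean_space"
  shows "finite J \<Longrightarrow> dim (X ` J) \<le> card J"
  using dim_le_card' [of "X ` J"] card_image_le [of J X] by simp

text \<open>Resampling row \<open>i\<close> leaves the earlier rows fixed, and fewer than
  \<open>CARD('d)\<close> of them span a proper, hence null, subspace.\<close>

lemma AE_gauss_rows_notin_span:
  assumes \<sigma>: "\<sigma> > 0" and i: "i < n" "i < CARD('d)"
  shows "AE X in PiM {..<n} (\<lambda>_. gauss_iso \<sigma> :: (real^'d) measure). X i \<notin> span (X ` {..<i})"
proof -
  let ?M = "gauss_iso \<sigma> :: (real^'d) measure"
  let ?P = "PiM {..<n} (\<lambda>_. ?M)"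
  \<comment> \<open>Membership in the span is encoded as being a fixed point of the row projection,
    whose measurability is known.\<close>
  define f where "f X = (if row_proj i X (X i) = X i then 1 else 0 :: ennreal)" for X :: "nat \<Rightarrow> real^'d"
  have [measurable]: "(\<lambda>X. X j) \<in> borel_measurable ?P" if "j < n" for j
    using measurable_component_singleton [of j "{..<n}" "\<lambda>_. ?M"] that by simp
  have [measurable]: "(\<lambda>X. row_proj i X (X i)) \<in> borel_measurable ?P"
    using i by (intro borel_measurable_row_proj) auto
  have [measurable]: "f \<in> borel_measurable ?P"
    unfolding f_def using i by measurable
  have "(\<integral>\<^sup>+X. f X \<partial>?P) = (\<integral>\<^sup>+X. \<integral>\<^sup>+x. f (X(i := x)) \<partial>?M \<partial>?P)"
    using i by (intro nn_integral_PiM_resample prob_space_gauss_iso \<sigma>) auto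
  also have "\<dots> = (\<integral>\<^sup>+X. 0 \<partial>?P)"
  proof (intro nn_integral_cong)
    fix X :: "nat \<Rightarrow> real^'d"
    have "dim (X ` {..<i}) < CARD('d)"
      using dim_rows_le [of "{..<i}" X] i by simp
    then have "AE x in ?M. x \<notin> span (X ` {..<i})" by (rule AE_gauss_iso_notin_lowdim)
    then have "AE x in ?M. f (X(i := x)) = 0"
    proof eventually_elim
      case (elim x)
      have "row_proj i (X(i := x)) = row_proj i X" by (rule row_proj_cong) auto
      with elim show ?case by (simp add: f_def row_proj_eq_self_iff)
    qed
    then have "(\<integral>\<^sup>+x. f (X(i := x)) \<partial>?M) = (\<integral>\<^sup>+x. 0 \<partial>?M)" by (rule nn_integral_cong_AE)
    then show "(\<integral>\<^sup>+x. f (X(i := x)) \<partial>?M) = 0" by simp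
  qed
  finally have "(\<integral>\<^sup>+X. f X \<partial>?P) = 0" by simp
  then have "AE X in ?P. f X = 0" by (subst (asm) nn_integral_0_iff_AE) auto
  then show ?thesis
    by eventually_elim (simp add: f_def row_proj_eq_self_iff split: if_splits)
qed

text \<open>The first \<open>min n (CARD('d))\<close> rows already give the lower bound; the upper
  bounds hold for every design.\<close>

lemma AE_gauss_rows_dim:
  assumes \<sigma>: "\<sigma> > 0"
  shows "AE X in PiM {..<n} (\<lambda>_. gauss_iso \<sigma> :: (real^'d) measure). dim (X ` {..<n}) = min n (CARD('d))"
proof -
  let ?m = "min n (CARD('d))"
  have "AE X in PiM {..<n} (\<lambda>_. gauss_iso \<sigma> :: (real^'d) measure). \<forall>i\<in>{..<?m}. X i \<notin> span (X ` {..<i})"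
    by (intro AE_finite_allI AE_gauss_rows_notin_span \<sigma>) auto
  then show ?thesis
  proof eventually_elim
    case (elim X)
    then have "dim (X ` {..<?m}) = ?m" by (intro dim_rows_eq) auto
    moreover have "dim (X ` {..<?m}) \<le> dim (X ` {..<n})" by (intro dim_subset) auto
    moreover have "dim (X ` {..<n}) \<le> n" using dim_rows_le [of "{..<n}" X] by simp
    moreover have "dim (X ` {..<n}) \<le> CARD('d)" using dim_subset_UNIV [of "X ` {..<n}"] by simp
    ultimately show ?case by linarith
  qed
qed

section \<open>Laplace transforms of squared distances\<close>

text \<open>Resampling along \<open>b\<close> puts a fresh normal in that direction and leaves the
  components along the other members of \<open>B\<close> untouched, so each basis vector contributes
  one factor.\<close>

lemma nn_integral_gauss_exp_orthonormal:
  fixes B :: "(real^'d) set"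
  assumes \<sigma>: "\<sigma> > 0" and t: "t \<ge> 0"
    and "finite B" "pairwise orthogonal B" "\<And>b. b \<in> B \<Longrightarrow> norm b = 1"
  shows "(\<integral>\<^sup>+x. ennreal (exp (- t * (\<Sum>b\<in>B. (b \<bullet> x)\<^sup>2))) \<partial>gauss_iso \<sigma>)
    = ennreal ((1 / sqrt (1 + 2 * t * \<sigma>\<^sup>2)) ^ card B)"
  using assms(3-)
proof (induction B rule: finite_induct)
  case empty
  interpret prob_space "gauss_iso \<sigma> :: (real^'d) measure" using \<sigma> by (rule prob_space_gauss_iso)
  show ?case using emeasure_space_1 by simp
next
  case (insert b B)
  let ?s = "1 + 2 * t * \<sigma>\<^sup>2"
  have s: "?s > 0" using t by (simp add: add_pos_nonneg)
  have b: "norm b = 1" "b \<bullet> b = 1" using insert.prems by (auto simp: norm_eq_1)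
  have orth: "b' \<bullet> b = 0" if "b' \<in> B" for b'
    using insert.prems(1) insert.hyps that by (auto simp: pairwise_insert orthogonal_def)
  have "(\<integral>\<^sup>+x. ennreal (exp (- t * (\<Sum>b'\<in>insert b B. (b' \<bullet> x)\<^sup>2))) \<partial>gauss_iso \<sigma>)
    = (\<integral>\<^sup>+x. \<integral>\<^sup>+c. ennreal (exp (- t * (\<Sum>b'\<in>insert b B. (b' \<bullet> (x + (c - b \<bullet> x) *\<^sub>R b))\<^sup>2)))
        \<partial>normal_law \<sigma> \<partial>gauss_iso \<sigma>)"
    by (rule nn_integral_gauss_iso_resample_along [OF \<sigma> b(1)]) measurable
  also have "\<dots> = (\<integral>\<^sup>+x. \<integral>\<^sup>+c. ennreal (exp (- t * (\<Sum>b'\<in>B. (b' \<bullet> x)\<^sup>2))) * ennreal (exp (- t * (c + 0)\<^sup>2))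
        \<partial>normal_law \<sigma> \<partial>gauss_iso \<sigma>)"
  proof (intro nn_integral_cong)
    fix x :: "real^'d" and c :: real
    have "(\<Sum>b'\<in>B. (b' \<bullet> (x + (c - b \<bullet> x) *\<^sub>R b))\<^sup>2) = (\<Sum>b'\<in>B. (b' \<bullet> x)\<^sup>2)"
      by (intro sum.cong refl) (simp add: inner_add_right orth)
    moreover have "b \<bullet> (x + (c - b \<bullet> x) *\<^sub>R b) = c" by (simp add: inner_add_right b)
    ultimately have "- t * (\<Sum>b'\<in>insert b B. (b' \<bullet> (x + (c - b \<bullet> x) *\<^sub>R b))\<^sup>2)
        = - t * (\<Sum>b'\<in>B. (b' \<bullet> x)\<^sup>2) + - t * (c + 0)\<^sup>2"
      using insert.hyps by (simp add: algebra_simps)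
    then show "ennreal (exp (- t * (\<Sum>b'\<in>insert b B. (b' \<bullet> (x + (c - b \<bullet> x) *\<^sub>R b))\<^sup>2)))
        = ennreal (exp (- t * (\<Sum>b'\<in>B. (b' \<bullet> x)\<^sup>2))) * ennreal (exp (- t * (c + 0)\<^sup>2))"
      by (simp only: exp_add) (simp add: ennreal_mult)
  qed
  also have "\<dots> = (\<integral>\<^sup>+x. ennreal (exp (- t * (\<Sum>b'\<in>B. (b' \<bullet> x)\<^sup>2))) * ennreal (1 / sqrt ?s) \<partial>gauss_iso \<sigma>)"
    by (subst nn_integral_cmult, measurable, subst nn_integral_normal_law_exp_square [OF \<sigma> t]) simp
  also have "\<dots> = ennreal ((1 / sqrt ?s) ^ card B) * ennreal (1 / sqrt ?s)"
    using insert by (subst nn_integral_multc) (auto simp: pairwise_insert)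
  also have "\<dots> = ennreal ((1 / sqrt ?s) ^ card (insert b B))"
    using insert.hyps s by (simp add: ennreal_mult [symmetric] mult.commute)
  finally show ?case .
qed

lemma sum_inner_orthonormal_sq:
  fixes C :: "'a::euclidean_space set"
  assumes "pairwise orthogonal C" "\<And>b. b \<in> C \<Longrightarrow> norm b = 1" "finite C" "q \<in> span C"
  shows "(\<Sum>b\<in>C. (b \<bullet> q)\<^sup>2) = (norm q)\<^sup>2"
proof -
  have "(\<Sum>b\<in>C. (q \<bullet> b) *\<^sub>R b) = q"
    using assms by (intro orthonormal_basis_expand) auto
  then have "q \<bullet> q = q \<bullet> (\<Sum>b\<in>C. (q \<bullet> b) *\<^sub>R b)" by simp
  also have "\<dots> = (\<Sum>b\<in>C. (b \<bullet> q)\<^sup>2)"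
    by (simp add: inner_sum_right power2_eq_square inner_commute)
  finally show ?thesis by (simp add: power2_norm_eq_inner)
qed

text \<open>\<open>gram\<close> writes \<open>X i\<close> as a combination of the rows with
  coefficients \<open>X j \<bullet> pinv_col n X i\<close>. The rows are independent, so
  coefficients can be compared: the columns of the pseudo-inverse form the basis dual to the
  rows.\<close>

lemma inner_pinv_col_row:
  fixes X :: "nat \<Rightarrow> 'a::euclidean_space"
  assumes dim: "dim (X ` {..<n}) = n" and i: "i < n" and j: "j < n"
  shows "X j \<bullet> pinv_col n X i = (if j = i then 1 else 0)"
proof -
  have "card (X ` {..<n}) = n"
    using dim_le_card' [of "X ` {..<n}"] card_image_le [of "{..<n}" X] dim by simp
  then have inj: "inj_on X {..<n}" by (intro eq_card_imp_inj_on) auto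
  have indep: "independent (X ` {..<n})"
    using dim \<open>card (X ` {..<n}) = n\<close> by (intro card_le_dim_spanning [of _ "span (X ` {..<n})"]) (auto intro: span_base)
  define c where "c j = X j \<bullet> pinv_col n X i - (if j = i then 1 else 0)" for j
  have "(\<Sum>j<n. c j *\<^sub>R X j) = gram n X (pinv_col n X i) - (\<Sum>j<n. (if j = i then 1 else 0) *\<^sub>R X j)"
    by (simp add: c_def gram_def scaleR_diff_left sum_subtractf)
  also have "(\<Sum>j<n. (if j = i then 1 else 0) *\<^sub>R X j) = X i"
    using i by (subst sum.cong [OF refl, where h = "\<lambda>j. if j = i then X j else 0"]) auto
  finally have "(\<Sum>j<n. c j *\<^sub>R X j) = 0" using gram_pinv_col [OF i] by simp
  then have "(\<Sum>v\<in>X ` {..<n}. c (the_inv_into {..<n} X v) *\<^sub>R v) = 0"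
    using inj by (subst sum.reindex) (auto simp: the_inv_into_f_f)
  then have "c (the_inv_into {..<n} X (X j)) = 0"
    using indep j by (intro independentD [OF indep]) auto
  then show ?thesis using inj j by (simp add: the_inv_into_f_f c_def)
qed

text \<open>A dual vector is orthogonal to the other rows and lies in the row space, hence is a
  multiple of the component \<open>q\<close> of \<open>X i\<close> orthogonal to those rows. The
  normalisation \<open>X i \<bullet> p = 1\<close> makes the factor
  \<open>1 / (q \<bullet> q)\<close>.\<close>

lemma norm_pinv_col_sq:
  fixes X :: "nat \<Rightarrow> 'a::euclidean_space"
  assumes dim: "dim (X ` {..<n}) = n" and i: "i < n"
    and C: "pairwise orthogonal C" "\<And>b. b \<in> C \<Longrightarrow> norm b = 1" "finite C"
      "span C = orthogonal_comp (span (X ` ({..<n} - {i})))"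
  shows "(norm (pinv_col n X i))\<^sup>2 = 1 / (\<Sum>b\<in>C. (b \<bullet> X i)\<^sup>2)"
proof -
  define V where "V = span (X ` ({..<n} - {i}))"
  define p where "p = pinv_col n X i"
  obtain v q where vq: "v \<in> V" "\<And>w. w \<in> V \<Longrightarrow> orthogonal q w" "X i = v + q"
    using orthogonal_subspace_decomp_exists [of "X ` ({..<n} - {i})" "X i"] unfolding V_def by metis
  have q_comp: "q \<in> span C"
    using vq unfolding C(4) V_def [symmetric] orthogonal_comp_def by (simp add: orthogonal_commute)
  have pV: "orthogonal p w" if "w \<in> V" for w
  proof -
    have "orthogonal p (X j)" if "j \<in> {..<n} - {i}" for j
      using inner_pinv_col_row [OF dim i, of j] that by (simp add: p_def orthogonal_def inner_commute)
    then show ?thesis using that unfolding V_def by (metis (mono_tags, lifting) imageE orthogonal_to_span)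
  qed
  have pXi: "X i \<bullet> p = 1" using inner_pinv_col_row [OF dim i i] by (simp add: p_def)
  have "p \<in> span (insert (X i) (X ` ({..<n} - {i})))"
    using pinv_col_in_span [OF i, of X] i unfolding p_def
    by (metis image_insert insert_Diff lessThan_iff)
  then obtain c where c: "p - c *\<^sub>R X i \<in> V" unfolding V_def by (auto simp: span_insert)
  \<comment> \<open>\<open>u\<close> lies in \<open>V\<close>, whereas \<open>p\<close> and
    \<open>q\<close> are orthogonal to \<open>V\<close>; so \<open>u\<close> is orthogonal to
    itself.\<close>
  define u where "u = p - c *\<^sub>R q"
  have u: "u = (p - c *\<^sub>R X i) + c *\<^sub>R v" by (simp add: u_def vq(3) algebra_simps)
  have "u \<in> V" unfolding u unfolding V_def
    using c vq(1) by (intro span_add span_scale) (auto simp: V_def)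
  then have "u \<bullet> u = 0"
    using pV [of u] vq(2) [of u] by (simp add: u_def inner_diff_left orthogonal_def)
  then have p: "p = c *\<^sub>R q" by (simp add: u_def)
  have "v \<bullet> q = 0" using vq(2) [OF vq(1)] by (simp add: orthogonal_def inner_commute)
  then have c1: "c * (q \<bullet> q) = 1" using pXi by (simp add: p vq(3) inner_add_left)
  then have "q \<bullet> q \<noteq> 0" by auto
  then have "(norm p)\<^sup>2 = 1 / (norm q)\<^sup>2"
    using c1 unfolding power2_norm_eq_inner p by (simp add: field_simps)
  also have "(norm q)\<^sup>2 = (\<Sum>b\<in>C. (b \<bullet> q)\<^sup>2)"
    using sum_inner_orthonormal_sq [OF C(1,2,3) q_comp] by simp
  also have "\<dots> = (\<Sum>b\<in>C. (b \<bullet> X i)\<^sup>2)"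
  proof (intro sum.cong refl)
    fix b assume "b \<in> C"
    then have "b \<in> orthogonal_comp V" using C(4) span_base unfolding V_def by blast
    then have "v \<bullet> b = 0" using vq(1) by (auto simp: orthogonal_comp_def orthogonal_def)
    then show "(b \<bullet> q)\<^sup>2 = (b \<bullet> X i)\<^sup>2" by (simp add: vq(3) inner_add_right inner_commute)
  qed
  finally show ?thesis by (simp add: p_def)
qed

text \<open>With the other rows frozen, the reciprocal in the exponent is the squared distance of
  the fresh row from their span. Almost surely that span has dimension \<open>n - 1\<close>, hence
  codimension \<open>CARD('d) + 1 - n\<close>.\<close>

lemma nn_integral_gauss_rows_laplace:
  assumes \<sigma>: "\<sigma> > 0" and t: "t \<ge> 0" and i: "i < n" and n: "n \<le> CARD('d)"
  shows "(\<integral>\<^sup>+X. ennreal (exp (- t * (1 / (norm (pinv_col n X i))\<^sup>2))) \<partial>PiM {..<n} (\<lambda>_. gauss_iso \<sigma> :: (real^'d) measure))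
    = ennreal ((1 / sqrt (1 + 2 * t * \<sigma>\<^sup>2)) ^ (CARD('d) + 1 - n))"
proof -
  let ?M = "gauss_iso \<sigma> :: (real^'d) measure"
  let ?P = "PiM {..<n} (\<lambda>_. ?M)"
  interpret P: prob_space ?P by (intro prob_space_PiM prob_space_gauss_iso \<sigma>)
  define F where "F X = ennreal (exp (- t * (1 / (norm (pinv_col n X i))\<^sup>2)))" for X :: "nat \<Rightarrow> real^'d"
  let ?v = "ennreal ((1 / sqrt (1 + 2 * t * \<sigma>\<^sup>2)) ^ (CARD('d) + 1 - n))"
  have [measurable]: "(\<lambda>X. X j) \<in> borel_measurable ?P" if "j < n" for j
    using measurable_component_singleton [of j "{..<n}" "\<lambda>_. ?M"] that by simp
  have [measurable]: "(\<lambda>X. pinv_col n X i) \<in> borel_measurable ?P"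
    using i by (intro borel_measurable_pinv_col) auto
  have [measurable]: "F \<in> borel_measurable ?P" unfolding F_def by measurable
  have "(\<integral>\<^sup>+X. F X \<partial>?P) = (\<integral>\<^sup>+X. \<integral>\<^sup>+x. F (X(i := x)) \<partial>?M \<partial>?P)"
    using i by (intro nn_integral_PiM_resample prob_space_gauss_iso \<sigma>) auto
  also have "\<dots> = (\<integral>\<^sup>+X. ?v \<partial>?P)"
  proof (rule nn_integral_cong_AE)
    have "AE X in ?P. dim (X ` {..<n}) = n"
      using AE_gauss_rows_dim [OF \<sigma>, of n, where 'd = 'd] n by (simp add: min_absorb1)
    then show "AE X in ?P. (\<integral>\<^sup>+x. F (X(i := x)) \<partial>?M) = ?v"
    proof eventually_elim
      case (elim X)
      define K where "K = {..<n} - {i}"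
      have K: "{..<n} = insert i K" "finite K" "card K = n - 1" "i \<notin> K" using i by (auto simp: K_def)
      have "dim (X ` {..<n}) \<le> dim (X ` K) + 1"
        unfolding K(1) by (simp add: dim_insert)
      moreover have "dim (X ` K) \<le> n - 1" using dim_rows_le [of K X] K by simp
      ultimately have dimK: "dim (X ` K) = n - 1" using elim by simp
      let ?V = "span (X ` K)"
      have "subspace (orthogonal_comp ?V)" by (rule subspace_orthogonal_comp)
      then obtain C where C: "C \<subseteq> orthogonal_comp ?V" "pairwise orthogonal C" "\<And>b. b \<in> C \<Longrightarrow> norm b = 1"
          "independent C" "card C = dim (orthogonal_comp ?V)" "span C = orthogonal_comp ?V"
        using orthonormal_basis_subspace by metis
      have "finite C" using C(4) by (rule independent_imp_finite)
      have "dim (orthogonal_comp ?V) + dim ?V = CARD('d)"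
        using dim_subspace_orthogonal_to_vectors [of ?V "UNIV :: (real^'d) set"]
        by (simp add: orthogonal_comp_def)
      then have cardC: "card C = CARD('d) + 1 - n" using C(5) dimK i n by (simp add: dim_span)
      have "AE x in ?M. x \<notin> ?V"
        using dimK i n by (intro AE_gauss_iso_notin_lowdim) auto
      then have "AE x in ?M. F (X(i := x)) = ennreal (exp (- t * (\<Sum>b\<in>C. (b \<bullet> x)\<^sup>2)))"
      proof eventually_elim
        case (elim x)
        have img: "X(i := x) ` K = X ` K" using K by auto
        have "X(i := x) ` {..<n} = insert x (X ` K)" using img K by (auto simp: K(1))
        then have "dim (X(i := x) ` {..<n}) = n" using elim dimK i by (simp add: dim_insert)
        then have "(norm (pinv_col n (X(i := x)) i))\<^sup>2 = 1 / (\<Sum>b\<in>C. (b \<bullet> (X(i := x)) i)\<^sup>2)"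
          using C \<open>finite C\<close> img by (intro norm_pinv_col_sq i) (auto simp: K_def)
        then show ?case by (simp add: F_def)
      qed
      then have "(\<integral>\<^sup>+x. F (X(i := x)) \<partial>?M) = (\<integral>\<^sup>+x. ennreal (exp (- t * (\<Sum>b\<in>C. (b \<bullet> x)\<^sup>2))) \<partial>?M)"
        by (rule nn_integral_cong_AE)
      also have "\<dots> = ?v"
        using nn_integral_gauss_exp_orthonormal [OF \<sigma> t \<open>finite C\<close>] C cardC by simp
      finally show ?case .
    qed
  qed
  also have "\<dots> = ?v" by (simp add: P.emeasure_space_1)
  finally show ?thesis by (simp add: F_def)
qed

section \<open>Inverse moments from Laplace transforms\<close>

lemma nn_integral_exp_atLeast_0:
  assumes "r > 0"
  shows "(\<integral>\<^sup>+t. ennreal (exp (- t * r)) * indicator {0..} t \<partial>lborel) = ennreal (1 / r)"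
proof -
  have "((\<lambda>t. - exp (- t * r) / r) \<longlongrightarrow> 0) at_top"
    using assms by real_asymp
  then have "(\<integral>\<^sup>+t. ennreal (exp (- t * r)) * indicator {0..} t \<partial>lborel) = ennreal (0 - (- exp (- 0 * r) / r))"
    using assms by (intro nn_integral_FTC_atLeast) (auto intro!: derivative_eq_intros)
  then show ?thesis by simp
qed

text \<open>The integrand decays like \<open>t powr (- k / 2)\<close>, which is integrable at
  infinity exactly for \<open>k > 2\<close>. For \<open>k \<le> 2\<close> it dominates the case
  \<open>k = 2\<close>, whose primitive is a logarithm.\<close>

lemma nn_integral_inverse_sqrt_power:
  assumes a: "a > 0"
  shows "(\<integral>\<^sup>+t. ennreal ((1 / sqrt (1 + 2 * t * a)) ^ k) * indicator {0..} t \<partial>lborel)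
    = (if k \<ge> 3 then ennreal (1 / (a * (real k - 2))) else \<infinity>)"
proof (cases "k \<ge> 3")
  case True
  \<comment> \<open>\<open>- e\<close> is the exponent \<open>1 - k / 2\<close> of the
    primitive.\<close>
  define e where "e = (real k - 2) / 2"
  have e: "e > 0" using True by (simp add: e_def)
  define F where "F t = - (1 / (2 * a * e)) * (1 + 2 * t * a) powr (- e)" for t
  have "filterlim (\<lambda>t. 1 + 2 * t * a) at_top at_top"
    using a by real_asymp
  then have "((\<lambda>t. (1 + 2 * t * a) powr (- e)) \<longlongrightarrow> 0) at_top"
    using e by (intro tendsto_neg_powr) auto
  then have "(F \<longlongrightarrow> - (1 / (2 * a * e)) * 0) at_top"
    unfolding F_def by (intro tendsto_intros)
  then have lim: "(F \<longlongrightarrow> 0) at_top" by simp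
  have "(\<integral>\<^sup>+t. ennreal ((1 / sqrt (1 + 2 * t * a)) ^ k) * indicator {0..} t \<partial>lborel) = ennreal (0 - F 0)"
  proof (rule nn_integral_FTC_atLeast [OF _ _ _ lim])
    fix t :: real assume t: "0 \<le> t"
    have s: "1 + 2 * t * a > 0" using a t by (simp add: add_pos_nonneg)
    have "(F has_real_derivative - (1 / (2 * a * e)) * (- e * (1 + 2 * t * a) powr (- e - 1) * (2 * a))) (at t)"
      unfolding F_def using s by (auto intro!: derivative_eq_intros)
    also have "- (1 / (2 * a * e)) * (- e * (1 + 2 * t * a) powr (- e - 1) * (2 * a)) = (1 + 2 * t * a) powr (- e - 1)"
      using a e by simp
    also have "- e - 1 = - (1/2) * real k" by (simp add: e_def field_simps)
    also have "(1 + 2 * t * a) powr (- (1/2) * real k) = ((1 + 2 * t * a) powr (- (1/2))) powr real k"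
      by (rule powr_powr [symmetric])
    also have "\<dots> = ((1 + 2 * t * a) powr (- (1/2))) ^ k"
      using s by (intro powr_realpow) simp
    also have "(1 + 2 * t * a) powr (- (1/2)) = 1 / sqrt (1 + 2 * t * a)"
      using s by (subst powr_minus) (simp add: powr_half_sqrt inverse_eq_divide)
    finally show "(F has_real_derivative (1 / sqrt (1 + 2 * t * a)) ^ k) (at t)" .
  qed (use a in auto)
  also have "0 - F 0 = 1 / (a * (real k - 2))" by (simp add: F_def e_def)
  finally show ?thesis using True by simp
next
  case False
  let ?I = "\<integral>\<^sup>+t. ennreal ((1 / sqrt (1 + 2 * t * a)) ^ k) * indicator {0..} t \<partial>lborel"
  have "ennreal c \<le> ?I" if c: "c \<ge> 0" for c
  proof -
    \<comment> \<open>The point at which the logarithmic primitive reaches the prescribed level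
      \<open>c\<close>.\<close>
    define T where "T = (exp (2 * a * c) - 1) / (2 * a)"
    have T: "T \<ge> 0" "1 + 2 * T * a = exp (2 * a * c)" using a c by (auto simp: T_def field_simps)
    have "(\<integral>\<^sup>+t. ennreal (1 / (1 + 2 * t * a)) * indicator {0..T} t \<partial>lborel)
        = ennreal (ln (1 + 2 * T * a) / (2 * a) - ln (1 + 2 * 0 * a) / (2 * a))"
    proof (rule nn_integral_FTC_Icc [where F = "\<lambda>t. ln (1 + 2 * t * a) / (2 * a)"])
      fix t assume t: "t \<in> {0..T}"
      have s: "1 + 2 * t * a > 0" using a t by (simp add: add_pos_nonneg)
      have "((\<lambda>t. ln (1 + 2 * t * a) / (2 * a)) has_real_derivative (1 / (1 + 2 * t * a) * (2 * a)) / (2 * a)) (at t)"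
        using s a by (auto intro!: derivative_eq_intros)
      then show "((\<lambda>t. ln (1 + 2 * t * a) / (2 * a)) has_real_derivative 1 / (1 + 2 * t * a)) (at t)"
        using a by simp
      show "0 \<le> 1 / (1 + 2 * t * a)" using s by simp
    qed (use T in auto)
    also have "ln (1 + 2 * T * a) / (2 * a) - ln (1 + 2 * 0 * a) / (2 * a) = c"
      unfolding T(2) using a by simp
    finally have "ennreal c = (\<integral>\<^sup>+t. ennreal (1 / (1 + 2 * t * a)) * indicator {0..T} t \<partial>lborel)" by simp
    also have "\<dots> \<le> ?I"
    proof (intro nn_integral_mono)
      fix t :: real
      show "ennreal (1 / (1 + 2 * t * a)) * indicator {0..T} t
        \<le> ennreal ((1 / sqrt (1 + 2 * t * a)) ^ k) * indicator {0..} t"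
      proof (cases "0 \<le> t \<and> t \<le> T")
        case True
        then have s: "1 + 2 * t * a \<ge> 1" using a by simp
        have "(1 / sqrt (1 + 2 * t * a)) ^ 2 \<le> (1 / sqrt (1 + 2 * t * a)) ^ k"
        proof (rule power_decreasing)
          have "1 \<le> sqrt (1 + 2 * t * a)" using s by simp
          then show "1 / sqrt (1 + 2 * t * a) \<le> 1" by (subst divide_le_eq_1_pos) linarith+
        qed (use False s in auto)
        then show ?thesis using True s by (simp add: power_divide ennreal_leI)
      qed (auto simp: indicator_def)
    qed
    finally show ?thesis .
  qed
  moreover have "?I = top" if "\<And>c. c \<ge> 0 \<Longrightarrow> ennreal c \<le> ?I"
  proof (cases ?I)
    case (real c)
    then show ?thesis using that [of "c + 1"] by simp
  qed
  ultimately have "?I = top" by blast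
  then show ?thesis using False by simp
qed

lemma nn_integral_inverse_of_laplace:
  assumes M: "prob_space M" and r [measurable]: "r \<in> borel_measurable M" and pos: "AE x in M. r x > 0"
    and a: "a > 0"
    and lap: "\<And>t. t \<ge> 0 \<Longrightarrow> (\<integral>\<^sup>+x. ennreal (exp (- t * r x)) \<partial>M) = ennreal ((1 / sqrt (1 + 2 * t * a)) ^ k)"
  shows "(\<integral>\<^sup>+x. ennreal (1 / r x) \<partial>M) = (if k \<ge> 3 then ennreal (1 / (a * (real k - 2))) else \<infinity>)"
proof -
  interpret M: prob_space M by fact
  interpret pair_sigma_finite M "lborel :: real measure" by unfold_locales
  have "(\<integral>\<^sup>+x. ennreal (1 / r x) \<partial>M)
      = (\<integral>\<^sup>+x. \<integral>\<^sup>+t. ennreal (exp (- t * r x)) * indicator {0..} t \<partial>lborel \<partial>M)"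
    by (rule nn_integral_cong_AE, rule eventually_mono [OF pos], rule nn_integral_exp_atLeast_0 [symmetric])
  also have "\<dots> = (\<integral>\<^sup>+t. \<integral>\<^sup>+x. ennreal (exp (- t * r x)) * indicator {0..} t \<partial>M \<partial>lborel)"
    by (rule Fubini' [symmetric]) measurable
  also have "\<dots> = (\<integral>\<^sup>+t. ennreal ((1 / sqrt (1 + 2 * t * a)) ^ k) * indicator {0..} t \<partial>lborel)"
  proof (intro nn_integral_cong)
    fix t :: real
    have "(\<integral>\<^sup>+x. ennreal (exp (- t * r x)) * indicator {0..} t \<partial>M)
        = (\<integral>\<^sup>+x. ennreal (exp (- t * r x)) \<partial>M) * indicator {0..} t"
      by (rule nn_integral_multc) measurable
    then show "(\<integral>\<^sup>+x. ennreal (exp (- t * r x)) * indicator {0..} t \<partial>M)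
        = ennreal ((1 / sqrt (1 + 2 * t * a)) ^ k) * indicator {0..} t"
      using lap [of t] by (cases "t \<ge> 0") auto
  qed
  also have "\<dots> = (if k \<ge> 3 then ennreal (1 / (a * (real k - 2))) else \<infinity>)"
    using a by (rule nn_integral_inverse_sqrt_power)
  finally show ?thesis .
qed

section \<open>Distances from the column space\<close>

text \<open>The squared distance of \<open>c\<close> from the column space of the matrix with rows
  \<open>W 0, ..., W (m - 1)\<close>, that is, the least value of the sum of squares
  \<open>(c i + W i \<bullet> v)\<^sup>2\<close> over \<open>v\<close>. The explicit minimiser makes
  measurability in \<open>c\<close> evident.\<close>

definition residual :: "nat \<Rightarrow> (nat \<Rightarrow> 'a::euclidean_space) \<Rightarrow> (nat \<Rightarrow> real) \<Rightarrow> real" where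
  "residual m W c = (\<Sum>i<m. (W i \<bullet> (\<Sum>j<m. c j *\<^sub>R pinv_col m W j) - c i)\<^sup>2)"

lemma residual_decomp:
  "(\<Sum>i<m. (c i + W i \<bullet> v)\<^sup>2)
    = residual m W c + (\<Sum>i<m. (W i \<bullet> (v + (\<Sum>j<m. c j *\<^sub>R pinv_col m W j)))\<^sup>2)"
proof -
  define w where "w = (\<Sum>j<m. c j *\<^sub>R pinv_col m W j)"
  have "(\<Sum>i<m. (c i + W i \<bullet> v)\<^sup>2) = (\<Sum>i<m. (W i \<bullet> (- v) - c i)\<^sup>2)"
    by (intro sum.cong refl) (simp add: power2_eq_square algebra_simps)
  also have "\<dots> = (\<Sum>i<m. (W i \<bullet> w - c i)\<^sup>2) + (\<Sum>i<m. (W i \<bullet> (- v - w))\<^sup>2)"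
    unfolding w_def by (rule sum_square_residual_decomp)
  also have "(\<Sum>i<m. (W i \<bullet> (- v - w))\<^sup>2) = (\<Sum>i<m. (W i \<bullet> (v + w))\<^sup>2)"
    by (intro sum.cong refl) (simp add: inner_diff_right inner_add_right power2_eq_square algebra_simps)
  finally show ?thesis unfolding residual_def w_def .
qed

lemma residual_attained: "\<exists>v. (\<Sum>i<m. (c i + W i \<bullet> v)\<^sup>2) = residual m W c"
  by (rule exI [of _ "- (\<Sum>j<m. c j *\<^sub>R pinv_col m W j)"]) (simp add: residual_def power2_commute)

lemma residual_le: "residual m W c \<le> (\<Sum>i<m. (c i + W i \<bullet> v)\<^sup>2)"
  by (subst residual_decomp) (simp add: sum_nonneg)

text \<open>Spanning rows make the quadratic form positive definite. Its minimum over the unit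
  sphere bounds it below by a multiple of the squared norm, and a Gaussian density then dominates
  the integrand.\<close>

lemma nn_integral_lborel_exp_form_finite:
  fixes W :: "nat \<Rightarrow> real^'d"
  assumes W: "span (W ` {..<m}) = UNIV" and t: "t > 0"
  shows "(\<integral>\<^sup>+v. ennreal (exp (- t * (\<Sum>i<m. (W i \<bullet> v)\<^sup>2))) \<partial>lborel) < \<infinity>"
proof -
  define Q where "Q v = (\<Sum>i<m. (W i \<bullet> v)\<^sup>2)" for v
  have cont: "continuous_on S Q" for S
    unfolding Q_def by (intro continuous_intros)
  obtain u where u: "u \<in> sphere 0 1" "\<And>v. v \<in> sphere 0 1 \<Longrightarrow> Q u \<le> Q v"
    using continuous_attains_inf [OF compact_sphere _ cont, of "0 :: real^'d" 1] by auto
  have "Q u > 0"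
  proof (rule ccontr)
    assume "\<not> Q u > 0"
    moreover have "Q u \<ge> 0" by (simp add: Q_def sum_nonneg)
    ultimately have "(\<Sum>i<m. (W i \<bullet> u)\<^sup>2) = 0" unfolding Q_def by linarith
    then have "\<forall>i\<in>{..<m}. (W i \<bullet> u)\<^sup>2 = 0" by (subst (asm) sum_nonneg_eq_0_iff) auto
    then have "u \<bullet> u = 0" by (intro orthogonal_span_rows [of m W u u]) (auto simp: W)
    then show False using u(1) by simp
  qed
  have Q_ge: "Q u * (norm v)\<^sup>2 \<le> Q v" for v
  proof (cases "v = 0")
    case False
    have "Q u \<le> Q ((1 / norm v) *\<^sub>R v)" using False by (intro u) simp
    also have "\<dots> = Q v / (norm v)\<^sup>2"
      by (simp add: Q_def power_divide sum_divide_distrib [symmetric])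
    finally show ?thesis using False by (simp add: field_simps)
  qed (simp add: Q_def)
  \<comment> \<open>The width for which the Gaussian exponent is
    \<open>- t * Q u * (norm v)\<^sup>2\<close>.\<close>
  define \<tau> where "\<tau> = 1 / sqrt (2 * t * Q u)"
  have \<tau>: "\<tau> > 0" "1 / (2 * \<tau>\<^sup>2) = t * Q u"
    using \<open>Q u > 0\<close> t by (auto simp: \<tau>_def power_divide)
  define K where "K = (1 / sqrt (2 * pi * \<tau>\<^sup>2)) ^ CARD('d)"
  have K: "K > 0" using \<tau>(1) by (simp add: K_def)
  interpret prob_space "gauss_iso \<tau> :: (real^'d) measure" using \<tau>(1) by (rule prob_space_gauss_iso)
  have "emeasure (gauss_iso \<tau> :: (real^'d) measure) UNIV = 1" using emeasure_space_1 by simp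
  then have one: "(\<integral>\<^sup>+(v::real^'d). ennreal (K * exp (- (norm v)\<^sup>2 / (2 * \<tau>\<^sup>2))) \<partial>lborel) = 1"
    unfolding gauss_iso_def by (subst (asm) emeasure_density) (auto simp: prod_normal_density_eq_radial K_def)
  have "(\<integral>\<^sup>+v. ennreal (exp (- t * Q v)) \<partial>lborel)
      \<le> (\<integral>\<^sup>+(v::real^'d). ennreal (1 / K) * ennreal (K * exp (- (norm v)\<^sup>2 / (2 * \<tau>\<^sup>2))) \<partial>lborel)"
  proof (intro nn_integral_mono)
    fix v :: "real^'d"
    have "- t * Q v \<le> - (norm v)\<^sup>2 / (2 * \<tau>\<^sup>2)"
    proof -
      have "- (norm v)\<^sup>2 / (2 * \<tau>\<^sup>2) = - (t * Q u * (norm v)\<^sup>2)"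
        unfolding \<tau>(2) [symmetric] by simp
      then show ?thesis using mult_left_mono [OF Q_ge [of v], of t] t by (simp add: mult_ac)
    qed
    then show "ennreal (exp (- t * Q v)) \<le> ennreal (1 / K) * ennreal (K * exp (- (norm v)\<^sup>2 / (2 * \<tau>\<^sup>2)))"
      using K by (simp add: ennreal_mult [symmetric] ennreal_leI)
  qed
  also have "\<dots> = ennreal (1 / K)"
    by (subst nn_integral_cmult, measurable, subst one) simp
  finally show ?thesis unfolding Q_def by (simp add: le_less_trans)
qed

text \<open>Together with finiteness, this permits cancelling a Gaussian integral from both sides of
  an identity in [0, \<infinity>].\<close>

lemma nn_integral_lborel_pos:
  fixes f :: "'a::euclidean_space \<Rightarrow> real"
  assumes [measurable]: "f \<in> borel_measurable borel" and "\<And>x. f x > 0"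
  shows "(\<integral>\<^sup>+x. ennreal (f x) \<partial>lborel) \<noteq> 0"
proof
  assume "(\<integral>\<^sup>+x. ennreal (f x) \<partial>lborel) = 0"
  then have "AE x in (lborel :: 'a measure). ennreal (f x) = 0" by (subst (asm) nn_integral_0_iff_AE) auto
  then have "AE x in (lborel :: 'a measure). False"
  proof eventually_elim
    case (elim x)
    then have "f x \<le> 0" by (simp add: ennreal_eq_0_iff)
    then show False using assms(2) [of x] by simp
  qed
  then have "emeasure (lborel :: 'a measure) (space lborel) = 0"
    by (simp add: trivial_limit_def [symmetric] ae_filter_eq_bot_iff)
  then show False by simp
qed

lemma nn_integral_lborel_scale:
  fixes f :: "'a::euclidean_space \<Rightarrow> ennreal"
  assumes [measurable]: "f \<in> borel_measurable borel" and c: "c > 0"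
  shows "(\<integral>\<^sup>+x. f x \<partial>lborel) = ennreal (c ^ DIM('a)) * (\<integral>\<^sup>+x. f (c *\<^sub>R x) \<partial>lborel)"
proof -
  have "(\<integral>\<^sup>+x. f x \<partial>lborel)
      = (\<integral>\<^sup>+x. f x \<partial>density (distr lborel borel (\<lambda>x. (0::'a) + c *\<^sub>R x)) (\<lambda>_. ennreal (\<bar>c\<bar> ^ DIM('a))))"
    using c by (subst lborel_affine [of c "0::'a"]) auto
  also have "\<dots> = ennreal (c ^ DIM('a)) * (\<integral>\<^sup>+x. f (c *\<^sub>R x) \<partial>lborel)"
    using c by (simp add: nn_integral_density nn_integral_distr nn_integral_cmult)
  finally show ?thesis .
qed

text \<open>Completing the square in \<open>v\<close> gives \<open>\<integral>exp (- t |c + W v|\<^sup>2) dv = exp (- t residual) J t\<close>, where \<open>J t\<close>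
  does not depend on \<open>c\<close>. Averaging the left-hand side over the Gaussian \<open>c\<close> turns it into a multiple
  of \<open>J (t / s)\<close>, and rescaling \<open>v\<close> relates this to \<open>J t\<close>; the determinants never have to be computed.\<close>
lemma nn_integral_residual_laplace:
  fixes W :: "nat \<Rightarrow> real^'d"
  assumes W: "span (W ` {..<m}) = UNIV" and \<sigma>: "\<sigma> > 0" and t: "t > 0"
  shows "(\<integral>\<^sup>+c. ennreal (exp (- t * residual m W c)) \<partial>PiM {..<m} (\<lambda>_. normal_law \<sigma>))
    = ennreal ((1 / sqrt (1 + 2 * t * \<sigma>\<^sup>2)) ^ (m - CARD('d)))"
proof -
  let ?N = "PiM {..<m} (\<lambda>_. normal_law \<sigma>)"
  interpret N1: prob_space "normal_law \<sigma>" using \<sigma> by (rule prob_space_normal_law)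
  interpret N: prob_space ?N by (intro prob_space_PiM prob_space_normal_law \<sigma>)
  interpret product_sigma_finite "\<lambda>_::nat. normal_law \<sigma>" by unfold_locales
  interpret NL: pair_sigma_finite ?N "lborel :: (real^'d) measure" by unfold_locales
  define s where "s = 1 + 2 * t * \<sigma>\<^sup>2"
  have s: "s > 0" using t by (simp add: s_def add_pos_nonneg)
  define J where "J u = (\<integral>\<^sup>+v. ennreal (exp (- u * (\<Sum>i<m. (W i \<bullet> v)\<^sup>2))) \<partial>lborel)" for u
  \<comment> \<open>The exponent \<open>m - CARD('d)\<close> is a truncated subtraction; spanning
    rows guarantee that nothing is cut off.\<close>
  have m: "m \<ge> CARD('d)"
  proof -
    have "CARD('d) = dim (W ` {..<m})" using W dim_span [of "W ` {..<m}"] by simp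
    also have "\<dots> \<le> m" using dim_rows_le [of "{..<m}" W] by simp
    finally show ?thesis .
  qed
  have Jfin: "J t \<noteq> \<infinity>" using nn_integral_lborel_exp_form_finite [OF W t] by (simp add: J_def)
  have Jpos: "J t \<noteq> 0" unfolding J_def by (rule nn_integral_lborel_pos) auto
  have scale: "J (t / s) = ennreal (sqrt s ^ CARD('d)) * J t"
  proof -
    have "J (t / s) = ennreal (sqrt s ^ CARD('d)) * (\<integral>\<^sup>+v. ennreal (exp (- (t / s) * (\<Sum>i<m. (W i \<bullet> (sqrt s *\<^sub>R v))\<^sup>2))) \<partial>lborel)"
      unfolding J_def using s by (subst nn_integral_lborel_scale [where c = "sqrt s"]) auto
    also have "(\<lambda>v. - (t / s) * (\<Sum>i<m. (W i \<bullet> (sqrt s *\<^sub>R v))\<^sup>2)) = (\<lambda>v. - t * (\<Sum>i<m. (W i \<bullet> v)\<^sup>2))"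
      using s by (simp add: power_mult_distrib sum_distrib_left [symmetric])
    finally show ?thesis by (simp add: J_def)
  qed
  have shift_meas: "(\<lambda>x. ennreal (exp (- t * (x + r)\<^sup>2))) \<in> borel_measurable (normal_law \<sigma>)" for r
    by measurable
  have comp [measurable]: "(\<lambda>c. c i) \<in> borel_measurable ?N" if "i < m" for i
    using measurable_component_singleton [of i "{..<m}" "\<lambda>_. normal_law \<sigma>"] that by simp
  have res_meas [measurable]: "(\<lambda>c. residual m W c) \<in> borel_measurable ?N"
    unfolding residual_def by (auto intro!: borel_measurable_sum borel_measurable_power borel_measurable_diff
        borel_measurable_inner borel_measurable_scaleR)
  have joint_meas [measurable]: "(\<lambda>z. \<Sum>i<m. (fst z i + W i \<bullet> snd z)\<^sup>2) \<in> borel_measurable (?N \<Otimes>\<^sub>M lborel)"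
  proof (intro borel_measurable_sum borel_measurable_power borel_measurable_add)
    fix i assume "i \<in> {..<m}"
    then show "(\<lambda>z. fst z i) \<in> borel_measurable (?N \<Otimes>\<^sub>M lborel)"
      by (intro measurable_compose [OF measurable_fst comp]) auto
  qed measurable
  have "(\<integral>\<^sup>+c. ennreal (exp (- t * residual m W c)) \<partial>?N) * J t
      = (\<integral>\<^sup>+c. ennreal (exp (- t * residual m W c)) * J t \<partial>?N)"
    by (rule nn_integral_multc [symmetric]) measurable
  also have "\<dots> = (\<integral>\<^sup>+c. \<integral>\<^sup>+v. ennreal (exp (- t * (\<Sum>i<m. (c i + W i \<bullet> v)\<^sup>2))) \<partial>lborel \<partial>?N)"
  proof (intro nn_integral_cong)
    fix c
    define w where "w = (\<Sum>j<m. c j *\<^sub>R pinv_col m W j)"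
    define h where "h v = ennreal (exp (- t * (\<Sum>i<m. (W i \<bullet> v)\<^sup>2)))" for v
    have [measurable]: "h \<in> borel_measurable borel" unfolding h_def by measurable
    have "(\<integral>\<^sup>+v. ennreal (exp (- t * (\<Sum>i<m. (c i + W i \<bullet> v)\<^sup>2))) \<partial>lborel)
        = (\<integral>\<^sup>+v. ennreal (exp (- t * residual m W c)) * h (v + w) \<partial>lborel)"
      unfolding h_def w_def
      by (subst residual_decomp) (simp add: distrib_left exp_add ennreal_mult exp_diff exp_minus divide_inverse)
    also have "\<dots> = ennreal (exp (- t * residual m W c)) * (\<integral>\<^sup>+v. h (v + w) \<partial>lborel)"
      by (rule nn_integral_cmult) measurable
    also have "(\<integral>\<^sup>+v. h (v + w) \<partial>lborel) = J t"
      using nn_integral_distr [of "(+) w" lborel borel h] lborel_distr_plus [of w]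
      by (simp add: J_def h_def [abs_def] add.commute)
    finally show "ennreal (exp (- t * residual m W c)) * J t
        = (\<integral>\<^sup>+v. ennreal (exp (- t * (\<Sum>i<m. (c i + W i \<bullet> v)\<^sup>2))) \<partial>lborel)" by simp
  qed
  also have "\<dots> = (\<integral>\<^sup>+v. \<integral>\<^sup>+c. ennreal (exp (- t * (\<Sum>i<m. (c i + W i \<bullet> v)\<^sup>2))) \<partial>?N \<partial>lborel)"
    by (rule NL.Fubini' [symmetric]) (use joint_meas in \<open>simp add: split_beta\<close>)
  also have "\<dots> = (\<integral>\<^sup>+v. ennreal ((1 / sqrt s) ^ m) * ennreal (exp (- (t / s) * (\<Sum>i<m. (W i \<bullet> v)\<^sup>2))) \<partial>lborel)"
  proof (intro nn_integral_cong)
    fix v :: "real^'d"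
    have "(\<integral>\<^sup>+c. ennreal (exp (- t * (\<Sum>i<m. (c i + W i \<bullet> v)\<^sup>2))) \<partial>?N)
        = (\<integral>\<^sup>+c. (\<Prod>i<m. ennreal (exp (- t * (c i + W i \<bullet> v)\<^sup>2))) \<partial>?N)"
      by (simp add: prod_ennreal exp_sum [symmetric] sum_distrib_left sum_negf)
    also have "\<dots> = (\<Prod>i<m. \<integral>\<^sup>+x. ennreal (exp (- t * (x + W i \<bullet> v)\<^sup>2)) \<partial>normal_law \<sigma>)"
      by (rule product_nn_integral_prod) (simp, rule shift_meas)
    also have "\<dots> = (\<Prod>i<m. ennreal (exp (- t / s * (W i \<bullet> v)\<^sup>2) / sqrt s))"
      unfolding s_def using \<sigma> t by (subst nn_integral_normal_law_exp_square) auto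
    also have "\<dots> = ennreal ((1 / sqrt s) ^ m * exp (- (t / s) * (\<Sum>i<m. (W i \<bullet> v)\<^sup>2)))"
      using s by (simp add: prod_ennreal prod_dividef exp_sum [symmetric] sum_distrib_left sum_negf power_divide)
    finally show "(\<integral>\<^sup>+c. ennreal (exp (- t * (\<Sum>i<m. (c i + W i \<bullet> v)\<^sup>2))) \<partial>?N)
        = ennreal ((1 / sqrt s) ^ m) * ennreal (exp (- (t / s) * (\<Sum>i<m. (W i \<bullet> v)\<^sup>2)))"
      using s by (simp add: ennreal_mult)
  qed
  also have "\<dots> = ennreal ((1 / sqrt s) ^ m) * J (t / s)"
    unfolding J_def by (rule nn_integral_cmult) measurable
  also have "\<dots> = ennreal ((1 / sqrt s) ^ m * sqrt s ^ CARD('d)) * J t"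
    unfolding scale using s by (simp add: ennreal_mult mult.assoc)
  also have "(1 / sqrt s) ^ m * sqrt s ^ CARD('d) = (1 / sqrt s) ^ (m - CARD('d))"
  proof -
    have "(1 / sqrt s) ^ m = (1 / sqrt s) ^ (m - CARD('d)) * (1 / sqrt s) ^ CARD('d)"
      using m by (simp add: power_add [symmetric])
    then show ?thesis using s by (simp add: power_divide)
  qed
  finally show ?thesis
    using Jfin Jpos unfolding s_def by (metis ennreal_mult_cancel_left infinity_ennreal_def mult.commute)
qed

text \<open>The diagonal entry at the unit vector \<open>a\<close> of the pseudo-inverse of the Gram matrix.\<close>
definition gram_pinv :: "nat \<Rightarrow> (nat \<Rightarrow> 'a::euclidean_space) \<Rightarrow> 'a \<Rightarrow> real" where
  "gram_pinv n X a = (\<Sum>i<n. (a \<bullet> pinv_col n X i)\<^sup>2)"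

lemma gram_pinv_cong: "(\<And>i. i < n \<Longrightarrow> X i = Y i) \<Longrightarrow> gram_pinv n X a = gram_pinv n Y a"
  unfolding gram_pinv_def by (intro sum.cong refl) (simp add: pinv_col_cong [of n X Y])

lemma borel_measurable_gram_pinv [measurable (raw)]:
  fixes Y :: "'a \<Rightarrow> nat \<Rightarrow> real^'d"
  assumes "\<And>j. j < n \<Longrightarrow> (\<lambda>x. Y x j) \<in> borel_measurable M"
  shows "(\<lambda>x. gram_pinv n (Y x) a) \<in> borel_measurable M"
  unfolding gram_pinv_def
  by (intro borel_measurable_sum borel_measurable_power borel_measurable_inner borel_measurable_pinv_col
      borel_measurable_const assms) auto

text \<open>\<open>1 / gram_pinv n Z a\<close> is the minimum of
  \<open>\<eta> \<bullet> gram n Z \<eta>\<close> under \<open>a \<bullet> \<eta> = 1\<close>, that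
  is, the squared distance of the design column in direction \<open>a\<close> from the remaining
  columns. The rows \<open>W i\<close> with \<open>i < n\<close> carry these columns and are
  orthogonal to \<open>a\<close>; appending \<open>a\<close> as row \<open>n\<close> makes the rows
  span the whole space. The coefficient \<open>c n\<close> is arbitrary because a step along
  \<open>a\<close> absorbs it.\<close>

lemma gram_pinv_full_rank:
  fixes Z :: "nat \<Rightarrow> 'a::euclidean_space"
  assumes Z: "span (Z ` {..<n}) = UNIV" and a: "norm a = 1"
  defines "W \<equiv> \<lambda>i. if i < n then Z i - (a \<bullet> Z i) *\<^sub>R a else a"
  assumes c: "\<And>i. i < n \<Longrightarrow> c i = a \<bullet> Z i"
  shows "gram_pinv n Z a > 0" and "span (W ` {..<Suc n}) = UNIV"
    and "residual (Suc n) W c = 1 / gram_pinv n Z a"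
proof -
  have aa: "a \<bullet> a = 1" using a by (simp add: norm_eq_1)
  \<comment> \<open>\<open>v\<close> is the inverse Gram matrix applied to \<open>a\<close>, so
    \<open>\<beta>\<close> below is its diagonal entry at \<open>a\<close>.\<close>
  obtain v where v: "gram n Z v = a"
    using gram_image_span [of n Z] Z by (metis UNIV_I imageE)
  have av: "a \<bullet> pinv_col n Z i = Z i \<bullet> v" if "i < n" for i
    using gram_pinv_col [OF that, of Z] v inner_gram_sym [of v n Z "pinv_col n Z i"]
    by (simp add: inner_commute)
  define \<beta> where "\<beta> = gram_pinv n Z a"
  have \<beta>: "\<beta> = a \<bullet> v"
    using inner_gram_self [of v n Z] v by (simp add: \<beta>_def gram_pinv_def av inner_commute)
  have "\<beta> \<ge> 0" by (simp add: \<beta>_def gram_pinv_def sum_nonneg)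
  moreover have "\<beta> \<noteq> 0"
  proof
    assume "\<beta> = 0"
    then have "\<forall>i\<in>{..<n}. (a \<bullet> pinv_col n Z i)\<^sup>2 = 0"
      unfolding \<beta>_def gram_pinv_def by (subst (asm) sum_nonneg_eq_0_iff) auto
    then have "v \<bullet> v = 0" by (intro orthogonal_span_rows [of n Z v v]) (auto simp: Z av)
    then have "gram n Z v = 0" by (simp add: gram_def)
    then show False using v aa by auto
  qed
  ultimately show pos: "gram_pinv n Z a > 0" by (simp add: \<beta>_def)
  have "a \<in> span (W ` {..<Suc n})" by (rule span_base) (auto simp: W_def intro!: image_eqI [of _ _ n])
  have "Z i \<in> span (W ` {..<Suc n})" if "i < n" for i
  proof -
    have "W i \<in> span (W ` {..<Suc n})" using that by (intro span_base) auto
    then have "W i + (a \<bullet> Z i) *\<^sub>R a \<in> span (W ` {..<Suc n})"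
      by (intro span_add span_scale \<open>a \<in> span (W ` {..<Suc n})\<close>)
    then show ?thesis using that by (simp add: W_def)
  qed
  then have "span (Z ` {..<n}) \<subseteq> span (W ` {..<Suc n})"
    by (intro span_minimal subspace_span) auto
  then show "span (W ` {..<Suc n}) = UNIV" using Z by auto
  have expand: "(\<Sum>i<Suc n. (c i + W i \<bullet> u)\<^sup>2) = (\<Sum>i<n. (Z i \<bullet> (a + u - (a \<bullet> u) *\<^sub>R a))\<^sup>2) + (c n + a \<bullet> u)\<^sup>2" for u
  proof -
    have "(\<Sum>i<n. (c i + W i \<bullet> u)\<^sup>2) = (\<Sum>i<n. (Z i \<bullet> (a + u - (a \<bullet> u) *\<^sub>R a))\<^sup>2)"
      by (intro sum.cong refl arg_cong [where f = "\<lambda>x. x\<^sup>2"])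
        (simp add: W_def c inner_diff_left inner_diff_right inner_add_right inner_commute mult.commute)
    then show ?thesis by (simp add: W_def)
  qed
  \<comment> \<open>The square is completed around the constrained minimiser
    \<open>(1 / \<beta>) *\<^sub>R v\<close>. Its image under \<open>gram\<close> is a multiple of
    \<open>a\<close>, so the constraint determines the cross term.\<close>
  have quad: "(\<Sum>i<n. (Z i \<bullet> \<eta>)\<^sup>2) = 1 / \<beta> + (\<Sum>i<n. (Z i \<bullet> (\<eta> - (1 / \<beta>) *\<^sub>R v))\<^sup>2)" if "a \<bullet> \<eta> = 1" for \<eta>
  proof -
    define \<eta>0 where "\<eta>0 = (1 / \<beta>) *\<^sub>R v"
    have g0: "gram n Z \<eta>0 = (1 / \<beta>) *\<^sub>R a" by (simp add: \<eta>0_def linear_scale [OF linear_gram] v)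
    have a0: "a \<bullet> \<eta>0 = 1" using pos by (simp add: \<eta>0_def \<beta> [symmetric]) (simp add: \<beta>_def)
    have "(\<eta> - \<eta>0) \<bullet> gram n Z (\<eta> - \<eta>0) = \<eta> \<bullet> gram n Z \<eta> - 2 * (\<eta> \<bullet> gram n Z \<eta>0) + \<eta>0 \<bullet> gram n Z \<eta>0"
      using inner_gram_sym [of \<eta>0 n Z \<eta>]
      by (simp add: linear_diff [OF linear_gram] inner_diff_left inner_diff_right inner_commute)
    also have "\<dots> = \<eta> \<bullet> gram n Z \<eta> - 1 / \<beta>"
      using that a0 by (simp add: g0 inner_commute)
    finally show ?thesis unfolding inner_gram_self \<eta>0_def by simp
  qed
  have ge: "1 / \<beta> \<le> (\<Sum>i<Suc n. (c i + W i \<bullet> u)\<^sup>2)" for u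
  proof -
    have "a \<bullet> (a + u - (a \<bullet> u) *\<^sub>R a) = 1" by (simp add: inner_diff_right inner_add_right aa)
    from quad [OF this] have "1 / \<beta> \<le> (\<Sum>i<n. (Z i \<bullet> (a + u - (a \<bullet> u) *\<^sub>R a))\<^sup>2)"
      by (simp add: sum_nonneg)
    then show ?thesis unfolding expand by (simp add: add_increasing2)
  qed
  have eq: "(\<Sum>i<Suc n. (c i + W i \<bullet> ((1 / \<beta>) *\<^sub>R v - a - c n *\<^sub>R a))\<^sup>2) = 1 / \<beta>"
  proof -
    \<comment> \<open>The two multiples of \<open>a\<close> make
      \<open>a \<bullet> ?u = - c n\<close>; this kills the last square in \<open>expand\<close> and
      leaves exactly the constrained minimiser in the others.\<close>
    let ?u = "(1 / \<beta>) *\<^sub>R v - a - c n *\<^sub>R a"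
    have av1: "a \<bullet> ((1 / \<beta>) *\<^sub>R v) = 1" using pos by (simp add: \<beta> [symmetric]) (simp add: \<beta>_def)
    then have au: "a \<bullet> ?u = - c n" by (simp add: inner_diff_right aa)
    have "a + ?u - (a \<bullet> ?u) *\<^sub>R a = (1 / \<beta>) *\<^sub>R v" unfolding au by simp
    then show ?thesis unfolding expand au using quad [OF av1] by simp
  qed
  have "residual (Suc n) W c \<le> 1 / \<beta>"
    using residual_le [of "Suc n" W c "(1 / \<beta>) *\<^sub>R v - a - c n *\<^sub>R a"] unfolding eq .
  moreover have "1 / \<beta> \<le> residual (Suc n) W c"
    using residual_attained [of c W "Suc n"] ge by metis
  ultimately show "residual (Suc n) W c = 1 / gram_pinv n Z a" by (simp add: \<beta>_def)
qed

section \<open>Replacing one column of the design\<close>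

text \<open>In an orthonormal basis containing \<open>a\<close>, this is the independence of the
  column belonging to \<open>a\<close> from the other columns. It is resampling along
  \<open>a\<close> in one row, carried over to the product of all rows.\<close>

lemma nn_integral_gauss_rows_resample_column:
  fixes a :: "real^'d" and n :: nat
  assumes \<sigma>: "\<sigma> > 0" and a: "norm a = 1"
    and f [measurable]: "f \<in> borel_measurable (PiM {..<n} (\<lambda>_. gauss_iso \<sigma>))"
  shows "(\<integral>\<^sup>+X. f X \<partial>PiM {..<n} (\<lambda>_. gauss_iso \<sigma>))
    = (\<integral>\<^sup>+X. \<integral>\<^sup>+c. f (\<lambda>i\<in>{..<n}. X i + (c i - a \<bullet> X i) *\<^sub>R a) \<partial>PiM {..<n} (\<lambda>_. normal_law \<sigma>) \<partial>PiM {..<n} (\<lambda>_. gauss_iso \<sigma>))"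
proof -
  let ?M = "gauss_iso \<sigma> :: (real^'d) measure" and ?N = "normal_law \<sigma>"
  interpret N: prob_space ?N using \<sigma> by (rule prob_space_normal_law)
  interpret M: prob_space ?M using \<sigma> by (rule prob_space_gauss_iso)
  interpret MN: pair_prob_space ?M ?N ..
  define g where "g z = fst z + (snd z - a \<bullet> fst z) *\<^sub>R a" for z :: "(real^'d) \<times> real"
  have [measurable]: "g \<in> ?M \<Otimes>\<^sub>M ?N \<rightarrow>\<^sub>M ?M" unfolding g_def by measurable
  have [measurable]: "g \<in> borel_measurable (borel \<Otimes>\<^sub>M borel)" unfolding g_def by measurable
  have "distr (?M \<Otimes>\<^sub>M ?N) ?M g = ?M"
  proof (rule measure_eqI)
    fix B assume "B \<in> sets (distr (?M \<Otimes>\<^sub>M ?N) ?M g)"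
    then have [measurable]: "B \<in> sets borel" by simp
    have "emeasure (distr (?M \<Otimes>\<^sub>M ?N) ?M g) B = (\<integral>\<^sup>+x. indicator B x \<partial>distr (?M \<Otimes>\<^sub>M ?N) ?M g)"
      by (subst nn_integral_indicator) auto
    also have "\<dots> = (\<integral>\<^sup>+z. indicator B (g z) \<partial>(?M \<Otimes>\<^sub>M ?N))"
      by (subst nn_integral_distr) auto
    also have "\<dots> = (\<integral>\<^sup>+x. \<integral>\<^sup>+c. indicator B (g (x, c)) \<partial>?N \<partial>?M)"
      by (rule N.nn_integral_fst [symmetric]) measurable
    also have "\<dots> = (\<integral>\<^sup>+x. indicator B x \<partial>?M)"
      unfolding g_def fst_conv snd_conv
      by (rule nn_integral_gauss_iso_resample_along [OF \<sigma> a, symmetric]) measurable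
    also have "\<dots> = emeasure ?M B" by (subst nn_integral_indicator) auto
    finally show "emeasure (distr (?M \<Otimes>\<^sub>M ?N) ?M g) B = emeasure ?M B" .
  qed simp
  then have "(\<integral>\<^sup>+X. f X \<partial>PiM {..<n} (\<lambda>_. ?M)) = (\<integral>\<^sup>+S. f (\<lambda>i\<in>{..<n}. g (S i)) \<partial>PiM {..<n} (\<lambda>_. ?M \<Otimes>\<^sub>M ?N))"
    by (intro nn_integral_PiM_distr) (auto intro: M.prob_space_axioms MN.prob_space_axioms)
  also have "\<dots> = (\<integral>\<^sup>+X. \<integral>\<^sup>+c. f (\<lambda>i\<in>{..<n}. g ((\<lambda>i\<in>{..<n}. (X i, c i)) i)) \<partial>PiM {..<n} (\<lambda>_. ?N) \<partial>PiM {..<n} (\<lambda>_. ?M))"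
  proof (rule nn_integral_PiM_pair)
    have "(\<lambda>S. \<lambda>i\<in>{..<n}. g (S i)) \<in> PiM {..<n} (\<lambda>_. ?M \<Otimes>\<^sub>M ?N) \<rightarrow>\<^sub>M PiM {..<n} (\<lambda>_. ?M)"
      by (intro measurable_restrict) measurable
    then show "(\<lambda>S. f (\<lambda>i\<in>{..<n}. g (S i))) \<in> borel_measurable (PiM {..<n} (\<lambda>_. ?M \<Otimes>\<^sub>M ?N))"
      by measurable
  qed (auto intro: M.prob_space_axioms N.prob_space_axioms)
  also have "\<dots> = (\<integral>\<^sup>+X. \<integral>\<^sup>+c. f (\<lambda>i\<in>{..<n}. X i + (c i - a \<bullet> X i) *\<^sub>R a) \<partial>PiM {..<n} (\<lambda>_. ?N) \<partial>PiM {..<n} (\<lambda>_. ?M))"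
    by (intro nn_integral_cong arg_cong [where f = f]) (auto simp: g_def restrict_def)
  finally show ?thesis .
qed

text \<open>The exceptional set of \<open>P\<close> is enclosed in a measurable null set
  \<open>N\<close>, and the resampling identity is applied to the indicator of \<open>N\<close>; a
  vanishing double integral makes almost every inner integral vanish.\<close>

lemma AE_gauss_rows_resample_column:
  fixes a :: "real^'d" and n :: nat
  assumes \<sigma>: "\<sigma> > 0" and a: "norm a = 1"
    and P: "AE X in PiM {..<n} (\<lambda>_. gauss_iso \<sigma>). P X"
  shows "AE X in PiM {..<n} (\<lambda>_. gauss_iso \<sigma>). AE c in PiM {..<n} (\<lambda>_. normal_law \<sigma>).
    P (\<lambda>i\<in>{..<n}. X i + (c i - a \<bullet> X i) *\<^sub>R a)"
proof -
  let ?P = "PiM {..<n} (\<lambda>_. gauss_iso \<sigma> :: (real^'d) measure)" and ?Q = "PiM {..<n} (\<lambda>_. normal_law \<sigma>)"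
  interpret Q: prob_space ?Q by (intro prob_space_PiM prob_space_normal_law \<sigma>)
  obtain N where N: "{X \<in> space ?P. \<not> P X} \<subseteq> N" "emeasure ?P N = 0" "N \<in> sets ?P"
    using P by (rule AE_E)
  define Z where "Z z = (\<lambda>i\<in>{..<n}. fst z i + (snd z i - a \<bullet> fst z i) *\<^sub>R a)" for z
  have Zm [measurable]: "Z \<in> ?P \<Otimes>\<^sub>M ?Q \<rightarrow>\<^sub>M ?P"
    unfolding Z_def by (intro measurable_restrict) measurable
  have [measurable]: "N \<in> sets ?P" by fact
  have "(\<integral>\<^sup>+X. \<integral>\<^sup>+c. indicator N (Z (X, c)) \<partial>?Q \<partial>?P) = (\<integral>\<^sup>+X. indicator N X \<partial>?P)"
    unfolding Z_def fst_conv snd_conv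
    by (rule nn_integral_gauss_rows_resample_column [OF \<sigma> a, symmetric]) measurable
  then have "(\<integral>\<^sup>+X. \<integral>\<^sup>+c. indicator N (Z (X, c)) \<partial>?Q \<partial>?P) = 0" using N by simp
  moreover have "(\<lambda>X. \<integral>\<^sup>+c. indicator N (Z (X, c)) \<partial>?Q) \<in> borel_measurable ?P"
    by (intro Q.borel_measurable_nn_integral) measurable
  ultimately have "AE X in ?P. (\<integral>\<^sup>+c. indicator N (Z (X, c)) \<partial>?Q) = 0"
    by (subst (asm) nn_integral_0_iff_AE) auto
  with AE_space [of ?P] show ?thesis
  proof eventually_elim
    case (elim X)
    have ZX: "(\<lambda>c. Z (X, c)) \<in> ?Q \<rightarrow>\<^sub>M ?P" using elim(1) by measurable
    then have "(\<lambda>c. indicator N (Z (X, c)) :: ennreal) \<in> borel_measurable ?Q" by measurable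
    with elim(2) have "AE c in ?Q. (indicator N (Z (X, c)) :: ennreal) = 0"
      by (subst (asm) nn_integral_0_iff_AE) auto
    with AE_space [of ?Q] show ?case
    proof eventually_elim
      case (elim c)
      then have "Z (X, c) \<notin> N" by (simp add: indicator_def split: if_splits)
      moreover have "Z (X, c) \<in> space ?P" using measurable_space [OF ZX elim(1)] .
      ultimately show ?case using N(1) unfolding Z_def by auto
    qed
  qed
qed

lemma AE_gauss_rows_full_rank:
  assumes \<sigma>: "\<sigma> > 0" and n: "n \<ge> CARD('d)"
  shows "AE X in PiM {..<n} (\<lambda>_. gauss_iso \<sigma> :: (real^'d) measure). span (X ` {..<n}) = UNIV"
  using AE_gauss_rows_dim [OF \<sigma>, of n, where 'd = 'd]
proof eventually_elim
  case (elim X)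
  then have "dim (X ` {..<n}) = DIM(real^'d)" using n by simp
  then show ?case by (simp only: dim_eq_full)
qed

text \<open>With the other columns frozen, the reciprocal of \<open>gram_pinv\<close> is the
  residual of the fresh column against \<open>CARD('d) - 1\<close> columns of length
  \<open>n\<close>, which explains the exponent.\<close>

lemma nn_integral_gauss_rows_gram_pinv_laplace:
  fixes a :: "real^'d"
  assumes \<sigma>: "\<sigma> > 0" and a: "norm a = 1" and n: "n \<ge> CARD('d)" and t: "t \<ge> 0"
  shows "(\<integral>\<^sup>+X. ennreal (exp (- t * (1 / gram_pinv n X a))) \<partial>PiM {..<n} (\<lambda>_. gauss_iso \<sigma>))
    = ennreal ((1 / sqrt (1 + 2 * t * \<sigma>\<^sup>2)) ^ (Suc n - CARD('d)))"
proof -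
  let ?P = "PiM {..<n} (\<lambda>_. gauss_iso \<sigma> :: (real^'d) measure)" and ?Q = "PiM {..<n} (\<lambda>_. normal_law \<sigma>)"
  interpret N: prob_space "normal_law \<sigma>" using \<sigma> by (rule prob_space_normal_law)
  interpret P: prob_space ?P by (intro prob_space_PiM prob_space_gauss_iso \<sigma>)
  interpret product_sigma_finite "\<lambda>_::nat. normal_law \<sigma>" by unfold_locales
  let ?v = "ennreal ((1 / sqrt (1 + 2 * t * \<sigma>\<^sup>2)) ^ (Suc n - CARD('d)))"
  show ?thesis
  proof (cases "t = 0")
    case True
    then show ?thesis by (simp add: P.emeasure_space_1)
  next
    case False
    define F where "F X = ennreal (exp (- t * (1 / gram_pinv n X a)))" for X :: "nat \<Rightarrow> real^'d"
    have [measurable]: "(\<lambda>X. X j) \<in> borel_measurable ?P" if "j < n" for j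
      using measurable_component_singleton [of j "{..<n}" "\<lambda>_. gauss_iso \<sigma> :: (real^'d) measure"] that by simp
    have [measurable]: "(\<lambda>X. gram_pinv n X a) \<in> borel_measurable ?P"
      by (intro borel_measurable_gram_pinv) auto
    have [measurable]: "F \<in> borel_measurable ?P" unfolding F_def by measurable
    define Z where "Z X c = (\<lambda>i\<in>{..<n}. X i + (c i - a \<bullet> X i) *\<^sub>R a)" for X c
    have aa: "a \<bullet> a = 1" using a by (simp add: norm_eq_1)
    have "(\<integral>\<^sup>+X. F X \<partial>?P) = (\<integral>\<^sup>+X. \<integral>\<^sup>+c. F (Z X c) \<partial>?Q \<partial>?P)"
      unfolding Z_def by (rule nn_integral_gauss_rows_resample_column [OF \<sigma> a]) measurable
    also have "\<dots> = (\<integral>\<^sup>+X. ?v \<partial>?P)"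
    proof (rule nn_integral_cong_AE)
      show "AE X in ?P. (\<integral>\<^sup>+c. F (Z X c) \<partial>?Q) = ?v"
        using AE_gauss_rows_full_rank [OF \<sigma> n]
          AE_gauss_rows_resample_column [OF \<sigma> a AE_gauss_rows_full_rank [OF \<sigma> n], folded Z_def]
      proof eventually_elim
        case (elim X)
        define W where "W i = (if i < n then X i - (a \<bullet> X i) *\<^sub>R a else a)" for i
        have W: "span (W ` {..<Suc n}) = UNIV"
          unfolding W_def by (rule gram_pinv_full_rank(2) [OF elim(1) a, of "\<lambda>i. a \<bullet> X i"]) simp
        \<comment> \<open>The appended row of \<open>W\<close> calls for one more coefficient. The
          residual does not depend on it, so averaging over a further normal variable
          \<open>g\<close> changes nothing and completes the product measure over
          \<open>Suc n\<close> indices.\<close>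
        have "(\<integral>\<^sup>+c. F (Z X c) \<partial>?Q) = (\<integral>\<^sup>+c. \<integral>\<^sup>+g. ennreal (exp (- t * residual (Suc n) W (c(n := g)))) \<partial>normal_law \<sigma> \<partial>?Q)"
        proof (rule nn_integral_cong_AE)
          show "AE c in ?Q. F (Z X c) = (\<integral>\<^sup>+g. ennreal (exp (- t * residual (Suc n) W (c(n := g)))) \<partial>normal_law \<sigma>)"
            using elim(2)
          proof eventually_elim
            case (elim c)
            have aZ: "a \<bullet> Z X c i = c i" if "i < n" for i
              using that by (simp add: Z_def inner_add_right aa)
            have W_eq: "(\<lambda>i. if i < n then Z X c i - (a \<bullet> Z X c i) *\<^sub>R a else a) = W"
              using aZ by (auto simp: W_def fun_eq_iff) (simp add: Z_def algebra_simps)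
            have "residual (Suc n) W (c(n := g)) = 1 / gram_pinv n (Z X c) a" for g
              using gram_pinv_full_rank(3) [OF elim a, of "c(n := g)"] aZ unfolding W_eq by simp
            then show ?case by (simp add: F_def N.emeasure_space_1 del: space_normal_law)
          qed
        qed
        also have "\<dots> = (\<integral>\<^sup>+c. ennreal (exp (- t * residual (Suc n) W c)) \<partial>PiM (insert n {..<n}) (\<lambda>_. normal_law \<sigma>))"
        proof (rule product_nn_integral_insert [symmetric])
          have [measurable]: "(\<lambda>c. c i) \<in> borel_measurable (PiM (insert n {..<n}) (\<lambda>_. normal_law \<sigma>))" if "i < Suc n" for i
            using measurable_component_singleton [of i "insert n {..<n}" "\<lambda>_. normal_law \<sigma>"] that
            by (simp add: less_Suc_eq disj_commute)
          have [measurable]: "(\<lambda>c. residual (Suc n) W c) \<in> borel_measurable (PiM (insert n {..<n}) (\<lambda>_. normal_law \<sigma>))"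
            unfolding residual_def
            by (intro borel_measurable_sum borel_measurable_power borel_measurable_diff
                borel_measurable_inner borel_measurable_scaleR) auto
          show "(\<lambda>c. ennreal (exp (- t * residual (Suc n) W c))) \<in> borel_measurable (PiM (insert n {..<n}) (\<lambda>_. normal_law \<sigma>))"
            by measurable
        qed auto
        also have "\<dots> = ?v"
          unfolding lessThan_Suc [symmetric]
          using nn_integral_residual_laplace [OF W \<sigma>, of t] t False by simp
        finally show ?case .
      qed
    qed
    also have "\<dots> = ?v" by (simp add: P.emeasure_space_1)
    finally show ?thesis by (simp add: F_def)
  qed
qed

lemma nn_integral_gram_pinv_overdetermined:
  fixes a :: "real^'d"
  assumes \<sigma>: "\<sigma> > 0" and a: "norm a = 1" and n: "n \<ge> CARD('d)"
  shows "(\<integral>\<^sup>+X. ennreal (gram_pinv n X a) \<partial>PiM {..<n} (\<lambda>_. gauss_iso \<sigma>))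
    = (if n > CARD('d) + 1 then ennreal (1 / (\<sigma>\<^sup>2 * (real n - real CARD('d) - 1))) else \<infinity>)"
proof -
  let ?P = "PiM {..<n} (\<lambda>_. gauss_iso \<sigma> :: (real^'d) measure)"
  have [measurable]: "(\<lambda>X. X j) \<in> borel_measurable ?P" if "j < n" for j
    using measurable_component_singleton [of j "{..<n}" "\<lambda>_. gauss_iso \<sigma> :: (real^'d) measure"] that by simp
  have meas [measurable]: "(\<lambda>X. gram_pinv n X a) \<in> borel_measurable ?P"
    by (intro borel_measurable_gram_pinv) auto
  have "(\<integral>\<^sup>+X. ennreal (1 / (1 / gram_pinv n X a)) \<partial>?P)
      = (if Suc n - CARD('d) \<ge> 3 then ennreal (1 / (\<sigma>\<^sup>2 * (real (Suc n - CARD('d)) - 2))) else \<infinity>)"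
  proof (rule nn_integral_inverse_of_laplace)
    show "prob_space ?P" by (intro prob_space_PiM prob_space_gauss_iso \<sigma>)
    show "AE X in ?P. 0 < 1 / gram_pinv n X a"
      using AE_gauss_rows_full_rank [OF \<sigma> n]
    proof eventually_elim
      case (elim X)
      then show ?case using gram_pinv_full_rank(1) [OF elim a, of "\<lambda>i. a \<bullet> X i"] by simp
    qed
    show "(\<integral>\<^sup>+X. ennreal (exp (- t * (1 / gram_pinv n X a))) \<partial>?P)
        = ennreal ((1 / sqrt (1 + 2 * t * \<sigma>\<^sup>2)) ^ (Suc n - CARD('d)))" if "t \<ge> 0" for t
      using nn_integral_gauss_rows_gram_pinv_laplace [OF \<sigma> a n that] .
  qed (use \<sigma> in auto)
  then show ?thesis using n by (auto simp: of_nat_diff Suc_diff_le algebra_simps)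
qed

lemma nn_integral_norm_pinv_col_underdetermined:
  assumes \<sigma>: "\<sigma> > 0" and n: "n \<le> CARD('d)" and i: "i < n"
  shows "(\<integral>\<^sup>+X. ennreal ((norm (pinv_col n X i))\<^sup>2) \<partial>PiM {..<n} (\<lambda>_. gauss_iso \<sigma> :: (real^'d) measure))
    = (if n + 1 < CARD('d) then ennreal (1 / (\<sigma>\<^sup>2 * (real CARD('d) - real n - 1))) else \<infinity>)"
proof -
  let ?P = "PiM {..<n} (\<lambda>_. gauss_iso \<sigma> :: (real^'d) measure)"
  have [measurable]: "(\<lambda>X. X j) \<in> borel_measurable ?P" if "j < n" for j
    using measurable_component_singleton [of j "{..<n}" "\<lambda>_. gauss_iso \<sigma> :: (real^'d) measure"] that by simp
  have meas [measurable]: "(\<lambda>X. pinv_col n X i) \<in> borel_measurable ?P"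
    using i by (intro borel_measurable_pinv_col) auto
  have "(\<integral>\<^sup>+X. ennreal (1 / (1 / (norm (pinv_col n X i))\<^sup>2)) \<partial>?P)
      = (if CARD('d) + 1 - n \<ge> 3 then ennreal (1 / (\<sigma>\<^sup>2 * (real (CARD('d) + 1 - n) - 2))) else \<infinity>)"
  proof (rule nn_integral_inverse_of_laplace)
    show "prob_space ?P" by (intro prob_space_PiM prob_space_gauss_iso \<sigma>)
    show "AE X in ?P. 0 < 1 / (norm (pinv_col n X i))\<^sup>2"
      using AE_gauss_rows_dim [OF \<sigma>, of n, where 'd = 'd]
    proof eventually_elim
      case (elim X)
      then have "X i \<bullet> pinv_col n X i = 1" using inner_pinv_col_row [of X n i i] n i by simp
      then show ?case by auto
    qed
    show "(\<integral>\<^sup>+X. ennreal (exp (- t * (1 / (norm (pinv_col n X i))\<^sup>2))) \<partial>?P)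
        = ennreal ((1 / sqrt (1 + 2 * t * \<sigma>\<^sup>2)) ^ (CARD('d) + 1 - n))" if "t \<ge> 0" for t
      using nn_integral_gauss_rows_laplace [OF \<sigma> that i n] .
  qed (use \<sigma> in auto)
  then show ?thesis using n by (auto simp: of_nat_diff Suc_diff_le algebra_simps)
qed

section \<open>Rotation invariance of the design\<close>

lemma nn_integral_gauss_rows_orthogonal:
  fixes f :: "real^'d \<Rightarrow> real^'d" and n :: nat
  assumes \<sigma>: "\<sigma> > 0" and f: "orthogonal_transformation f"
    and F: "F \<in> borel_measurable (PiM {..<n} (\<lambda>_. gauss_iso \<sigma>))"
  shows "(\<integral>\<^sup>+X. F X \<partial>PiM {..<n} (\<lambda>_. gauss_iso \<sigma>)) = (\<integral>\<^sup>+X. F (\<lambda>i\<in>{..<n}. f (X i)) \<partial>PiM {..<n} (\<lambda>_. gauss_iso \<sigma>))"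
  using borel_measurable_orthogonal_transformation [OF f]
  by (intro nn_integral_PiM_distr distr_gauss_iso_orthogonal prob_space_gauss_iso \<sigma> f F) auto

lemma borel_measurable_rows:
  fixes n :: nat
  shows "j < n \<Longrightarrow> (\<lambda>X. X j) \<in> borel_measurable (PiM {..<n} (\<lambda>_. gauss_iso \<sigma> :: (real^'d) measure))"
  using measurable_component_singleton [of j "{..<n}" "\<lambda>_. gauss_iso \<sigma> :: (real^'d) measure"] by simp

lemma borel_measurable_gram_pinv_rows:
  "(\<lambda>X. gram_pinv n X a) \<in> borel_measurable (PiM {..<n} (\<lambda>_. gauss_iso \<sigma> :: (real^'d) measure))"
  by (intro borel_measurable_gram_pinv borel_measurable_rows)

lemma borel_measurable_row_proj_rows:
  "(\<lambda>X. row_proj n X v) \<in> borel_measurable (PiM {..<n} (\<lambda>_. gauss_iso \<sigma> :: (real^'d) measure))"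
  by (intro borel_measurable_row_proj borel_measurable_rows borel_measurable_const)

lemma inner_orthogonal_transformation:
  "orthogonal_transformation f \<Longrightarrow> f u \<bullet> f v = u \<bullet> v"
  by (simp add: orthogonal_transformation_def)

lemma gram_pinv_orthogonal:
  assumes f: "orthogonal_transformation f"
  shows "gram_pinv n (\<lambda>i. f (X i)) (f a) = gram_pinv n X a"
  by (simp add: gram_pinv_def pinv_col_orthogonal [OF f] inner_orthogonal_transformation [OF f])

text \<open>Rotating all rows by a map that takes \<open>a\<close> to \<open>b\<close> preserves the
  law of the design and carries one diagonal entry into the other.\<close>

lemma nn_integral_gram_pinv_isotropic:
  fixes a b :: "real^'d"
  assumes \<sigma>: "\<sigma> > 0" and ab: "norm a = 1" "norm b = 1"
  shows "(\<integral>\<^sup>+X. ennreal (gram_pinv n X a) \<partial>PiM {..<n} (\<lambda>_. gauss_iso \<sigma>))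
    = (\<integral>\<^sup>+X. ennreal (gram_pinv n X b) \<partial>PiM {..<n} (\<lambda>_. gauss_iso \<sigma>))"
proof -
  obtain f :: "real^'d \<Rightarrow> real^'d" where f: "orthogonal_transformation f" "f a = b"
    using orthogonal_transformation_exists_1 [OF ab] by metis
  have "gram_pinv n (\<lambda>i\<in>{..<n}. f (X i)) b = gram_pinv n X a" for X
    using gram_pinv_orthogonal [OF f(1), of n X a] gram_pinv_cong [of n "\<lambda>i\<in>{..<n}. f (X i)" "\<lambda>i. f (X i)" b] f(2)
    by simp
  then show ?thesis
    using borel_measurable_gram_pinv_rows [of n b \<sigma>]
    by (subst (2) nn_integral_gauss_rows_orthogonal [OF \<sigma> f(1)]) auto
qed

lemma sum_axis_inner_sq: "(\<Sum>j\<in>UNIV. (axis j 1 \<bullet> v)\<^sup>2) = (norm (v :: real^'d))\<^sup>2"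
  by (simp add: inner_axis' power2_norm_eq_inner) (simp add: inner_vec_def power2_eq_square)

text \<open>By isotropy all coordinate axes have the same expectation. Their sum is the trace of the
  pseudo-inverse Gram matrix, equal to the sum of the squared lengths of the \<open>n\<close>
  columns \<open>pinv_col n X i\<close>. Keeping the factor \<open>CARD('d)\<close> on the left
  covers the infinite case as well.\<close>

lemma nn_integral_gram_pinv_underdetermined_aux:
  fixes a :: "real^'d"
  assumes \<sigma>: "\<sigma> > 0" and a: "norm a = 1" and n: "n \<le> CARD('d)"
  shows "of_nat CARD('d) * (\<integral>\<^sup>+X. ennreal (gram_pinv n X a) \<partial>PiM {..<n} (\<lambda>_. gauss_iso \<sigma>))
    = of_nat n * (if n + 1 < CARD('d) then ennreal (1 / (\<sigma>\<^sup>2 * (real CARD('d) - real n - 1))) else \<infinity>)"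
proof -
  let ?P = "PiM {..<n} (\<lambda>_. gauss_iso \<sigma> :: (real^'d) measure)"
  have m: "(\<lambda>X. ennreal ((norm (pinv_col n X i))\<^sup>2)) \<in> borel_measurable ?P" if "i < n" for i
  proof -
    have "(\<lambda>X. pinv_col n X i) \<in> borel_measurable ?P"
      using that by (intro borel_measurable_pinv_col borel_measurable_rows)
    then show ?thesis by measurable
  qed
  have "of_nat CARD('d) * (\<integral>\<^sup>+X. ennreal (gram_pinv n X a) \<partial>?P)
      = (\<Sum>j\<in>(UNIV::'d set). \<integral>\<^sup>+X. ennreal (gram_pinv n X a) \<partial>?P)" by simp
  also have "\<dots> = (\<Sum>j\<in>(UNIV::'d set). \<integral>\<^sup>+X. ennreal (gram_pinv n X (axis j 1)) \<partial>?P)"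
    by (intro sum.cong refl nn_integral_gram_pinv_isotropic \<sigma> a) simp
  also have "\<dots> = (\<integral>\<^sup>+X. (\<Sum>j\<in>(UNIV::'d set). ennreal (gram_pinv n X (axis j 1))) \<partial>?P)"
    using borel_measurable_gram_pinv_rows by (intro nn_integral_sum [symmetric]) simp
  also have "\<dots> = (\<integral>\<^sup>+X. (\<Sum>i<n. ennreal ((norm (pinv_col n X i))\<^sup>2)) \<partial>?P)"
  proof (intro nn_integral_cong)
    fix X :: "nat \<Rightarrow> real^'d"
    have "(\<Sum>j\<in>UNIV. gram_pinv n X (axis j 1)) = (\<Sum>i<n. (norm (pinv_col n X i))\<^sup>2)"
      unfolding gram_pinv_def by (subst sum.swap) (simp add: sum_axis_inner_sq)
    then show "(\<Sum>j\<in>(UNIV::'d set). ennreal (gram_pinv n X (axis j 1))) = (\<Sum>i<n. ennreal ((norm (pinv_col n X i))\<^sup>2))"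
      by (simp add: sum_ennreal gram_pinv_def sum_nonneg)
  qed
  also have "\<dots> = (\<Sum>i<n. \<integral>\<^sup>+X. ennreal ((norm (pinv_col n X i))\<^sup>2) \<partial>?P)"
    by (intro nn_integral_sum m) simp
  also have "\<dots> = (\<Sum>i<n. if n + 1 < CARD('d) then ennreal (1 / (\<sigma>\<^sup>2 * (real CARD('d) - real n - 1))) else \<infinity>)"
    by (intro sum.cong refl nn_integral_norm_pinv_col_underdetermined \<sigma> n) simp
  also have "\<dots> = of_nat n * (if n + 1 < CARD('d) then ennreal (1 / (\<sigma>\<^sup>2 * (real CARD('d) - real n - 1))) else \<infinity>)"
    by simp
  finally show ?thesis .
qed

lemma nn_integral_gram_pinv_underdetermined:
  fixes a :: "real^'d"
  assumes \<sigma>: "\<sigma> > 0" and a: "norm a = 1" and n: "n + 1 < CARD('d)"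
  shows "(\<integral>\<^sup>+X. ennreal (gram_pinv n X a) \<partial>PiM {..<n} (\<lambda>_. gauss_iso \<sigma>))
    = ennreal (real n / (real CARD('d) * (\<sigma>\<^sup>2 * (real CARD('d) - real n - 1))))"
proof -
  let ?I = "\<integral>\<^sup>+X. ennreal (gram_pinv n X a) \<partial>PiM {..<n} (\<lambda>_. gauss_iso \<sigma>)"
  let ?v = "\<sigma>\<^sup>2 * (real CARD('d) - real n - 1)"
  have v: "?v > 0" using \<sigma> n by simp
  have "of_nat CARD('d) * ?I = of_nat n * ennreal (1 / ?v)"
    using nn_integral_gram_pinv_underdetermined_aux [OF \<sigma> a, of n] n by simp
  also have "\<dots> = of_nat CARD('d) * ennreal (real n / (real CARD('d) * ?v))"
    using v by (simp add: ennreal_of_nat_eq_real_of_nat ennreal_mult [symmetric])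
  finally show ?thesis by (simp add: ennreal_mult_cancel_left)
qed

text \<open>The condition \<open>0 < n\<close> keeps \<open>of_nat n * \<infinity>\<close> from
  collapsing to zero.\<close>

lemma nn_integral_gram_pinv_threshold:
  fixes a :: "real^'d"
  assumes \<sigma>: "\<sigma> > 0" and a: "norm a = 1" and n: "0 < n" "n \<le> CARD('d)" "CARD('d) \<le> n + 1"
  shows "(\<integral>\<^sup>+X. ennreal (gram_pinv n X a) \<partial>PiM {..<n} (\<lambda>_. gauss_iso \<sigma>)) = \<infinity>"
proof -
  have "of_nat CARD('d) * (\<integral>\<^sup>+X. ennreal (gram_pinv n X a) \<partial>PiM {..<n} (\<lambda>_. gauss_iso \<sigma>)) = \<infinity>"
    using nn_integral_gram_pinv_underdetermined_aux [OF \<sigma> a, of n] n by (simp add: ennreal_mult_top)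
  then show ?thesis by (simp add: ennreal_mult_eq_top_iff)
qed

section \<open>Second moments of the random projection\<close>

text \<open>After a rotation taking \<open>a\<close> to \<open>a'\<close>, the Householder
  reflection \<open>h\<close> along \<open>v\<close> exchanges \<open>f b\<close> and
  \<open>b'\<close>. Both are orthogonal to \<open>a'\<close>, hence so is \<open>v\<close>, and
  \<open>h\<close> leaves \<open>a'\<close> in place.\<close>

lemma orthogonal_transformation_exists_pair:
  fixes a b a' b' :: "real^'d"
  assumes "norm a = 1" "norm b = 1" "a \<bullet> b = 0" "norm a' = 1" "norm b' = 1" "a' \<bullet> b' = 0"
  obtains f :: "real^'d \<Rightarrow> real^'d" where "orthogonal_transformation f" "f a = a'" "f b = b'"
proof -
  obtain f :: "real^'d \<Rightarrow> real^'d" where f: "orthogonal_transformation f" "f a = a'"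
    using orthogonal_transformation_exists_1 [OF assms(1,4)] by metis
  define v where "v = f b - b'"
  have fb: "f b \<bullet> f b = 1" "b' \<bullet> b' = 1" "a' \<bullet> f b = 0"
    using assms inner_orthogonal_transformation [OF f(1), of b b] inner_orthogonal_transformation [OF f(1), of a b]
    by (auto simp: norm_eq_1 f(2))
  show ?thesis
  proof (cases "v = 0")
    case True
    then show ?thesis using that [OF f] by (simp add: v_def)
  next
    case False
    define h where "h x = x - (2 * (x \<bullet> v) / (v \<bullet> v)) *\<^sub>R v" for x
    have vv: "v \<bullet> v \<noteq> 0" using False by simp
    have lin: "linear h"
    proof (rule linearI)
      show "h (x + y) = h x + h y" for x y
        by (simp add: h_def inner_add_left distrib_left add_divide_distrib scaleR_add_left)
      show "h (c *\<^sub>R x) = c *\<^sub>R h x" for c x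
        by (simp add: h_def scaleR_diff_right mult.left_commute)
    qed
    have "h x \<bullet> h y = x \<bullet> y" for x y
    proof -
      define \<alpha> where "\<alpha> = 2 * (x \<bullet> v) / (v \<bullet> v)"
      define \<beta> where "\<beta> = 2 * (y \<bullet> v) / (v \<bullet> v)"
      have "\<alpha> * (v \<bullet> v) = 2 * (x \<bullet> v)" using vv by (simp add: \<alpha>_def)
      then have "\<beta> * (\<alpha> * (v \<bullet> v)) = 2 * (\<beta> * (x \<bullet> v))" by simp
      moreover have "\<beta> * (x \<bullet> v) = \<alpha> * (y \<bullet> v)" by (simp add: \<alpha>_def \<beta>_def)
      moreover have "h x \<bullet> h y = x \<bullet> y - \<beta> * (x \<bullet> v) - \<alpha> * (y \<bullet> v) + \<beta> * (\<alpha> * (v \<bullet> v))"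
        unfolding h_def \<alpha>_def [symmetric] \<beta>_def [symmetric]
        by (simp add: inner_diff_left inner_diff_right inner_commute [of v y] right_diff_distrib)
      ultimately show ?thesis by linarith
    qed
    with lin have orth: "orthogonal_transformation h"
      unfolding orthogonal_transformation_def by blast
    have "a' \<bullet> v = 0" by (simp add: v_def inner_diff_right fb assms)
    then have "h a' = a'" by (simp add: h_def)
    moreover have "h (f b) = b'"
    proof -
      have "v \<bullet> v = 2 * (f b \<bullet> v)"
        unfolding v_def by (simp add: inner_diff_left inner_diff_right fb inner_commute)
      then have "2 * (f b \<bullet> v) / (v \<bullet> v) = 1" using vv by (metis divide_self)
      then have "h (f b) = f b - v" unfolding h_def by (simp only: scaleR_one)
      then show ?thesis by (simp add: v_def)
    qed
    moreover have "orthogonal_transformation (h \<circ> f)"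
      by (intro orthogonal_transformation_compose f orth)
    ultimately show ?thesis using that [of "h \<circ> f"] f by simp
  qed
qed

text \<open>Expanded in an orthonormal basis \<open>C\<close> of the row space, the trace of the
  projection counts the elements of \<open>C\<close>.\<close>

lemma sum_row_proj_trace:
  fixes X :: "nat \<Rightarrow> real^'d"
  shows "(\<Sum>j\<in>UNIV. axis j 1 \<bullet> row_proj n X (axis j 1)) = real (dim (X ` {..<n}))"
proof -
  obtain C where C: "C \<subseteq> span (X ` {..<n})" "pairwise orthogonal C" "\<And>b. b \<in> C \<Longrightarrow> norm b = 1"
      "independent C" "card C = dim (span (X ` {..<n}))" "span C = span (X ` {..<n})"
    using orthonormal_basis_subspace [OF subspace_span] by metis
  have "finite C" using C(4) by (rule independent_imp_finite)
  have "axis j 1 \<bullet> row_proj n X (axis j 1) = (\<Sum>u\<in>C. (axis j 1 \<bullet> u)\<^sup>2)" for j :: 'd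
  proof -
    have "axis j 1 \<bullet> row_proj n X (axis j 1) = (\<Sum>u\<in>C. (u \<bullet> row_proj n X (axis j 1))\<^sup>2)"
      using sum_inner_orthonormal_sq [OF C(2,3) \<open>finite C\<close>, of "row_proj n X (axis j 1)"]
        row_proj_in_span [of n X] C(6) by (simp add: norm_row_proj_sq)
    also have "\<dots> = (\<Sum>u\<in>C. (axis j 1 \<bullet> u)\<^sup>2)"
      using C(1) by (intro sum.cong refl) (auto simp: inner_row_proj_eq inner_commute)
    finally show ?thesis .
  qed
  then have "(\<Sum>j\<in>UNIV. axis j 1 \<bullet> row_proj n X (axis j 1)) = (\<Sum>u\<in>C. \<Sum>j\<in>UNIV. (axis j 1 \<bullet> u)\<^sup>2)"
    by (simp add: sum.swap [of _ _ C])
  also have "\<dots> = real (card C)" by (simp add: sum_axis_inner_sq C(3))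
  finally show ?thesis using C(5) by simp
qed

text \<open>By rotation invariance all orthonormal pairs share one second moment \<open>Q\<close>.
  It also governs the squared difference of two diagonal entries, so a combination of such squares
  whose sum is almost surely constant determines \<open>Q\<close>.\<close>

lemma nn_integral_row_proj_sq_orthonormal:
  fixes a b :: "real^'d"
  assumes \<sigma>: "\<sigma> > 0" and ab: "norm a = 1" "norm b = 1" "a \<bullet> b = 0" and n: "n \<le> CARD('d)"
  shows "(\<integral>\<^sup>+X. ennreal ((a \<bullet> row_proj n X b)\<^sup>2) \<partial>PiM {..<n} (\<lambda>_. gauss_iso \<sigma>))
    = ennreal (real n * (real CARD('d) - real n) / (real CARD('d) * (real CARD('d) - 1) * (real CARD('d) + 2)))"
proof -
  let ?P = "PiM {..<n} (\<lambda>_. gauss_iso \<sigma> :: (real^'d) measure)"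
  interpret P: prob_space ?P by (intro prob_space_PiM prob_space_gauss_iso \<sigma>)
  define d where "d = real CARD('d)"
  define \<pi> where "\<pi> X u v = u \<bullet> row_proj n X v" for X and u v :: "real^'d"
  have \<pi>_meas [measurable]: "(\<lambda>X. \<pi> X u v) \<in> borel_measurable ?P" for u v
    unfolding \<pi>_def using borel_measurable_row_proj_rows by measurable
  define Q where "Q = (\<integral>\<^sup>+X. ennreal ((\<pi> X a b)\<^sup>2) \<partial>?P)"
  have Q: "(\<integral>\<^sup>+X. ennreal ((\<pi> X u v)\<^sup>2) \<partial>?P) = Q" if uv: "norm u = 1" "norm v = 1" "u \<bullet> v = 0" for u v
  proof -
    obtain f :: "real^'d \<Rightarrow> real^'d" where f: "orthogonal_transformation f" "f a = u" "f b = v"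
      using orthogonal_transformation_exists_pair [OF ab uv] by metis
    have "\<pi> (\<lambda>i\<in>{..<n}. f (X i)) u v = \<pi> X a b" for X
    proof -
      have "row_proj n (\<lambda>i\<in>{..<n}. f (X i)) = row_proj n (\<lambda>i. f (X i))" by (rule row_proj_cong) simp
      then show ?thesis
        using row_proj_orthogonal [OF f(1), of n X b] f inner_orthogonal_transformation [OF f(1), of a]
        by (simp add: \<pi>_def)
    qed
    then show ?thesis
      unfolding Q_def by (subst nn_integral_gauss_rows_orthogonal [OF \<sigma> f(1)]) auto
  qed
  define e where "e i = (axis i 1 :: real^'d)" for i
  have e: "norm (e i) = 1" "i \<noteq> j \<Longrightarrow> e i \<bullet> e j = 0" for i j
    by (auto simp: e_def inner_axis_axis)
  have diag: "(\<integral>\<^sup>+X. ennreal ((\<pi> X (e i) (e i) - \<pi> X (e j) (e j))\<^sup>2) \<partial>?P) = 4 * Q" if "i \<noteq> j" for i j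
  proof -
    \<comment> \<open>The pair \<open>e i\<close>, \<open>e j\<close> turned by 45 degrees: the
      off-diagonal entry there is half the difference of the two diagonal entries.\<close>
    define u v where "u = (1 / sqrt 2) *\<^sub>R (e i + e j)" and "v = (1 / sqrt 2) *\<^sub>R (e i - e j)"
    have ee: "e i \<bullet> e i = 1" "e j \<bullet> e j = 1" "e i \<bullet> e j = 0" "e j \<bullet> e i = 0"
      using e that by (auto simp: norm_eq_1)
    have "norm u = 1" "norm v = 1" "u \<bullet> v = 0"
      unfolding norm_eq_1 u_def v_def
      by (simp_all add: inner_add_left inner_add_right inner_diff_left inner_diff_right ee)
    then have "4 * Q = (\<integral>\<^sup>+X. 4 * ennreal ((\<pi> X u v)\<^sup>2) \<partial>?P)"
      by (subst nn_integral_cmult) (auto simp: Q)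
    also have "\<dots> = (\<integral>\<^sup>+X. ennreal ((\<pi> X (e i) (e i) - \<pi> X (e j) (e j))\<^sup>2) \<partial>?P)"
    proof (intro nn_integral_cong)
      fix X
      have "\<pi> X (e i) (e j) = \<pi> X (e j) (e i)"
        unfolding \<pi>_def by (metis inner_commute inner_row_proj_sym)
      then have "\<pi> X u v = (\<pi> X (e i) (e i) - \<pi> X (e j) (e j)) / 2"
        unfolding \<pi>_def u_def v_def
        by (simp add: linear_diff [OF linear_row_proj] linear_scale [OF linear_row_proj]
            inner_add_left inner_diff_right add_divide_distrib diff_divide_distrib)
      then have "\<pi> X (e i) (e i) - \<pi> X (e j) (e j) = 2 * \<pi> X u v" by simp
      then have "4 * (\<pi> X u v)\<^sup>2 = (\<pi> X (e i) (e i) - \<pi> X (e j) (e j))\<^sup>2"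
        by (simp only: power_mult_distrib) simp
      then show "4 * ennreal ((\<pi> X u v)\<^sup>2) = ennreal ((\<pi> X (e i) (e i) - \<pi> X (e j) (e j))\<^sup>2)"
        by (metis ennreal_mult ennreal_numeral zero_le_numeral zero_le_power2)
    qed
    finally show ?thesis by simp
  qed
  \<comment> \<open>The weight \<open>2 * d\<close> makes the squared diagonal entries cancel in the
    sum over ordered pairs: the first terms give \<open>2 * d\<close> times their sum minus twice
    the squared trace, the second ones \<open>2 * d\<close> times the sum of all squared entries
    minus \<open>2 * d\<close> times the same sum. What remains is
    \<open>2 * d * n - 2 * n\<^sup>2\<close>.\<close>
  define T where "T X i j = (\<pi> X (e i) (e i) - \<pi> X (e j) (e j))\<^sup>2 + 2 * d * (\<pi> X (e i) (e j))\<^sup>2" for X i j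
  have [measurable]: "(\<lambda>X. T X i j) \<in> borel_measurable ?P" for i j unfolding T_def by measurable
  have d: "d \<ge> 0" by (simp add: d_def)
  have T_nonneg: "T X i j \<ge> 0" for X i j using d by (simp add: T_def)
  have T_int: "(\<integral>\<^sup>+X. ennreal (T X i j) \<partial>?P) = ennreal (4 + 2 * d) * Q" if "i \<noteq> j" for i j
  proof -
    have "(\<integral>\<^sup>+X. ennreal (T X i j) \<partial>?P) = (\<integral>\<^sup>+X. ennreal ((\<pi> X (e i) (e i) - \<pi> X (e j) (e j))\<^sup>2)
        + ennreal (2 * d) * ennreal ((\<pi> X (e i) (e j))\<^sup>2) \<partial>?P)"
      unfolding T_def using d by (intro nn_integral_cong) (simp add: ennreal_plus ennreal_mult)
    also have "\<dots> = 4 * Q + ennreal (2 * d) * Q"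
      using that e by (simp add: nn_integral_add nn_integral_cmult diag Q)
    also have "\<dots> = ennreal (4 + 2 * d) * Q"
      using d by (simp add: ennreal_plus distrib_right)
    finally show ?thesis .
  qed
  let ?D = "{(i, j). i \<noteq> (j :: 'd)}"
  have trace: "AE X in ?P. (\<Sum>(i, j)\<in>?D. T X i j) = 2 * real n * (d - real n)"
    using AE_gauss_rows_dim [OF \<sigma>, of n, where 'd = 'd]
  proof eventually_elim
    case (elim X)
    define p where "p i j = \<pi> X (e i) (e j)" for i j
    have tr: "(\<Sum>i\<in>UNIV. p i i) = real n"
      using sum_row_proj_trace [of n X] elim n by (simp add: p_def \<pi>_def e_def)
    have "(\<Sum>i\<in>UNIV. \<Sum>j\<in>UNIV. (p i j)\<^sup>2) = (\<Sum>j\<in>UNIV. \<Sum>i\<in>UNIV. (p i j)\<^sup>2)" by (rule sum.swap)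
    also have "\<dots> = (\<Sum>j\<in>UNIV. p j j)"
      by (simp add: p_def \<pi>_def e_def sum_axis_inner_sq norm_row_proj_sq)
    finally have sq: "(\<Sum>i\<in>UNIV. \<Sum>j\<in>UNIV. (p i j)\<^sup>2) = real n" using tr by simp
    have "(\<Sum>(i, j)\<in>?D. T X i j) = (\<Sum>(i, j)\<in>UNIV. if i \<noteq> j then T X i j else 0)"
      by (rule sum.mono_neutral_cong_left) auto
    also have "\<dots> = (\<Sum>i\<in>UNIV. \<Sum>j\<in>UNIV. if i \<noteq> j then T X i j else 0)"
      by (simp add: sum.cartesian_product)
    also have "\<dots> = (\<Sum>i\<in>UNIV. \<Sum>j\<in>UNIV. T X i j - (if j = i then 2 * d * (p i i)\<^sup>2 else 0))"
      by (intro sum.cong refl) (auto simp: T_def p_def)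
    also have "\<dots> = (\<Sum>i\<in>UNIV. \<Sum>j\<in>UNIV. T X i j) - 2 * d * (\<Sum>i\<in>UNIV. (p i i)\<^sup>2)"
      by (simp add: sum_subtractf sum_distrib_left)
    also have "(\<Sum>i\<in>UNIV. \<Sum>j\<in>UNIV. T X i j)
        = (\<Sum>i\<in>UNIV. \<Sum>j\<in>UNIV. (p i i)\<^sup>2 + (p j j)\<^sup>2 - 2 * (p i i * p j j) + 2 * d * (p i j)\<^sup>2)"
      by (intro sum.cong refl) (simp add: T_def p_def power2_diff)
    also have "\<dots> = d * (\<Sum>i\<in>UNIV. (p i i)\<^sup>2) + d * (\<Sum>i\<in>UNIV. (p i i)\<^sup>2)
        - 2 * ((\<Sum>i\<in>UNIV. p i i) * (\<Sum>j\<in>UNIV. p j j)) + 2 * d * (\<Sum>i\<in>UNIV. \<Sum>j\<in>UNIV. (p i j)\<^sup>2)"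
      by (simp add: sum.distrib sum_subtractf sum_distrib_left [symmetric] sum_product d_def)
    finally show ?case unfolding sq tr by (simp add: algebra_simps)
  qed
  have cardD: "real (card ?D) = d * (d - 1)"
  proof -
    have "?D = UNIV - (\<lambda>i. (i, i)) ` UNIV" by auto
    then have "card ?D = CARD('d) * CARD('d) - CARD('d)"
      by (simp add: card_Diff_subset card_image inj_on_def card_cartesian_product [of UNIV UNIV, simplified])
    then show ?thesis by (simp add: d_def algebra_simps of_nat_diff)
  qed
  have "ennreal (real (card ?D) * (4 + 2 * d)) * Q = (\<Sum>(i, j)\<in>?D. ennreal (4 + 2 * d) * Q)"
    using d by (simp add: ennreal_mult ennreal_of_nat_eq_real_of_nat mult.assoc)
  also have "\<dots> = (\<Sum>(i, j)\<in>?D. \<integral>\<^sup>+X. ennreal (T X i j) \<partial>?P)"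
    by (intro sum.cong refl) (auto simp: T_int)
  also have "\<dots> = (\<integral>\<^sup>+X. (\<Sum>(i, j)\<in>?D. ennreal (T X i j)) \<partial>?P)"
    unfolding split_beta by (rule nn_integral_sum [symmetric]) measurable
  also have "\<dots> = (\<integral>\<^sup>+X. ennreal (2 * real n * (d - real n)) \<partial>?P)"
  proof (rule nn_integral_cong_AE)
    show "AE X in ?P. (\<Sum>(i, j)\<in>?D. ennreal (T X i j)) = ennreal (2 * real n * (d - real n))"
      using trace
    proof eventually_elim
      case (elim X)
      have "(\<Sum>(i, j)\<in>?D. ennreal (T X i j)) = ennreal (\<Sum>(i, j)\<in>?D. T X i j)"
        unfolding split_beta by (rule sum_ennreal) (simp add: T_nonneg)
      then show ?case unfolding elim .
    qed
  qed
  also have "\<dots> = ennreal (2 * real n * (d - real n))" by (simp add: P.emeasure_space_1)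
  finally have eq: "ennreal (d * (d - 1) * (4 + 2 * d)) * Q = ennreal (2 * real n * (d - real n))"
    unfolding cardD .
  \<comment> \<open>The orthonormal pair \<open>a\<close>, \<open>b\<close> rules out dimension one,
    where the divisor \<open>d - 1\<close> would vanish.\<close>
  have d2: "d \<ge> 2"
  proof -
    have "CARD('d) \<noteq> 1"
    proof
      assume "CARD('d) = 1"
      then obtain k :: 'd where k: "UNIV = {k}" by (auto simp: card_1_singleton_iff)
      have "a \<bullet> b = a $ k * b $ k" "a \<bullet> a = a $ k * a $ k" "b \<bullet> b = b $ k * b $ k"
        by (simp_all add: inner_vec_def k)
      then show False using ab by (auto simp: norm_eq_1)
    qed
    moreover have "CARD('d) \<noteq> 0" by simp
    ultimately have "CARD('d) \<ge> 2" by linarith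
    then show ?thesis by (simp add: d_def)
  qed
  have "ennreal (d * (d - 1) * (4 + 2 * d)) * Q
      = ennreal (d * (d - 1) * (4 + 2 * d)) * ennreal (real n * (d - real n) / (d * (d - 1) * (d + 2)))"
  proof -
    define k where "k = d * (d - 1) * (d + 2)"
    have "d * (d - 1) * (4 + 2 * d) = k * 2" by (simp add: k_def algebra_simps)
    moreover have "k \<noteq> 0" using d2 by (simp add: k_def)
    ultimately have "d * (d - 1) * (4 + 2 * d) * (real n * (d - real n) / k) = 2 * real n * (d - real n)"
      by simp
    then show ?thesis
      unfolding eq k_def using d2 n by (subst ennreal_mult [symmetric]) (auto simp: d_def)
  qed
  then have "Q = ennreal (real n * (d - real n) / (d * (d - 1) * (d + 2)))"
    using d2 by (auto simp: ennreal_mult_cancel_left ennreal_eq_0_iff mult_le_0_iff)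
  then show ?thesis by (simp add: Q_def \<pi>_def d_def)
qed

lemma nn_integral_row_proj_sq:
  fixes a b :: "real^'d"
  assumes \<sigma>: "\<sigma> > 0" and ab: "norm a = 1" "a \<bullet> b = 0" and n: "n \<le> CARD('d)"
  shows "(\<integral>\<^sup>+X. ennreal ((a \<bullet> row_proj n X b)\<^sup>2) \<partial>PiM {..<n} (\<lambda>_. gauss_iso \<sigma>))
    = ennreal ((norm b)\<^sup>2 * (real n * (real CARD('d) - real n)) / (real CARD('d) * (real CARD('d) - 1) * (real CARD('d) + 2)))"
proof (cases "b = 0")
  case True
  then show ?thesis by (simp add: linear_0 [OF linear_row_proj])
next
  case False
  define b' where "b' = (1 / norm b) *\<^sub>R b"
  have b: "b = norm b *\<^sub>R b'" using False by (simp add: b'_def)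
  have b': "norm b' = 1" "a \<bullet> b' = 0" using False ab by (auto simp: b'_def)
  let ?v = "real n * (real CARD('d) - real n) / (real CARD('d) * (real CARD('d) - 1) * (real CARD('d) + 2))"
  have eq: "(a \<bullet> row_proj n X b)\<^sup>2 = (norm b)\<^sup>2 * (a \<bullet> row_proj n X b')\<^sup>2" for X
    by (subst b) (simp add: linear_scale [OF linear_row_proj] power_mult_distrib)
  have m: "(\<lambda>X. ennreal ((a \<bullet> row_proj n X b')\<^sup>2)) \<in> borel_measurable (PiM {..<n} (\<lambda>_. gauss_iso \<sigma>))"
    using borel_measurable_row_proj_rows by measurable
  have "(\<integral>\<^sup>+X. ennreal ((a \<bullet> row_proj n X b)\<^sup>2) \<partial>PiM {..<n} (\<lambda>_. gauss_iso \<sigma>))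
      = ennreal ((norm b)\<^sup>2) * (\<integral>\<^sup>+X. ennreal ((a \<bullet> row_proj n X b')\<^sup>2) \<partial>PiM {..<n} (\<lambda>_. gauss_iso \<sigma>))"
    unfolding eq by (subst nn_integral_cmult [OF m, symmetric]) (simp add: ennreal_mult)
  also have "\<dots> = ennreal ((norm b)\<^sup>2) * ennreal ?v"
    by (subst nn_integral_row_proj_sq_orthonormal [OF \<sigma> ab(1) b' n]) simp
  also have "\<dots> = ennreal ((norm b)\<^sup>2 * ?v)"
    by (rule ennreal_mult' [symmetric]) simp
  finally show ?thesis by simp
qed

section \<open>Noise, risk and orbit averaging\<close>

lemma nn_integral_affine_sq:
  fixes \<mu> :: "real measure"
  assumes \<mu>: "prob_space \<mu>" "sets \<mu> = sets borel" "integrable \<mu> (\<lambda>e. e\<^sup>2)"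
    and mean: "(\<integral>e. e \<partial>\<mu>) = 0" and var: "(\<integral>e. e\<^sup>2 \<partial>\<mu>) = s\<^sup>2"
  shows "(\<integral>\<^sup>+e. ennreal ((A + e * b)\<^sup>2) \<partial>\<mu>) = ennreal (A\<^sup>2 + s\<^sup>2 * b\<^sup>2)"
proof -
  interpret prob_space \<mu> by fact
  have "(\<lambda>e. e) \<in> borel_measurable \<mu>" using \<mu>(2) by (rule measurable_ident_sets)
  then have int: "integrable \<mu> (\<lambda>e. e)"
    using \<mu>(3) by (rule square_integrable_imp_integrable)
  have eq: "(A + e * b)\<^sup>2 = A\<^sup>2 + 2 * A * b * e + b\<^sup>2 * e\<^sup>2" for e
    by (simp add: power2_eq_square algebra_simps)
  have int2: "integrable \<mu> (\<lambda>e. A\<^sup>2 + 2 * A * b * e + b\<^sup>2 * e\<^sup>2)"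
    by (intro Bochner_Integration.integrable_add integrable_const integrable_mult_right int \<mu>(3))
  have "(\<integral>\<^sup>+e. ennreal ((A + e * b)\<^sup>2) \<partial>\<mu>) = (\<integral>\<^sup>+e. ennreal (A\<^sup>2 + 2 * A * b * e + b\<^sup>2 * e\<^sup>2) \<partial>\<mu>)"
    by (simp only: eq)
  also have "\<dots> = ennreal (\<integral>e. A\<^sup>2 + 2 * A * b * e + b\<^sup>2 * e\<^sup>2 \<partial>\<mu>)"
    by (rule nn_integral_eq_integral [OF int2], rule AE_I2) (simp only: eq [symmetric] zero_le_power2)
  also have "(\<integral>e. A\<^sup>2 + 2 * A * b * e + b\<^sup>2 * e\<^sup>2 \<partial>\<mu>) = A\<^sup>2 + b\<^sup>2 * s\<^sup>2"
    using int \<mu>(3) by (simp add: mean var prob_space)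
  finally show ?thesis by (simp only: mult.commute)
qed

text \<open>The last noise variable is integrated with the partial sum as constant term. Its zero
  mean removes the mixed product, so only mean and variance of the noise enter.\<close>

lemma nn_integral_noise_sq:
  fixes \<mu> :: "real measure" and n :: nat
  assumes \<mu>: "prob_space \<mu>" "sets \<mu> = sets borel" "integrable \<mu> (\<lambda>e. e\<^sup>2)"
    and mean: "(\<integral>e. e \<partial>\<mu>) = 0" and var: "(\<integral>e. e\<^sup>2 \<partial>\<mu>) = s\<^sup>2"
  shows "(\<integral>\<^sup>+\<xi>. ennreal ((A + (\<Sum>i<n. \<xi> i * b i))\<^sup>2) \<partial>PiM {..<n} (\<lambda>_. \<mu>)) = ennreal (A\<^sup>2 + s\<^sup>2 * (\<Sum>i<n. (b i)\<^sup>2))"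
proof (induction n)
  case 0
  interpret P: prob_space "PiM {} (\<lambda>_::nat. \<mu>)" by (intro prob_space_PiM \<mu>)
  show ?case by (simp add: P.emeasure_space_1)
next
  case (Suc n)
  interpret M: prob_space \<mu> by fact
  interpret product_sigma_finite "\<lambda>_::nat. \<mu>" by unfold_locales
  interpret P: prob_space "PiM {..<n} (\<lambda>_. \<mu>)" by (intro prob_space_PiM \<mu>)
  have comp: "(\<lambda>\<xi>. \<xi> i) \<in> borel_measurable (PiM I (\<lambda>_. \<mu>))" if "i \<in> I" for i I
    using measurable_component_singleton [of i I "\<lambda>_. \<mu>"] that \<mu>(2)
    by (simp add: measurable_cong_sets [OF refl \<mu>(2)])
  have sum_meas: "(\<lambda>\<xi>. A + (\<Sum>i<m. \<xi> i * b i)) \<in> borel_measurable (PiM I (\<lambda>_. \<mu>))" if "{..<m} \<subseteq> I" for m I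
    using that by (intro borel_measurable_add borel_measurable_sum borel_measurable_times comp) auto
  have "(\<integral>\<^sup>+\<xi>. ennreal ((A + (\<Sum>i<Suc n. \<xi> i * b i))\<^sup>2) \<partial>PiM (insert n {..<n}) (\<lambda>_. \<mu>))
      = (\<integral>\<^sup>+\<xi>. \<integral>\<^sup>+e. ennreal ((A + (\<Sum>i<Suc n. (\<xi>(n := e)) i * b i))\<^sup>2) \<partial>\<mu> \<partial>PiM {..<n} (\<lambda>_. \<mu>))"
  proof (rule product_nn_integral_insert)
    have [measurable]: "(\<lambda>\<xi>. A + (\<Sum>i<Suc n. \<xi> i * b i)) \<in> borel_measurable (PiM (insert n {..<n}) (\<lambda>_. \<mu>))"
      by (rule sum_meas) auto
    show "(\<lambda>\<xi>. ennreal ((A + (\<Sum>i<Suc n. \<xi> i * b i))\<^sup>2)) \<in> borel_measurable (PiM (insert n {..<n}) (\<lambda>_. \<mu>))"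
      by measurable
  qed auto
  also have "\<dots> = (\<integral>\<^sup>+\<xi>. ennreal ((A + (\<Sum>i<n. \<xi> i * b i))\<^sup>2) + ennreal (s\<^sup>2 * (b n)\<^sup>2) \<partial>PiM {..<n} (\<lambda>_. \<mu>))"
  proof (intro nn_integral_cong)
    fix \<xi> :: "nat \<Rightarrow> real"
    have "(\<Sum>i<n. (\<xi>(n := e)) i * b i) = (\<Sum>i<n. \<xi> i * b i)" for e by (intro sum.cong) auto
    then have "(\<integral>\<^sup>+e. ennreal ((A + (\<Sum>i<Suc n. (\<xi>(n := e)) i * b i))\<^sup>2) \<partial>\<mu>)
        = (\<integral>\<^sup>+e. ennreal (((A + (\<Sum>i<n. \<xi> i * b i)) + e * b n)\<^sup>2) \<partial>\<mu>)"
      by (simp add: add.assoc)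
    also have "\<dots> = ennreal ((A + (\<Sum>i<n. \<xi> i * b i))\<^sup>2 + s\<^sup>2 * (b n)\<^sup>2)"
      by (rule nn_integral_affine_sq [OF \<mu> mean var])
    finally show "(\<integral>\<^sup>+e. ennreal ((A + (\<Sum>i<Suc n. (\<xi>(n := e)) i * b i))\<^sup>2) \<partial>\<mu>)
        = ennreal ((A + (\<Sum>i<n. \<xi> i * b i))\<^sup>2) + ennreal (s\<^sup>2 * (b n)\<^sup>2)"
      by (simp add: ennreal_plus)
  qed
  also have "\<dots> = ennreal (A\<^sup>2 + s\<^sup>2 * (\<Sum>i<n. (b i)\<^sup>2)) + ennreal (s\<^sup>2 * (b n)\<^sup>2)"
  proof -
    have [measurable]: "(\<lambda>\<xi>. A + (\<Sum>i<n. \<xi> i * b i)) \<in> borel_measurable (PiM {..<n} (\<lambda>_. \<mu>))"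
      by (rule sum_meas) auto
    show ?thesis by (subst nn_integral_add) (auto simp: Suc.IH P.emeasure_space_1)
  qed
  also have "\<dots> = ennreal (A\<^sup>2 + s\<^sup>2 * (\<Sum>i<Suc n. (b i)\<^sup>2))"
    by (subst ennreal_plus [symmetric]) (auto simp: sum_nonneg algebra_simps)
  finally show ?case by (simp only: lessThan_Suc)
qed

lemma lsq_eq_row_proj:
  "lsq \<theta> n S = row_proj n (\<lambda>i. fst (S i)) \<theta> + (\<Sum>i<n. snd (S i) *\<^sub>R pinv_col n (\<lambda>i. fst (S i)) i)"
  by (simp add: lsq_eq_sum_pinv_col row_proj_def scaleR_add_left sum.distrib)

lemma borel_measurable_lsq:
  assumes "sets \<mu>\<xi> = sets borel"
  shows "(\<lambda>S. lsq \<theta> n S) \<in> borel_measurable (sample_law \<sigma>X \<mu>\<xi> n :: (nat \<Rightarrow> (real^'d) \<times> real) measure)"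
proof -
  let ?M = "PiM {..<n} (\<lambda>_. gauss_iso \<sigma>X \<Otimes>\<^sub>M \<mu>\<xi> :: ((real^'d) \<times> real) measure)"
  have comp: "(\<lambda>S. S i) \<in> ?M \<rightarrow>\<^sub>M gauss_iso \<sigma>X \<Otimes>\<^sub>M \<mu>\<xi>" if "i < n" for i
    using that by (intro measurable_component_singleton) auto
  have f: "(\<lambda>S. fst (S i)) \<in> borel_measurable ?M" if "i < n" for i
    using measurable_compose [OF comp [OF that] measurable_fst]
    by (simp add: measurable_cong_sets [OF refl sets_gauss_iso])
  have s: "(\<lambda>S. snd (S i)) \<in> borel_measurable ?M" if "i < n" for i
    using measurable_compose [OF comp [OF that] measurable_snd]
    by (simp add: measurable_cong_sets [OF refl assms])
  show ?thesis
    unfolding sample_law_def joint_law_def lsq_eq_row_proj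
    by (intro borel_measurable_add borel_measurable_row_proj borel_measurable_sum borel_measurable_scaleR
        borel_measurable_pinv_col f s borel_measurable_const) auto
qed

text \<open>With the design frozen, \<open>a \<bullet> lsq \<theta> n S\<close> is affine in the
  noise: the constant term is \<open>a \<bullet> row_proj n X \<theta>\<close>, and the coefficients
  \<open>a \<bullet> pinv_col n X i\<close> have sum of squares
  \<open>gram_pinv n X a\<close>.\<close>

lemma nn_integral_lsq_sq:
  fixes a \<theta> :: "real^'d"
  assumes \<sigma>: "\<sigma>X > 0" and \<mu>: "prob_space \<mu>\<xi>" "sets \<mu>\<xi> = sets borel" "integrable \<mu>\<xi> (\<lambda>e. e\<^sup>2)"
    and mean: "(\<integral>e. e \<partial>\<mu>\<xi>) = 0" and var: "(\<integral>e. e\<^sup>2 \<partial>\<mu>\<xi>) = \<sigma>\<xi>\<^sup>2"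
  shows "(\<integral>\<^sup>+S. ennreal ((a \<bullet> lsq \<theta> n S)\<^sup>2) \<partial>sample_law \<sigma>X \<mu>\<xi> n)
    = (\<integral>\<^sup>+X. ennreal ((a \<bullet> row_proj n X \<theta>)\<^sup>2) \<partial>PiM {..<n} (\<lambda>_. gauss_iso \<sigma>X))
      + ennreal (\<sigma>\<xi>\<^sup>2) * (\<integral>\<^sup>+X. ennreal (gram_pinv n X a) \<partial>PiM {..<n} (\<lambda>_. gauss_iso \<sigma>X))"
proof -
  let ?P = "PiM {..<n} (\<lambda>_. gauss_iso \<sigma>X :: (real^'d) measure)"
  have lsq_meas: "(\<lambda>S. ennreal ((a \<bullet> lsq \<theta> n S)\<^sup>2)) \<in> borel_measurable (PiM {..<n} (\<lambda>_. gauss_iso \<sigma>X \<Otimes>\<^sub>M \<mu>\<xi>))"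
    using borel_measurable_lsq [OF \<mu>(2), of \<theta> n \<sigma>X] unfolding sample_law_def joint_law_def by measurable
  have m [measurable]: "(\<lambda>X. row_proj n X \<theta>) \<in> borel_measurable ?P" "(\<lambda>X. gram_pinv n X a) \<in> borel_measurable ?P"
    by (rule borel_measurable_row_proj_rows borel_measurable_gram_pinv_rows)+
  have "(\<integral>\<^sup>+S. ennreal ((a \<bullet> lsq \<theta> n S)\<^sup>2) \<partial>sample_law \<sigma>X \<mu>\<xi> n)
      = (\<integral>\<^sup>+X. \<integral>\<^sup>+\<xi>. ennreal ((a \<bullet> lsq \<theta> n (\<lambda>i\<in>{..<n}. (X i, \<xi> i)))\<^sup>2) \<partial>PiM {..<n} (\<lambda>_. \<mu>\<xi>) \<partial>?P)"
    unfolding sample_law_def joint_law_def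
    by (intro nn_integral_PiM_pair lsq_meas prob_space_gauss_iso \<sigma> \<mu>) simp
  also have "\<dots> = (\<integral>\<^sup>+X. ennreal ((a \<bullet> row_proj n X \<theta>)\<^sup>2) + ennreal (\<sigma>\<xi>\<^sup>2) * ennreal (gram_pinv n X a) \<partial>?P)"
  proof (intro nn_integral_cong)
    fix X :: "nat \<Rightarrow> real^'d"
    have "a \<bullet> lsq \<theta> n (\<lambda>i\<in>{..<n}. (X i, \<xi> i)) = a \<bullet> row_proj n X \<theta> + (\<Sum>i<n. \<xi> i * (a \<bullet> pinv_col n X i))" for \<xi>
    proof -
      have "row_proj n (\<lambda>i. fst ((\<lambda>i\<in>{..<n}. (X i, \<xi> i)) i)) = row_proj n X" by (rule row_proj_cong) simp
      moreover have "pinv_col n (\<lambda>i. fst ((\<lambda>i\<in>{..<n}. (X i, \<xi> i)) i)) j = pinv_col n X j" if "j < n" for j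
        using that by (intro pinv_col_cong) simp
      ultimately show ?thesis
        unfolding lsq_eq_row_proj by (simp add: inner_add_right inner_sum_right)
    qed
    then have "(\<integral>\<^sup>+\<xi>. ennreal ((a \<bullet> lsq \<theta> n (\<lambda>i\<in>{..<n}. (X i, \<xi> i)))\<^sup>2) \<partial>PiM {..<n} (\<lambda>_. \<mu>\<xi>))
        = ennreal ((a \<bullet> row_proj n X \<theta>)\<^sup>2 + \<sigma>\<xi>\<^sup>2 * gram_pinv n X a)"
      using nn_integral_noise_sq [OF \<mu> mean var] by (simp add: gram_pinv_def)
    then show "(\<integral>\<^sup>+\<xi>. ennreal ((a \<bullet> lsq \<theta> n (\<lambda>i\<in>{..<n}. (X i, \<xi> i)))\<^sup>2) \<partial>PiM {..<n} (\<lambda>_. \<mu>\<xi>))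
        = ennreal ((a \<bullet> row_proj n X \<theta>)\<^sup>2) + ennreal (\<sigma>\<xi>\<^sup>2) * ennreal (gram_pinv n X a)"
      by (simp add: ennreal_mult ennreal_plus gram_pinv_def sum_nonneg)
  qed
  also have "\<dots> = (\<integral>\<^sup>+X. ennreal ((a \<bullet> row_proj n X \<theta>)\<^sup>2) \<partial>?P) + ennreal (\<sigma>\<xi>\<^sup>2) * (\<integral>\<^sup>+X. ennreal (gram_pinv n X a) \<partial>?P)"
    by (subst nn_integral_add) (auto simp: nn_integral_cmult)
  finally show ?thesis .
qed

section \<open>Risk of linear predictors\<close>

text \<open>Resampling along the normalised \<open>v\<close> reduces the integral to the variance of
  one normal variable.\<close>

lemma nn_integral_gauss_iso_inner_sq:
  fixes v :: "real^'d"
  assumes \<sigma>: "\<sigma> > 0"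
  shows "(\<integral>\<^sup>+x. ennreal ((v \<bullet> x)\<^sup>2) \<partial>gauss_iso \<sigma>) = ennreal (\<sigma>\<^sup>2 * (norm v)\<^sup>2)"
proof (cases "v = 0")
  case False
  interpret prob_space "gauss_iso \<sigma> :: (real^'d) measure" using \<sigma> by (rule prob_space_gauss_iso)
  define b where "b = (1 / norm v) *\<^sub>R v"
  have "norm b = 1" using False by (simp add: b_def)
  then have b: "norm b = 1" "b \<bullet> b = 1" by (auto simp: norm_eq_1)
  have v: "v = norm v *\<^sub>R b" using False by (simp add: b_def)
  have "has_bochner_integral lborel (\<lambda>x. normal_density 0 \<sigma> x * (x - 0) ^ (2 * 1)) (fact (2 * 1) / ((2 / \<sigma>\<^sup>2) ^ 1 * fact 1))"
    using \<sigma> by (rule normal_moment_even)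
  then have second: "has_bochner_integral lborel (\<lambda>x. normal_density 0 \<sigma> x * x\<^sup>2) (\<sigma>\<^sup>2)"
    using \<sigma> by simp
  have normal: "(\<integral>\<^sup>+c. ennreal (c\<^sup>2) \<partial>normal_law \<sigma>) = ennreal (\<sigma>\<^sup>2)"
  proof -
    have "(\<integral>\<^sup>+c. ennreal (c\<^sup>2) \<partial>normal_law \<sigma>) = (\<integral>\<^sup>+c. ennreal (normal_density 0 \<sigma> c * c\<^sup>2) \<partial>lborel)"
      unfolding normal_law_def by (subst nn_integral_density) (auto simp: ennreal_mult)
    also have "\<dots> = ennreal (\<sigma>\<^sup>2)"
      using second by (subst nn_integral_eq_integral) (auto simp: has_bochner_integral_iff)
    finally show ?thesis .
  qed
  have "(\<integral>\<^sup>+x. ennreal ((v \<bullet> x)\<^sup>2) \<partial>gauss_iso \<sigma>)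
      = (\<integral>\<^sup>+x. \<integral>\<^sup>+c. ennreal ((v \<bullet> (x + (c - b \<bullet> x) *\<^sub>R b))\<^sup>2) \<partial>normal_law \<sigma> \<partial>gauss_iso \<sigma>)"
    by (rule nn_integral_gauss_iso_resample_along [OF \<sigma> b(1)]) measurable
  also have "\<dots> = (\<integral>\<^sup>+(x::real^'d). \<integral>\<^sup>+c. ennreal ((norm v)\<^sup>2) * ennreal (c\<^sup>2) \<partial>normal_law \<sigma> \<partial>gauss_iso \<sigma>)"
  proof (intro nn_integral_cong)
    fix x :: "real^'d" and c
    have "b \<bullet> (x + (c - b \<bullet> x) *\<^sub>R b) = c" by (simp add: inner_add_right b)
    then have "v \<bullet> (x + (c - b \<bullet> x) *\<^sub>R b) = norm v * c"
      by (subst v) (simp only: inner_scaleR_left)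
    then show "ennreal ((v \<bullet> (x + (c - b \<bullet> x) *\<^sub>R b))\<^sup>2) = ennreal ((norm v)\<^sup>2) * ennreal (c\<^sup>2)"
      by (simp add: power_mult_distrib ennreal_mult)
  qed
  also have "\<dots> = ennreal ((norm v)\<^sup>2) * ennreal (\<sigma>\<^sup>2)"
    using emeasure_space_1 by (simp add: nn_integral_cmult normal)
  finally show ?thesis by (simp add: ennreal_mult [symmetric] mult.commute)
qed simp

text \<open>The input covariance is a multiple of the identity, so the excess risk is a Euclidean
  distance; the noise variance is a constant that cancels in the gap.\<close>

lemma risk_linear:
  fixes u \<theta> :: "real^'d"
  assumes \<sigma>: "\<sigma>X > 0" and \<mu>: "prob_space \<mu>\<xi>" "sets \<mu>\<xi> = sets borel" "integrable \<mu>\<xi> (\<lambda>e. e\<^sup>2)"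
    and mean: "(\<integral>e. e \<partial>\<mu>\<xi>) = 0" and var: "(\<integral>e. e\<^sup>2 \<partial>\<mu>\<xi>) = \<sigma>\<xi>\<^sup>2"
  shows "risk \<sigma>X \<mu>\<xi> \<theta> (\<lambda>x. u \<bullet> x) = \<sigma>X\<^sup>2 * (norm (u - \<theta>))\<^sup>2 + \<sigma>\<xi>\<^sup>2"
proof -
  interpret M: prob_space \<mu>\<xi> by fact
  interpret G: prob_space "gauss_iso \<sigma>X :: (real^'d) measure" using \<sigma> by (rule prob_space_gauss_iso)
  have [measurable_cong]: "sets \<mu>\<xi> = sets borel" by fact
  have "(\<integral>\<^sup>+z. ennreal ((u \<bullet> fst z - (\<theta> \<bullet> fst z + snd z))\<^sup>2) \<partial>joint_law \<sigma>X \<mu>\<xi>)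
      = (\<integral>\<^sup>+x. \<integral>\<^sup>+e. ennreal ((u \<bullet> x - (\<theta> \<bullet> x + e))\<^sup>2) \<partial>\<mu>\<xi> \<partial>gauss_iso \<sigma>X)"
    unfolding joint_law_def by (subst M.nn_integral_fst [symmetric]) auto
  also have "\<dots> = (\<integral>\<^sup>+x. ennreal (((u - \<theta>) \<bullet> x)\<^sup>2) + ennreal (\<sigma>\<xi>\<^sup>2) \<partial>gauss_iso \<sigma>X)"
  proof (intro nn_integral_cong)
    fix x :: "real^'d"
    have *: "u \<bullet> x - (\<theta> \<bullet> x + e) = (u - \<theta>) \<bullet> x + e * (-1)" for e by (simp add: inner_diff_left)
    show "(\<integral>\<^sup>+e. ennreal ((u \<bullet> x - (\<theta> \<bullet> x + e))\<^sup>2) \<partial>\<mu>\<xi>) = ennreal (((u - \<theta>) \<bullet> x)\<^sup>2) + ennreal (\<sigma>\<xi>\<^sup>2)"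
      unfolding * nn_integral_affine_sq [OF \<mu> mean var] by (simp add: ennreal_plus)
  qed
  also have "\<dots> = ennreal (\<sigma>X\<^sup>2 * (norm (u - \<theta>))\<^sup>2) + ennreal (\<sigma>\<xi>\<^sup>2)"
    using G.emeasure_space_1 by (subst nn_integral_add) (auto simp: nn_integral_gauss_iso_inner_sq [OF \<sigma>])
  also have "\<dots> = ennreal (\<sigma>X\<^sup>2 * (norm (u - \<theta>))\<^sup>2 + \<sigma>\<xi>\<^sup>2)" by (simp add: ennreal_plus)
  finally have nn: "(\<integral>\<^sup>+z. ennreal ((u \<bullet> fst z - (\<theta> \<bullet> fst z + snd z))\<^sup>2) \<partial>joint_law \<sigma>X \<mu>\<xi>)
      = ennreal (\<sigma>X\<^sup>2 * (norm (u - \<theta>))\<^sup>2 + \<sigma>\<xi>\<^sup>2)" .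
  have "(\<lambda>z. (u \<bullet> fst z - (\<theta> \<bullet> fst z + snd z))\<^sup>2) \<in> borel_measurable (joint_law \<sigma>X \<mu>\<xi>)"
    unfolding joint_law_def by measurable
  then show ?thesis
    unfolding risk_def by (subst integral_eq_nn_integral) (simp_all add: nn del: ennreal_plus)
qed

section \<open>The orbit average as an orthogonal projection\<close>

lemma linear_matrix_vector_mult_left: "linear (\<lambda>A::real^'d^'m. A *v w)"
  by (intro linearI) (auto simp: matrix_vector_mult_add_rdistrib scaleR_matrix_vector_assoc)

context
  fixes H :: "('g::{topological_group_add, t2_space}) measure"
    and \<phi> :: "'g \<Rightarrow> real^'d^'d"
  assumes haar: "haar_prob H"
    and rep_hom: "\<And>g h. \<phi> (g + h) = \<phi> g ** \<phi> h"
    and rep_orth: "\<And>g. orthogonal_matrix (\<phi> g)"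
    and rep_cont: "continuous_on UNIV \<phi>"
begin

lemma inner_rep: "(\<phi> g *v x) \<bullet> (\<phi> g *v y) = x \<bullet> y"
  using rep_orth [of g] orthogonal_transformation_matrix [of "(*v) (\<phi> g)"]
  by (simp add: orthogonal_transformation_def)

lemma integrable_rep: "integrable H (\<lambda>g. \<phi> g *v w)"
proof -
  interpret H: prob_space H using haar by (simp add: haar_prob_def)
  have sets: "sets H = sets borel" using haar by (simp add: haar_prob_def)
  have "continuous_on UNIV (\<lambda>g. \<phi> g *v w)"
    using continuous_on_compose2 [OF linear_continuous_on rep_cont, of "\<lambda>A. A *v w" UNIV]
      linear_matrix_vector_mult_left [of w] by (simp add: linear_conv_bounded_linear)
  then have "(\<lambda>g. \<phi> g *v w) \<in> borel_measurable H"
    using borel_measurable_continuous_onI measurable_cong_sets [OF sets refl] by blast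
  moreover have "norm (\<phi> g *v w) = norm w" for g
    by (simp add: norm_eq_sqrt_inner inner_rep)
  ultimately show ?thesis
    by (intro H.integrable_const_bound [where B = "norm w"]) auto
qed

text \<open>The homomorphism property turns the action of \<open>k\<close> into a left translation,
  which the Haar measure absorbs.\<close>

lemma rep_orbit_avg: "\<phi> k *v orbit_avg H \<phi> w = orbit_avg H \<phi> w"
proof -
  have sets: "sets H = sets borel" using haar by (simp add: haar_prob_def)
  then have space: "space H = UNIV" using sets_eq_imp_space_eq [OF sets] by simp
  have "(\<lambda>h. k + h) \<in> borel \<rightarrow>\<^sub>M borel"
    by (intro borel_measurable_continuous_onI continuous_intros)
  then have meas: "(\<lambda>h. k + h) \<in> H \<rightarrow>\<^sub>M H"
    using measurable_cong_sets [OF sets sets] by simp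
  have "distr H H (\<lambda>h. k + h) = H"
  proof (rule measure_eqI)
    fix B assume "B \<in> sets (distr H H (\<lambda>h. k + h))"
    then have B: "B \<in> sets borel" "B \<in> sets H" using sets by simp_all
    \<comment> \<open>\<open>haar_prob\<close> speaks of images of left translations and
      \<open>distr\<close> of preimages; translating by \<open>- k\<close> converts one into the
      other.\<close>
    have "(\<lambda>h. k + h) -` B = (\<lambda>h. - k + h) ` B"
    proof (intro set_eqI iffI)
      fix x assume "x \<in> (\<lambda>h. k + h) -` B"
      then show "x \<in> (\<lambda>h. - k + h) ` B"
        by (intro image_eqI [of _ _ "k + x"]) (auto simp: add.assoc [symmetric])
    qed (auto simp: add.assoc [symmetric])
    then show "emeasure (distr H H (\<lambda>h. k + h)) B = emeasure H B"
      using haar B by (subst emeasure_distr [OF meas]) (auto simp: space haar_prob_def)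
  qed simp
  then have "orbit_avg H \<phi> w = (\<integral>g. \<phi> g *v w \<partial>distr H H (\<lambda>h. k + h))"
    by (simp add: orbit_avg_def)
  also have "\<dots> = (\<integral>g. \<phi> (k + g) *v w \<partial>H)"
    using integrable_rep [of w] by (intro integral_distr meas) auto
  also have "\<dots> = (\<integral>g. \<phi> k *v (\<phi> g *v w) \<partial>H)"
    by (simp add: rep_hom matrix_vector_mul_assoc)
  also have "\<dots> = \<phi> k *v (\<integral>g. \<phi> g *v w \<partial>H)"
    by (intro integral_bounded_linear matrix_vector_mul_bounded_linear integrable_rep)
  finally show ?thesis by (simp add: orbit_avg_def)
qed

text \<open>Because every \<open>\<phi> g\<close> preserves inner products, a vector fixed by all of
  them is invariant in the sense of \<open>inv_params\<close>.\<close>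

lemma orbit_avg_in_inv_params: "orbit_avg H \<phi> w \<in> inv_params \<phi>"
  unfolding inv_params_def using inner_rep [of _ "orbit_avg H \<phi> w"] by (auto simp: rep_orbit_avg)

text \<open>For invariant \<open>u\<close> the integrand is constant on the group. Combined with
  membership of the average in \<open>inv_params\<close>, this identifies it as the orthogonal
  projection.\<close>

lemma inner_orbit_avg:
  assumes "u \<in> inv_params \<phi>"
  shows "u \<bullet> orbit_avg H \<phi> w = u \<bullet> w"
proof -
  interpret H: prob_space H using haar by (simp add: haar_prob_def)
  have "u \<bullet> orbit_avg H \<phi> w = (\<integral>g. u \<bullet> (\<phi> g *v w) \<partial>H)"
    unfolding orbit_avg_def by (intro integral_inner_right [symmetric]) (rule integrable_rep)
  also have "\<dots> = (\<integral>g. u \<bullet> w \<partial>H)" using assms by (simp add: inv_params_def)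
  finally show ?thesis by (simp add: H.prob_space)
qed

lemma subspace_inv_params: "subspace (inv_params \<phi>)"
  by (auto simp: subspace_def inv_params_def inner_add_left)

lemma diff_orbit_avg_in_orthogonal_comp: "w - orbit_avg H \<phi> w \<in> orthogonal_comp (inv_params \<phi>)"
  by (auto simp: orthogonal_comp_def orthogonal_def inner_diff_right inner_orbit_avg)

text \<open>The average and \<open>\<theta>\<close> are both invariant, so their difference is
  orthogonal to the discarded part of \<open>w\<close>, and Pythagoras applies.\<close>

lemma norm_diff_orbit_avg:
  assumes \<theta>: "\<theta> \<in> inv_params \<phi>"
  shows "(norm (w - \<theta>))\<^sup>2 - (norm (orbit_avg H \<phi> w - \<theta>))\<^sup>2 = (norm (w - orbit_avg H \<phi> w))\<^sup>2"
proof -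
  let ?u = "orbit_avg H \<phi> w"
  have "?u - \<theta> \<in> inv_params \<phi>"
    by (intro subspace_diff subspace_inv_params orbit_avg_in_inv_params \<theta>)
  then have "(?u - \<theta>) \<bullet> (w - ?u) = 0" by (simp add: inner_diff_right inner_orbit_avg)
  moreover have "w - \<theta> = (?u - \<theta>) + (w - ?u)" by simp
  ultimately have "(norm (w - \<theta>))\<^sup>2 = (norm (?u - \<theta>))\<^sup>2 + (norm (w - ?u))\<^sup>2"
    by (metis norm_add_Pythagorean orthogonal_def)
  then show ?thesis by simp
qed

text \<open>Members of \<open>B\<close> are orthogonal to the invariant average, so the coordinates
  of the discarded part can be read off from \<open>w\<close> itself.\<close>

lemma norm_diff_orbit_avg_orthonormal:
  assumes "pairwise orthogonal B" "\<And>b. b \<in> B \<Longrightarrow> norm b = 1" "finite B"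
    and "span B = orthogonal_comp (inv_params \<phi>)"
  shows "(norm (w - orbit_avg H \<phi> w))\<^sup>2 = (\<Sum>a\<in>B. (a \<bullet> w)\<^sup>2)"
proof -
  have "(norm (w - orbit_avg H \<phi> w))\<^sup>2 = (\<Sum>a\<in>B. (a \<bullet> (w - orbit_avg H \<phi> w))\<^sup>2)"
    using assms diff_orbit_avg_in_orthogonal_comp [of w] by (intro sum_inner_orthonormal_sq [symmetric]) auto
  also have "\<dots> = (\<Sum>a\<in>B. (a \<bullet> w)\<^sup>2)"
  proof (intro sum.cong refl)
    fix a assume "a \<in> B"
    then have "a \<in> orthogonal_comp (inv_params \<phi>)" using assms(4) span_base by blast
    then have "a \<bullet> orbit_avg H \<phi> w = 0"
      using orbit_avg_in_inv_params [of w] by (auto simp: orthogonal_comp_def orthogonal_def inner_commute)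
    then show "(a \<bullet> (w - orbit_avg H \<phi> w))\<^sup>2 = (a \<bullet> w)\<^sup>2" by (simp add: inner_diff_right)
  qed
  finally show ?thesis .
qed

end

section \<open>The generalisation gap in the three regimes\<close>

theorem theorem4p1:
  fixes H :: "('g::{topological_group_add, t2_space}) measure"
    and \<phi> :: "'g \<Rightarrow> real^'d^'d"
    and \<theta> :: "real^'d"
    and \<sigma>X \<sigma>\<xi> :: real
    and \<mu>\<xi> :: "real measure"
    and n :: nat
  assumes compact_G: "compact (UNIV :: 'g set)"
    and haar: "haar_prob H"
    and rep_hom: "\<And>g h. \<phi> (g + h) = \<phi> g ** \<phi> h"
    and rep_zero: "\<phi> 0 = mat 1"
    and rep_orth: "\<And>g. orthogonal_matrix (\<phi> g)"
    and rep_cont: "continuous_on UNIV \<phi>"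
    and \<theta>_inv: "\<theta> \<in> inv_params \<phi>"
    and \<sigma>X_pos: "\<sigma>X > 0"
    and \<sigma>\<xi>_nonneg: "\<sigma>\<xi> \<ge> 0"
    and \<xi>_prob: "prob_space \<mu>\<xi>"
    and \<xi>_sets: "sets \<mu>\<xi> = sets borel"
    and \<xi>_sq_int: "integrable \<mu>\<xi> (\<lambda>e. e\<^sup>2)"
    and \<xi>_mean: "(\<integral>e. e \<partial>\<mu>\<xi>) = 0"
    and \<xi>_var: "(\<integral>e. e\<^sup>2 \<partial>\<mu>\<xi>) = \<sigma>\<xi>\<^sup>2"
  shows
   "let d = real CARD('d);
        M = sample_law \<sigma>X \<mu>\<xi> n;
        R = risk \<sigma>X \<mu>\<xi> \<theta>;
        w = lsq \<theta> n;
        \<Phi> = orbit_avg H \<phi>;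
        dimA = real (dim (orthogonal_comp (inv_params \<phi>)));
        gap = (\<lambda>S. R (\<lambda>x. w S \<bullet> x) - R (\<lambda>x. \<Phi> (w S) \<bullet> x));
        admissible = (\<lambda>h'::(nat \<Rightarrow> (real^'d) \<times> real) \<Rightarrow> real^'d \<Rightarrow> real.
           AE S in M. integrable (joint_law \<sigma>X \<mu>\<xi>)
                         (\<lambda>z. (h' S (fst z) - (\<theta> \<bullet> fst z + snd z))\<^sup>2)
                     \<and> R (h' S) \<le> R (\<lambda>x. \<Phi> (w S) \<bullet> x));
        gap' = (\<lambda>h' S. R (\<lambda>x. w S \<bullet> x) - R (h' S))
    in
    (real n > d + 1 \<longrightarrow>
        has_bochner_integral M gap (\<sigma>\<xi>\<^sup>2 * dimA / (real n - d - 1)) \<and>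
        (\<forall>h'. admissible h' \<longrightarrow>
           (\<integral>\<^sup>+ S. ennreal (gap' h' S) \<partial>M) \<ge> ennreal (\<sigma>\<xi>\<^sup>2 * dimA / (real n - d - 1))))
   \<and> (d - 1 \<le> real n \<and> real n \<le> d + 1 \<and> \<sigma>\<xi> > 0 \<and>
       \<not> (AE S in M. \<Phi> (w S) = w S) \<longrightarrow>
        (\<integral>\<^sup>+ S. ennreal (gap S) \<partial>M) = \<infinity> \<and>
        (\<forall>h'. admissible h' \<longrightarrow> (\<integral>\<^sup>+ S. ennreal (gap' h' S) \<partial>M) = \<infinity>))
   \<and> (real n < d - 1 \<longrightarrow>
        has_bochner_integral M gap
          (dimA * (\<sigma>X\<^sup>2 * (norm \<theta>)\<^sup>2 * (real n * (d - real n)) / (d * (d - 1) * (d + 2))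
                   + \<sigma>\<xi>\<^sup>2 * real n / (d * (d - real n - 1)))) \<and>
        (\<forall>h'. admissible h' \<longrightarrow>
           (\<integral>\<^sup>+ S. ennreal (gap' h' S) \<partial>M)
             \<ge> ennreal (dimA * (\<sigma>X\<^sup>2 * (norm \<theta>)\<^sup>2 * (real n * (d - real n)) / (d * (d - 1) * (d + 2))
                   + \<sigma>\<xi>\<^sup>2 * real n / (d * (d - real n - 1))))))"
proof -
  define d where "d = real CARD('d)"
  define M where "M = (sample_law \<sigma>X \<mu>\<xi> n :: (nat \<Rightarrow> (real^'d) \<times> real) measure)"
  define R where "R = risk \<sigma>X \<mu>\<xi> \<theta>"
  define w where "w = lsq \<theta> n"
  define \<Phi> where "\<Phi> = orbit_avg H \<phi>"
  define A where "A = orthogonal_comp (inv_params \<phi>)"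
  define gap where "gap S = R (\<lambda>x. w S \<bullet> x) - R (\<lambda>x. \<Phi> (w S) \<bullet> x)" for S
  let ?P = "PiM {..<n} (\<lambda>_. gauss_iso \<sigma>X :: (real^'d) measure)"
  obtain B where B: "B \<subseteq> A" "pairwise orthogonal B" "\<And>b. b \<in> B \<Longrightarrow> norm b = 1"
      "independent B" "card B = dim A" "span B = A"
    using orthonormal_basis_subspace [OF subspace_orthogonal_comp] unfolding A_def by metis
  have fin: "finite B" using B(4) by (rule independent_imp_finite)
  have a\<theta>: "a \<bullet> \<theta> = 0" if "a \<in> B" for a
    using that B(1) \<theta>_inv by (force simp: A_def orthogonal_comp_def orthogonal_def inner_commute)
  note norm_avg = norm_diff_orbit_avg [OF haar rep_hom rep_orth rep_cont]
  have proj: "(norm (v - \<Phi> v))\<^sup>2 = (\<Sum>a\<in>B. (a \<bullet> v)\<^sup>2)" for v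
    unfolding \<Phi>_def
    using B fin by (intro norm_diff_orbit_avg_orthonormal [OF haar rep_hom rep_orth rep_cont]) (auto simp: A_def)
  have gap: "gap S = \<sigma>X\<^sup>2 * (\<Sum>a\<in>B. (a \<bullet> w S)\<^sup>2)" for S
    unfolding proj [symmetric] norm_avg [OF \<theta>_inv, symmetric] \<Phi>_def gap_def R_def
    by (simp add: risk_linear [OF \<sigma>X_pos \<xi>_prob \<xi>_sets \<xi>_sq_int \<xi>_mean \<xi>_var] right_diff_distrib)
  have w_meas [measurable]: "w \<in> borel_measurable M"
    using borel_measurable_lsq [OF \<xi>_sets] by (simp add: w_def M_def)
  have gap_meas [measurable]: "gap \<in> borel_measurable M" unfolding gap by measurable
  have gap_nonneg: "gap S \<ge> 0" for S unfolding gap by (simp add: sum_nonneg)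
  define E where "E a = (\<integral>\<^sup>+X. ennreal ((a \<bullet> row_proj n X \<theta>)\<^sup>2) \<partial>?P)
      + ennreal (\<sigma>\<xi>\<^sup>2) * (\<integral>\<^sup>+X. ennreal (gram_pinv n X a) \<partial>?P)" for a
  have nn_gap: "(\<integral>\<^sup>+S. ennreal (gap S) \<partial>M) = ennreal (\<sigma>X\<^sup>2) * (\<Sum>a\<in>B. E a)"
  proof -
    have "(\<integral>\<^sup>+S. ennreal (gap S) \<partial>M) = (\<integral>\<^sup>+S. ennreal (\<sigma>X\<^sup>2) * (\<Sum>a\<in>B. ennreal ((a \<bullet> w S)\<^sup>2)) \<partial>M)"
      unfolding gap by (simp add: ennreal_mult sum_nonneg)
    also have "\<dots> = ennreal (\<sigma>X\<^sup>2) * (\<Sum>a\<in>B. \<integral>\<^sup>+S. ennreal ((a \<bullet> w S)\<^sup>2) \<partial>M)"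
      by (simp add: nn_integral_cmult nn_integral_sum del: sum_ennreal)
    also have "(\<Sum>a\<in>B. \<integral>\<^sup>+S. ennreal ((a \<bullet> w S)\<^sup>2) \<partial>M) = (\<Sum>a\<in>B. E a)"
      unfolding E_def w_def M_def
      by (intro sum.cong refl nn_integral_lsq_sq \<sigma>X_pos \<xi>_prob \<xi>_sets \<xi>_sq_int \<xi>_mean \<xi>_var)
    finally show ?thesis .
  qed
  \<comment> \<open>All unit vectors of \<open>B\<close> contribute the same amount and
    \<open>B\<close> has \<open>dim A\<close> elements, whence the factor
    \<open>dim A\<close>.\<close>
  have gap_value: "has_bochner_integral M gap (real (dim A) * v)"
    if v: "v \<ge> 0" "\<And>a. a \<in> B \<Longrightarrow> ennreal (\<sigma>X\<^sup>2) * E a = ennreal v" for v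
  proof -
    have "(\<integral>\<^sup>+S. ennreal (gap S) \<partial>M) = (\<Sum>a\<in>B. ennreal v)"
      unfolding nn_gap sum_distrib_left using v by (intro sum.cong refl) simp
    also have "\<dots> = ennreal (real (dim A) * v)"
      using v B(5) by (simp add: ennreal_mult ennreal_of_nat_eq_real_of_nat)
    finally show ?thesis
      using gap_nonneg v by (intro has_bochner_integral_nn_integral) auto
  qed
  \<comment> \<open>A lower risk of \<open>h' S\<close> can only widen the gap. The comparison of
    nonnegative integrals holds for any such \<open>h'\<close>, measurable in \<open>S\<close> or
    not.\<close>
  have mono: "(\<integral>\<^sup>+S. ennreal (gap S) \<partial>M) \<le> (\<integral>\<^sup>+S. ennreal (R (\<lambda>x. w S \<bullet> x) - R (h' S)) \<partial>M)"
    if "AE S in M. integrable (joint_law \<sigma>X \<mu>\<xi>) (\<lambda>z. (h' S (fst z) - (\<theta> \<bullet> fst z + snd z))\<^sup>2)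
        \<and> R (h' S) \<le> R (\<lambda>x. \<Phi> (w S) \<bullet> x)" for h' :: "(nat \<Rightarrow> (real^'d) \<times> real) \<Rightarrow> real^'d \<Rightarrow> real"
    by (rule nn_integral_mono_AE, rule eventually_mono [OF that]) (simp add: gap_def ennreal_leI)
  have nn_eq: "(\<integral>\<^sup>+S. ennreal (gap S) \<partial>M) = ennreal v" if "has_bochner_integral M gap v" for v
    using that gap_nonneg by (subst nn_integral_eq_integral) (auto simp: has_bochner_integral_iff)

  have over: "has_bochner_integral M gap (\<sigma>\<xi>\<^sup>2 * real (dim A) / (real n - d - 1))" if n: "real n > d + 1"
  proof -
    have n': "n > CARD('d) + 1" using n by (simp add: d_def)
    have "ennreal (\<sigma>X\<^sup>2) * E a = ennreal (\<sigma>\<xi>\<^sup>2 / (real n - d - 1))" if a: "a \<in> B" for a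
    proof -
      \<comment> \<open>With at least \<open>d\<close> rows the projection is almost surely the
        identity, and the bias \<open>a \<bullet> \<theta>\<close> is zero.\<close>
      have "AE X in ?P. row_proj n X \<theta> = \<theta>"
        using AE_gauss_rows_full_rank [OF \<sigma>X_pos, of n, where 'd = 'd] n'
        by (auto elim!: eventually_mono simp: row_proj_eq_self_iff)
      then have "(\<integral>\<^sup>+X. ennreal ((a \<bullet> row_proj n X \<theta>)\<^sup>2) \<partial>?P) = (\<integral>\<^sup>+X. 0 \<partial>?P)"
        by (intro nn_integral_cong_AE) (auto elim!: eventually_mono simp: a\<theta> [OF a])
      then have "E a = ennreal (\<sigma>\<xi>\<^sup>2) * ennreal (1 / (\<sigma>X\<^sup>2 * (real n - d - 1)))"
        unfolding E_def using nn_integral_gram_pinv_overdetermined [OF \<sigma>X_pos B(3) [OF a], of n] n'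
        by (simp add: d_def)
      then show ?thesis
        using n \<sigma>X_pos by (simp add: ennreal_mult [symmetric])
    qed
    then have "has_bochner_integral M gap (real (dim A) * (\<sigma>\<xi>\<^sup>2 / (real n - d - 1)))"
      using n by (intro gap_value) auto
    then show ?thesis by (simp add: mult.commute)
  qed

  have threshold: "(\<integral>\<^sup>+S. ennreal (gap S) \<partial>M) = \<infinity>"
    if n: "d - 1 \<le> real n" "real n \<le> d + 1" and \<sigma>\<xi>: "\<sigma>\<xi> > 0" and neq: "\<not> (AE S in M. \<Phi> (w S) = w S)"
  proof -
    have fixed: "\<Phi> v = v" if "(\<Sum>a\<in>B. (a \<bullet> v)\<^sup>2) = 0" for v
      using that unfolding proj [symmetric] by simp
    \<comment> \<open>An empty basis would make every estimate invariant.\<close>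
    have "B \<noteq> {}" using neq fixed by auto
    then obtain a where a: "a \<in> B" by blast
    \<comment> \<open>The range of \<open>n\<close> admits \<open>n = 0\<close> when
      \<open>d = 1\<close>; the estimate is then zero, which is invariant.\<close>
    have "n \<noteq> 0"
    proof
      assume "n = 0"
      then have "w S = 0" for S by (simp add: w_def lsq_eq_sum_pinv_col)
      then show False using neq fixed [of 0] by simp
    qed
    have "(\<integral>\<^sup>+X. ennreal (gram_pinv n X a) \<partial>?P) = \<infinity>"
    proof (cases "n \<ge> CARD('d)")
      case True
      then show ?thesis
        using nn_integral_gram_pinv_overdetermined [OF \<sigma>X_pos B(3) [OF a] True] n(2) by (simp add: d_def)
    next
      case False
      then show ?thesis
        using n(1) \<open>n \<noteq> 0\<close> by (intro nn_integral_gram_pinv_threshold \<sigma>X_pos B(3) [OF a]) (auto simp: d_def)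
    qed
    then have "E a = \<infinity>" using \<sigma>\<xi> by (simp add: E_def ennreal_mult_top)
    then have "(\<Sum>a\<in>B. E a) = \<infinity>"
      using a fin by (metis infinity_ennreal_def member_le_sum top.extremum_unique zero_le)
    then show ?thesis unfolding nn_gap using \<sigma>X_pos by (simp add: ennreal_mult_top)
  qed

  let ?u = "\<sigma>X\<^sup>2 * (norm \<theta>)\<^sup>2 * (real n * (d - real n)) / (d * (d - 1) * (d + 2)) + \<sigma>\<xi>\<^sup>2 * real n / (d * (d - real n - 1))"
  have under: "has_bochner_integral M gap (real (dim A) * ?u)" if n: "real n < d - 1"
  proof (rule gap_value)
    have n': "n + 1 < CARD('d)" using n by (simp add: d_def)
    have d: "d > 1" using n by linarith
    \<comment> \<open>\<open>x\<close> is the second moment of the bias along \<open>a\<close> and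
      \<open>y\<close> the noise contribution per unit of noise variance, both before the factor
      \<open>\<sigma>X\<^sup>2\<close> of the risk.\<close>
    define x y where "x = (norm \<theta>)\<^sup>2 * (real n * (d - real n)) / (d * (d - 1) * (d + 2))"
      and "y = real n / (d * (\<sigma>X\<^sup>2 * (d - real n - 1)))"
    have xy: "x \<ge> 0" "y \<ge> 0" using n d by (auto simp: x_def y_def)
    have u: "?u = \<sigma>X\<^sup>2 * (x + \<sigma>\<xi>\<^sup>2 * y)"
      using \<sigma>X_pos by (simp add: x_def y_def distrib_left)
    then show "?u \<ge> 0" using xy by simp
    fix a assume a: "a \<in> B"
    have "E a = ennreal x + ennreal (\<sigma>\<xi>\<^sup>2) * ennreal y"
      using nn_integral_row_proj_sq [OF \<sigma>X_pos B(3) [OF a] a\<theta> [OF a], of n]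
        nn_integral_gram_pinv_underdetermined [OF \<sigma>X_pos B(3) [OF a] n'] n'
      by (simp add: E_def x_def y_def d_def)
    then have "E a = ennreal (x + \<sigma>\<xi>\<^sup>2 * y)"
      using xy by (simp add: ennreal_mult ennreal_plus)
    then show "ennreal (\<sigma>X\<^sup>2) * E a = ennreal ?u"
      unfolding u using xy by (simp add: ennreal_mult)
  qed

  show ?thesis
    unfolding Let_def d_def [symmetric] M_def [symmetric] R_def [symmetric] w_def [symmetric]
      \<Phi>_def [symmetric] A_def [symmetric] gap_def [symmetric]
  proof (intro conjI impI allI)
    fix h' assume n: "real n > d + 1"
      and "AE S in M. integrable (joint_law \<sigma>X \<mu>\<xi>) (\<lambda>z. (h' S (fst z) - (\<theta> \<bullet> fst z + snd z))\<^sup>2)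
        \<and> R (h' S) \<le> R (\<lambda>x. \<Phi> (w S) \<bullet> x)"
    from mono [OF this(2)] nn_eq [OF over [OF n]]
    show "ennreal (\<sigma>\<xi>\<^sup>2 * real (dim A) / (real n - d - 1)) \<le> (\<integral>\<^sup>+S. ennreal (R (\<lambda>x. w S \<bullet> x) - R (h' S)) \<partial>M)"
      by simp
  next
    fix h' assume n: "d - 1 \<le> real n \<and> real n \<le> d + 1 \<and> \<sigma>\<xi> > 0 \<and> \<not> (AE S in M. \<Phi> (w S) = w S)"
      and "AE S in M. integrable (joint_law \<sigma>X \<mu>\<xi>) (\<lambda>z. (h' S (fst z) - (\<theta> \<bullet> fst z + snd z))\<^sup>2)
        \<and> R (h' S) \<le> R (\<lambda>x. \<Phi> (w S) \<bullet> x)"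
    from mono [OF this(2)] threshold n
    show "(\<integral>\<^sup>+S. ennreal (R (\<lambda>x. w S \<bullet> x) - R (h' S)) \<partial>M) = \<infinity>"
      by (simp add: top_unique)
  next
    fix h' assume n: "real n < d - 1"
      and "AE S in M. integrable (joint_law \<sigma>X \<mu>\<xi>) (\<lambda>z. (h' S (fst z) - (\<theta> \<bullet> fst z + snd z))\<^sup>2)
        \<and> R (h' S) \<le> R (\<lambda>x. \<Phi> (w S) \<bullet> x)"
    from mono [OF this(2)] nn_eq [OF under [OF n]]
    show "ennreal (real (dim A) * ?u) \<le> (\<integral>\<^sup>+S. ennreal (R (\<lambda>x. w S \<bullet> x) - R (h' S)) \<partial>M)"
      by simp
  qed (use over threshold under in auto)
qed

end
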